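(* A real $X\in 2^\omega$ is Solovay-$\Sigma^1_1$-generic if and only if $X$ is $\Pi^1_1$-random.
   Context: Work in Cantor space $2^\omega$ with the uniform measure $\lambda$. $X$ is $\Pi^1_1$-random if $X$ belongs to no $\Pi^1_1$ (lightface) class of measure $0$. A $\Sigma^1_1$ closed set is a closed subset of $2^\omega$ which is $\Sigma^1_1$. A sequence $(F_n)$ of sets of reals is uniformly $\Sigma^1_1$ if $\{(n,X):X\in F_n\}$ is $\Sigma^1_1$. $X$ is Solovay-$\Sigma^1_1$-generic if for every uniformly $\Sigma^1_1$ sequence $(F_n)_{n\in\omega}$ of closed sets each of positive measure, either $X\in F_n$ for some $n$, or there is a $\Sigma^1_1$ closed set $G$ of positive measure with $G\cap\bigcup_nF_n=\emptyset$ and $X\in G$. *)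

theory Defs
  imports "HOL-Probability.Probability"
begin

type_synonym cantor = "nat \<Rightarrow> bool"

text \<open>
  The product topology on the type \<^typ>\<open>cantor\<close> is its library topology, since \<^typ>\<open>bool\<close> is
  discrete. The measure is completed because \<open>\<Pi>\<^sup>1\<^sub>1\<close> classes need not be Borel (they are
  universally measurable).
\<close>

definition cantor_measure :: "cantor measure" where
  "cantor_measure = completion (PiM UNIV (\<lambda>_. measure_pmf (bernoulli_pmf (1/2))))"

instance bool :: second_countable_topology
proof
  have "open S = generate_topology (UNIV :: bool set set) S" for S
    by (simp add: generate_topology.Basis Topological_Spaces.open_discrete)
  then show "\<exists>B::bool set set. countable B \<and> open = generate_topology B"
    by (intro exI[of _ UNIV]) auto
qed

lemma closed_in_sets_cantor_measure:
  fixes F :: "cantor set"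
  shows "closed F \<Longrightarrow> F \<in> sets cantor_measure"
  unfolding cantor_measure_def
proof (rule sets_completionI_sets)
  assume "closed F"
  have "sets (PiM UNIV (\<lambda>_. measure_pmf (bernoulli_pmf (1/2)))) = sets (PiM UNIV (\<lambda>_::nat. borel :: bool measure))"
    by (rule sets_PiM_cong) (auto simp: sets_borel_eq_count_space)
  also have "\<dots> = sets borel" by (rule sets_PiM_equal_borel)
  finally show "F \<in> sets (PiM UNIV (\<lambda>_. measure_pmf (bernoulli_pmf (1/2))))"
    using \<open>closed F\<close> by auto
qed

text \<open>
  The lightface classes are those definable without parameters by formulas of second-order
  arithmetic. Number variables and set variables are separate sorts, both named by natural numbers.
\<close>

datatype tm =
    Var nat
  | Zero
  | One
  | Plus tm tm
  | Times tm tm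

datatype form =
    Eq tm tm
  | Less tm tm
  | Mem tm nat
  | Neg form
  | Conj form form
  | ExNum nat form
  | ExSet nat form
  | AllSet nat form

primrec tmval :: "(nat \<Rightarrow> nat) \<Rightarrow> tm \<Rightarrow> nat" where
  "tmval e (Var x) = e x"
| "tmval e Zero = 0"
| "tmval e One = 1"
| "tmval e (Plus a b) = tmval e a + tmval e b"
| "tmval e (Times a b) = tmval e a * tmval e b"

primrec sat :: "(nat \<Rightarrow> nat) \<Rightarrow> (nat \<Rightarrow> cantor) \<Rightarrow> form \<Rightarrow> bool" where
  "sat e s (Eq a b) \<longleftrightarrow> tmval e a = tmval e b"
| "sat e s (Less a b) \<longleftrightarrow> tmval e a < tmval e b"
| "sat e s (Mem a Y) \<longleftrightarrow> s Y (tmval e a)"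
| "sat e s (Neg \<phi>) \<longleftrightarrow> \<not> sat e s \<phi>"
| "sat e s (Conj \<phi> \<psi>) \<longleftrightarrow> sat e s \<phi> \<and> sat e s \<psi>"
| "sat e s (ExNum x \<phi>) \<longleftrightarrow> (\<exists>n. sat (e(x := n)) s \<phi>)"
| "sat e s (ExSet Y \<phi>) \<longleftrightarrow> (\<exists>Z. sat e (s(Y := Z)) \<phi>)"
| "sat e s (AllSet Y \<phi>) \<longleftrightarrow> (\<forall>Z. sat e (s(Y := Z)) \<phi>)"

primrec arithmetical :: "form \<Rightarrow> bool" where
  "arithmetical (Eq a b) \<longleftrightarrow> True"
| "arithmetical (Less a b) \<longleftrightarrow> True"
| "arithmetical (Mem a Y) \<longleftrightarrow> True"
| "arithmetical (Neg \<phi>) \<longleftrightarrow> arithmetical \<phi>"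
| "arithmetical (Conj \<phi> \<psi>) \<longleftrightarrow> arithmetical \<phi> \<and> arithmetical \<psi>"
| "arithmetical (ExNum x \<phi>) \<longleftrightarrow> arithmetical \<phi>"
| "arithmetical (ExSet Y \<phi>) \<longleftrightarrow> False"
| "arithmetical (AllSet Y \<phi>) \<longleftrightarrow> False"

inductive Sigma11_form :: "form \<Rightarrow> bool" where
  "arithmetical \<phi> \<Longrightarrow> Sigma11_form \<phi>"
| "Sigma11_form \<phi> \<Longrightarrow> Sigma11_form (ExSet Y \<phi>)"

inductive Pi11_form :: "form \<Rightarrow> bool" where
  "arithmetical \<phi> \<Longrightarrow> Pi11_form \<phi>"
| "Pi11_form \<phi> \<Longrightarrow> Pi11_form (AllSet Y \<phi>)"

text \<open>
  In the definitions below, set variable \<open>0\<close> stands for \<open>X\<close> and, in the uniform version, number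
  variable \<open>0\<close> for the index. Quantifying over
  all assignments \<open>e\<close>, \<open>s\<close> to the remaining variables is what excludes parameters.
\<close>

definition Sigma11_class :: "cantor set \<Rightarrow> bool" where
  "Sigma11_class A \<longleftrightarrow>
     (\<exists>\<phi>. Sigma11_form \<phi> \<and> (\<forall>X e s. X \<in> A \<longleftrightarrow> sat e (s(0 := X)) \<phi>))"

definition Pi11_class :: "cantor set \<Rightarrow> bool" where
  "Pi11_class A \<longleftrightarrow>
     (\<exists>\<phi>. Pi11_form \<phi> \<and> (\<forall>X e s. X \<in> A \<longleftrightarrow> sat e (s(0 := X)) \<phi>))"

lemma Pi11_form_negation:
  assumes "Sigma11_form f"
  shows "\<exists>g. Pi11_form g \<and> (\<forall>e s. sat e s g = (\<not> sat e s f))"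
  using assms
proof induction
  case (1 f) then show ?case by (intro exI[of _ "Neg f"]) (auto intro: Pi11_form.intros)
next
  case (2 f Y) then obtain g where "Pi11_form g" "(\<forall>e s. sat e s g = (\<not> sat e s f))" by auto
  then show ?case by (intro exI[of _ "AllSet Y g"]) (auto intro: Pi11_form.intros)
qed

lemma Pi11_class_Compl: "Sigma11_class A \<Longrightarrow> Pi11_class (-A)"
  unfolding Sigma11_class_def Pi11_class_def by (metis Pi11_form_negation ComplD ComplI)

definition uniformly_Sigma11 :: "(nat \<Rightarrow> cantor set) \<Rightarrow> bool" where
  "uniformly_Sigma11 F \<longleftrightarrow>
     (\<exists>\<phi>. Sigma11_form \<phi> \<and> (\<forall>n X e s. X \<in> F n \<longleftrightarrow> sat (e(0 := n)) (s(0 := X)) \<phi>))"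


definition Pi11_random :: "cantor \<Rightarrow> bool" where
  "Pi11_random X \<longleftrightarrow> \<not> (\<exists>A. Pi11_class A \<and> A \<in> null_sets cantor_measure \<and> X \<in> A)"

definition Solovay_Sigma11_generic :: "cantor \<Rightarrow> bool" where
  "Solovay_Sigma11_generic X \<longleftrightarrow>
     (\<forall>F. uniformly_Sigma11 F \<and> (\<forall>n. closed (F n) \<and> emeasure cantor_measure (F n) > 0) \<longrightarrow>
        (\<exists>n. X \<in> F n) \<or>
        (\<exists>G. Sigma11_class G \<and> closed G \<and> emeasure cantor_measure G > 0 \<and>
             G \<inter> (\<Union>n. F n) = {} \<and> X \<in> G))"

end

theory Submission
  imports Defs
begin

text \<open>
  Every \<open>\<Pi>\<^sup>1\<^sub>1\<close> class consists of the \<open>Y\<close> for which a tree hyperarithmetical in \<open>Y\<close> has no infinite path. Ranks of trees are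
  compared by simulations, so no ordinals occur; the role of the computable ordinals is played by the
  well-founded members of a sequence \<open>tree e\<close> of trees, diagonal in a universal tree, and the only recursion-theoretic
  input is that \<open>{e. tree e well-founded}\<close> is not \<open>\<Sigma>\<^sup>1\<^sub>1\<close>. Since ``measure \<open>> q\<close>'' preserves \<open>\<Sigma>\<^sup>1\<^sub>1\<close>, a class whose measure
  separated the well-founded \<open>e\<close> from the others would contradict this. In this way the \<open>Y\<close> whose tree is
  well-founded, but exceeds all well-founded \<open>tree e\<close>, are seen to form a null class, and
  \<open>{Y. rank \<ge> e}\<close> and \<open>{Y. rank \<le> e}\<close> are, up to null sets, unions of \<open>\<Sigma>\<^sup>1\<^sub>1\<close> closed subsets for each well-founded \<open>tree e\<close>.

  A random \<open>X\<close> outside all \<open>F n\<close> has a well-founded tree of the rank of a node of some \<open>tree e\<close>, and hence lies in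
  such a closed subset avoiding all \<open>F n\<close>. If a generic \<open>X\<close> lay in a \<open>\<Pi>\<^sup>1\<^sub>1\<close> null class, take a node \<open>t\<close> of its tree of minimal
  rank above all well-founded \<open>tree e\<close>, and apply genericity to closed approximations of the classes ``the
  child \<open>t'\<close> of \<open>t\<close> has rank above all well-founded \<open>tree e\<close>''. This gives a \<open>\<Sigma>\<^sup>1\<^sub>1\<close> class containing \<open>X\<close> which is null, again
  by diagonalization, and a generic real avoids \<open>\<Sigma>\<^sup>1\<^sub>1\<close> null classes.
\<close>

section \<open>Definability by arithmetical and \<open>\<Sigma>\<^sup>1\<^sub>1\<close> formulas\<close>

text \<open>Genericity sees only closed classes that are uniformly \<open>Sigma11\<close>, whereas a
  comparison of ranks defines a class that is \<open>Sigma11\<close> but in general not closed.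
  Bounding the answers in the simulation game makes the class closed, by compactness; the difficulty
  is to choose the bounds so that obeying them remains \<open>Sigma11\<close>. The bound chosen is
  the least \<open>w\<close> at which the loss, the class \<open>gap\<close>, has measure at most a
  given \<epsilon>. To respect it means that the loss exceeds \<epsilon> at every smaller
  \<open>w\<close>, and lower bounds on measures of \<open>Sigma11\<close> classes are
  \<open>Sigma11\<close>, provided that \<open>gap\<close> is so itself. This class mentions failed
  comparisons; failure is seen to be \<open>Sigma11\<close> when one side is well-founded, since it
  then says that some move leads to a rank at least that of the other side. Hence the condition
  \<open>stable\<close>, which asks for a tree that is the same for all reals and well-founded below
  the given node; the well-founded \<open>tree e\<close> are of this kind.\<close>

text \<open>Quantifiers over predicates of assignments are treated in de Bruijn style: variable 0 is the bound one.\<close>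

abbreviation sh :: "(nat \<Rightarrow> 'a) \<Rightarrow> nat \<Rightarrow> 'a" where
  "sh e \<equiv> (\<lambda>j. e (Suc j))"

abbreviation pr :: "nat \<Rightarrow> nat \<Rightarrow> nat" where
  "pr x y \<equiv> prod_encode (x, y)"

section \<open>Renaming of variables\<close>

primrec tm_bound :: "tm \<Rightarrow> nat" where
  "tm_bound (Var x) = Suc x"
| "tm_bound Zero = 0"
| "tm_bound One = 0"
| "tm_bound (Plus a b) = max (tm_bound a) (tm_bound b)"
| "tm_bound (Times a b) = max (tm_bound a) (tm_bound b)"

primrec num_bound :: "form \<Rightarrow> nat" where
  "num_bound (Eq a b) = max (tm_bound a) (tm_bound b)"
| "num_bound (Less a b) = max (tm_bound a) (tm_bound b)"
| "num_bound (Mem a Y) = tm_bound a"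
| "num_bound (Neg f) = num_bound f"
| "num_bound (Conj f g) = max (num_bound f) (num_bound g)"
| "num_bound (ExNum x f) = max (Suc x) (num_bound f)"
| "num_bound (ExSet Y f) = num_bound f"
| "num_bound (AllSet Y f) = num_bound f"

primrec tren :: "tm \<Rightarrow> (nat \<Rightarrow> nat) \<Rightarrow> tm" where
  "tren (Var x) r = Var (r x)"
| "tren Zero r = Zero"
| "tren One r = One"
| "tren (Plus a b) r = Plus (tren a r) (tren b r)"
| "tren (Times a b) r = Times (tren a r) (tren b r)"

text \<open>The bound variable is renamed to one above every value of the renaming, to avoid capture.\<close>

primrec ren :: "form \<Rightarrow> (nat \<Rightarrow> nat) \<Rightarrow> (nat \<Rightarrow> nat) \<Rightarrow> form" where
  "ren (Eq a b) r q = Eq (tren a r) (tren b r)"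
| "ren (Less a b) r q = Less (tren a r) (tren b r)"
| "ren (Mem a Y) r q = Mem (tren a r) (q Y)"
| "ren (Neg f) r q = Neg (ren f r q)"
| "ren (Conj f g) r q = Conj (ren f r q) (ren g r q)"
| "ren (ExNum x f) r q =
     (let m = Suc (\<Sum>i<num_bound f. r i) in ExNum m (ren f (r(x := m)) q))"
| "ren (ExSet Y f) r q = ExSet Y f"
| "ren (AllSet Y f) r q = AllSet Y f"

lemma tmval_cong: "(\<And>i. i < tm_bound t \<Longrightarrow> e i = e' i) \<Longrightarrow> tmval e t = tmval e' t"
  by (induction t) auto

lemma sat_cong_num:
  "(\<And>i. i < num_bound f \<Longrightarrow> e i = e' i) \<Longrightarrow> sat e s f = sat e' s f"
proof (induction f arbitrary: e e' s)
  case (Eq a b)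
  then have "tmval e a = tmval e' a" "tmval e b = tmval e' b" by (auto intro!: tmval_cong)
  then show ?case by simp
next
  case (Less a b)
  then have "tmval e a = tmval e' a" "tmval e b = tmval e' b" by (auto intro!: tmval_cong)
  then show ?case by simp
next
  case (Mem a Y)
  then have "tmval e a = tmval e' a" by (auto intro!: tmval_cong)
  then show ?case by simp
next
  case (Neg f)
  then show ?case by (metis num_bound.simps(4) sat.simps(4))
next
  case (Conj f g)
  have "sat e s f = sat e' s f" "sat e s g = sat e' s g"
    by (rule Conj; use Conj.prems in simp)+
  then show ?case by simp
next
  case (ExNum x f)
  have "sat (e(x := n)) s f = sat (e'(x := n)) s f" for n
    by (rule ExNum.IH) (use ExNum.prems in auto)
  then show ?case by simp
next
  case (ExSet Y f)
  have "sat e s' f = sat e' s' f" for s'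
    by (rule ExSet.IH) (use ExSet.prems in auto)
  then show ?case by simp
next
  case (AllSet Y f)
  have "sat e s' f = sat e' s' f" for s'
    by (rule AllSet.IH) (use AllSet.prems in auto)
  then show ?case by simp
qed

lemma tmval_tren: "tmval e (tren t r) = tmval (e \<circ> r) t"
  by (induction t) auto

lemma arithmetical_ren: "arithmetical f \<Longrightarrow> arithmetical (ren f r q)"
  by (induction f arbitrary: r q) (auto simp: Let_def)

lemma sat_ren:
  "arithmetical f \<Longrightarrow> sat e s (ren f r q) = sat (e \<circ> r) (s \<circ> q) f"
proof (induction f arbitrary: e r)
  case (ExNum x f)
  define m where "m = Suc (\<Sum>i<num_bound f. r i)"
  have "sat (e(m := n)) s (ren f (r(x := m)) q) = sat ((e \<circ> r)(x := n)) (s \<circ> q) f" for n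
  proof -
    have "sat (e(m := n)) s (ren f (r(x := m)) q)
          = sat ((e(m := n)) \<circ> (r(x := m))) (s \<circ> q) f"
      by (rule ExNum.IH) (use ExNum.prems in simp)
    also have "\<dots> = sat ((e \<circ> r)(x := n)) (s \<circ> q) f"
    proof (rule sat_cong_num)
      fix i assume i: "i < num_bound f"
      have "r i \<le> (\<Sum>i<num_bound f. r i)" using i by (intro member_le_sum) auto
      then show "((e(m := n)) \<circ> (r(x := m))) i = ((e \<circ> r)(x := n)) i"
        by (auto simp: m_def)
    qed
    finally show ?thesis .
  qed
  then show ?case by (simp add: Let_def m_def comp_def)
qed (auto simp: tmval_tren)

text \<open>Speaking of predicates of assignments instead of formulas reduces later definability
  proofs to closure rules that follow the shape of the predicate.\<close>

definition Arith :: "((nat \<Rightarrow> nat) \<Rightarrow> (nat \<Rightarrow> cantor) \<Rightarrow> bool) \<Rightarrow> bool" where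
  "Arith P \<longleftrightarrow> (\<exists>f. arithmetical f \<and> (\<forall>e s. sat e s f = P e s))"

lemma Arith_Eq: "Arith (\<lambda>e s. tmval e a = tmval e b)"
  unfolding Arith_def by (rule exI[of _ "Eq a b"]) auto

lemma Arith_less: "Arith (\<lambda>e s. e i < e j)"
  unfolding Arith_def by (rule exI[of _ "Less (Var i) (Var j)"]) auto

lemma Arith_mem: "Arith (\<lambda>e s. s i (e j))"
  unfolding Arith_def by (rule exI[of _ "Mem (Var j) i"]) auto

lemma Arith_not: "Arith P \<Longrightarrow> Arith (\<lambda>e s. \<not> P e s)"
  unfolding Arith_def by (metis arithmetical.simps(4) sat.simps(4))

lemma Arith_conj: "Arith P \<Longrightarrow> Arith Q \<Longrightarrow> Arith (\<lambda>e s. P e s \<and> Q e s)"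
  unfolding Arith_def by (metis arithmetical.simps(5) sat.simps(5))

lemma Arith_disj:
  assumes "Arith P" "Arith Q"
  shows "Arith (\<lambda>e s. P e s \<or> Q e s)"
  using Arith_not[OF Arith_conj[OF Arith_not[OF assms(1)] Arith_not[OF assms(2)]]] by simp

lemma Arith_ren:
  assumes "Arith P" shows "Arith (\<lambda>e s. P (\<lambda>j. e (r j)) (\<lambda>j. s (q j)))"
proof -
  obtain f where "arithmetical f" "\<And>e s. sat e s f = P e s" using assms unfolding Arith_def by auto
  then show ?thesis
    unfolding Arith_def by (intro exI[of _ "ren f r q"]) (auto simp: arithmetical_ren sat_ren comp_def)
qed

lemma Arith_ex:
  assumes "Arith (\<lambda>e s. P (e 0) (sh e) s)" shows "Arith (\<lambda>e s. \<exists>n. P n e s)"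
proof -
  obtain f where f: "arithmetical f" "\<And>e s. sat e s f = P (e 0) (sh e) s"
    using assms unfolding Arith_def by auto
  \<comment> \<open>All variables of \<open>f\<close> lie below \<open>m\<close>. After 0 is renamed
    to \<open>m\<close> and each \<open>Suc j\<close> to \<open>j\<close>, the variable
    \<open>m\<close> stands for the bound number only.\<close>
  define m where "m = num_bound f"
  have "sat (e(m := n)) s (ren f (case_nat m id) id) = P n e s" for e n s
  proof -
    have "sat (e(m := n)) s (ren f (case_nat m id) id) = sat ((e(m := n)) \<circ> case_nat m id) s f"
      using f by (simp add: sat_ren)
    also have "\<dots> = sat (case_nat n e) s f"
      by (rule sat_cong_num) (auto simp: m_def split: nat.splits)
    finally show ?thesis using f by simp
  qed
  then show ?thesis
    unfolding Arith_def using f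
    by (intro exI[of _ "ExNum m (ren f (case_nat m id) id)"]) (auto simp: arithmetical_ren)
qed

lemma Arith_all:
  assumes "Arith (\<lambda>e s. P (e 0) (sh e) s)" shows "Arith (\<lambda>e s. \<forall>n. P n e s)"
  using Arith_not[OF Arith_ex[where P = "\<lambda>n e s. \<not> P n e s", OF Arith_not[OF assms]]] by simp

lemma tmval_sh: "tmval (\<lambda>i. e (r i)) t = tmval e (tren t r)"
  by (simp add: tmval_tren comp_def)

text \<open>Atoms \<open>Mem\<close> are replaced by the definitions of the reals
  \<open>G i\<close>. Under a number quantifier the formula sees the new value while
  \<open>G i\<close> must still see the outer assignment; the renaming \<open>r\<close> lets the two
  drift apart in the induction.\<close>

lemma Arith_sat_subst:
  "arithmetical f \<Longrightarrow> (\<And>i. Arith (\<lambda>e s. G i (sh e) s (e 0))) \<Longrightarrow>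
   Arith (\<lambda>e s. sat (\<lambda>i. e (r i)) (\<lambda>i. G i e s) f)"
proof (induction f arbitrary: r G)
  case (Eq a b)
  show ?case using Arith_Eq[of "tren a r" "tren b r"] by (simp add: tmval_sh)
next
  case (Less a b)
  have "Arith (\<lambda>e s. \<exists>x. x = tmval e (tren a r) \<and> (\<exists>y. y = tmval e (tren b r) \<and> x < y))"
    using Arith_Eq[of "Var 0" "tren a (Suc \<circ> r)"] Arith_Eq[of "Var 0" "tren b (Suc \<circ> (Suc \<circ> r))"]
    by (intro Arith_ex Arith_conj Arith_less) (auto simp: tmval_tren comp_def)
  then show ?case by (simp add: tmval_sh)
next
  case (Mem a Y)
  have "Arith (\<lambda>e s. \<exists>x. x = tmval e (tren a r) \<and> G Y e s x)"
    using Arith_Eq[of "Var 0" "tren a (Suc \<circ> r)"] Mem(2)[of Y]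
    by (intro Arith_ex Arith_conj) (auto simp: tmval_tren comp_def)
  then show ?case by (simp add: tmval_sh)
next
  case (Neg f)
  then show ?case by (auto intro: Arith_not)
next
  case (Conj f g)
  then show ?case by (auto intro: Arith_conj)
next
  case (ExNum x f)
  have "Arith (\<lambda>e s. \<exists>n. sat ((\<lambda>i. e (r i))(x := n)) (\<lambda>i. G i e s) f)"
  proof (rule Arith_ex)
    have "Arith (\<lambda>e s. sat (\<lambda>i. e (((\<lambda>i. Suc (r i))(x := 0)) i)) (\<lambda>i. G i (sh e) s) f)"
    proof (rule ExNum.IH)
      show "arithmetical f" using ExNum by simp
      show "Arith (\<lambda>e s. G i (sh (sh e)) s (e 0))" for i
        using Arith_ren[OF ExNum.prems(2)[of i], of "case_nat 0 (\<lambda>j. Suc (Suc j))" id] by simp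
    qed
    moreover have "(\<lambda>i. e (((\<lambda>i. Suc (r i))(x := 0)) i)) = (\<lambda>i. e (Suc (r i)))(x := e 0)" for e :: "nat \<Rightarrow> nat"
      by auto
    ultimately show "Arith (\<lambda>e s. sat ((\<lambda>i. e (Suc (r i)))(x := e 0)) (\<lambda>i. G i (sh e) s) f)"
      by (simp only:)
  qed
  then show ?case by simp
qed auto

lemma Arith_subst:
  assumes "Arith Q" "\<And>i. Arith (\<lambda>e s. G i (sh e) s (e 0))"
  shows "Arith (\<lambda>e s. Q e (\<lambda>i. G i e s))"
proof -
  obtain f where f: "arithmetical f" "\<And>e s. sat e s f = Q e s"
    using assms unfolding Arith_def by auto
  show ?thesis using Arith_sat_subst[OF f(1) assms(2), where r = id] f by simp
qed

text \<open>Doubling removes the division from the triangular numbers, so that the graph of the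
  pairing function is a polynomial equation and thus an atomic formula.\<close>

lemma pr_eq_iff: "z = pr x y \<longleftrightarrow> z + z = (x + y) * (x + y + 1) + (x + x)"
proof -
  have "2 * triangle (x + y) = (x + y) * (x + y + 1)" by (simp add: triangle_def)
  then have "2 * pr x y = (x + y) * (x + y + 1) + 2 * x"
    by (simp add: prod_encode_def)
  then show ?thesis by linarith
qed

lemma Arith_pr: "Arith (\<lambda>e s. e i = pr (e j) (e k))"
  unfolding pr_eq_iff
  using Arith_Eq[of "Plus (Var i) (Var i)" "Plus (Times (Plus (Var j) (Var k)) (Plus (Plus (Var j) (Var k)) One)) (Plus (Var j) (Var j))"]
  by simp

lemma Arith_mem_pr: "Arith (\<lambda>e s. s i (pr (e j) (e k)))"
proof -
  have "Arith (\<lambda>e s. \<exists>m. m = pr (e j) (e k) \<and> s i m)"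
    by (intro Arith_ex Arith_conj Arith_pr Arith_mem)
  then show ?thesis by simp
qed

lemma tmval_const: "\<exists>t. \<forall>e. tmval e t = c"
proof (induction c)
  case 0 then show ?case by (intro exI[of _ Zero]) auto
next
  case (Suc c)
  then obtain t where "\<forall>e. tmval e t = c" by auto
  then show ?case by (intro exI[of _ "Plus t One"]) auto
qed

lemma Arith_const_eq: "Arith (\<lambda>e s. e i = c)"
proof -
  obtain t where "\<forall>e. tmval e t = c" using tmval_const by auto
  then show ?thesis using Arith_Eq[of "Var i" t] by simp
qed

lemma Arith_mem_pr_const: "Arith (\<lambda>e s. s i (pr c (e k)))"
proof -
  have "Arith (\<lambda>e s. \<exists>m. m = c \<and> s i (pr m (e k)))"
    by (intro Arith_ex Arith_conj Arith_mem_pr Arith_const_eq)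
  then show ?thesis by simp
qed

text \<open>A \<open>\<Sigma>\<^sup>1\<^sub>1\<close> predicate has a single existential set quantifier, at index 0 of the shifted assignment;
  finitely many reals are coded into one by slices \<open>\<lambda>x. W (pr n x)\<close>.\<close>

definition Sigma11 :: "((nat \<Rightarrow> nat) \<Rightarrow> (nat \<Rightarrow> cantor) \<Rightarrow> bool) \<Rightarrow> bool" where
  "Sigma11 P \<longleftrightarrow> (\<exists>Q. Arith Q \<and> (\<forall>e s. P e s \<longleftrightarrow> (\<exists>Z. Q e (case_nat Z s))))"

section \<open>Closure properties of \<open>Sigma11\<close>\<close>

lemma Sigma11I: "Arith Q \<Longrightarrow> (\<And>e s. P e s \<longleftrightarrow> (\<exists>Z. Q e (case_nat Z s))) \<Longrightarrow> Sigma11 P"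
  unfolding Sigma11_def by auto

lemma Sigma11E:
  assumes "Sigma11 P" obtains Q where "Arith Q" "\<And>e s. P e s \<longleftrightarrow> (\<exists>Z. Q e (case_nat Z s))"
  using assms unfolding Sigma11_def by auto

lemma Sigma11_cong: "Sigma11 P \<Longrightarrow> (\<And>e s. P e s = Q e s) \<Longrightarrow> Sigma11 Q"
  unfolding Sigma11_def by auto

lemma Arith_Sigma11: "Arith P \<Longrightarrow> Sigma11 P"
  by (rule Sigma11I[of "\<lambda>e s. P e (\<lambda>i. s (Suc i))"])
    (use Arith_ren[of P id Suc] in auto)

lemma Arith_subst0: 
  assumes "Arith Q" "Arith (\<lambda>e s. G (sh e) s (e 0))"
  shows "Arith (\<lambda>e s. Q e (case_nat (G e s) (\<lambda>i. s (q i))))"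
proof -
  have "Arith (\<lambda>e s. Q e (\<lambda>i. (case i of 0 \<Rightarrow> G e s | Suc j \<Rightarrow> s (q j))))"
  proof (rule Arith_subst[OF assms(1)])
    fix i
    show "Arith (\<lambda>e s. (case i of 0 \<Rightarrow> G (sh e) s | Suc j \<Rightarrow> s (q j)) (e 0))"
      by (cases i) (simp_all add: assms Arith_mem)
  qed
  then show ?thesis by simp
qed

lemma Sigma11_conj:
  assumes "Sigma11 P" "Sigma11 Q" shows "Sigma11 (\<lambda>e s. P e s \<and> Q e s)"
proof -
  from assms obtain A B where A: "Arith A" "\<And>e s. P e s \<longleftrightarrow> (\<exists>Z. A e (case_nat Z s))"
    and B: "Arith B" "\<And>e s. Q e s \<longleftrightarrow> (\<exists>Z. B e (case_nat Z s))" by (auto elim!: Sigma11E)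
  show ?thesis
  proof (rule Sigma11I)
    show "Arith (\<lambda>e s. A e (case_nat (\<lambda>x. s 0 (pr 0 x)) (\<lambda>i. s (Suc i))) \<and>
               B e (case_nat (\<lambda>x. s 0 (pr 1 x)) (\<lambda>i. s (Suc i))))"
      by (intro Arith_conj Arith_subst0 A B Arith_mem_pr_const)
    fix e s
    show "(P e s \<and> Q e s) = (\<exists>Z. A e (case_nat (\<lambda>x. case_nat Z s 0 (pr 0 x)) (\<lambda>i. case_nat Z s (Suc i))) \<and>
               B e (case_nat (\<lambda>x. case_nat Z s 0 (pr 1 x)) (\<lambda>i. case_nat Z s (Suc i))))" (is "_ = ?R")
    proof
      assume "P e s \<and> Q e s"
      then obtain U V where "A e (case_nat U s)" "B e (case_nat V s)" using A B by auto
      then show ?R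
        by (intro exI[of _ "\<lambda>z. case prod_decode z of (i, x) \<Rightarrow> if i = 0 then U x else V x"]) simp
    qed (auto simp: A B)
  qed
qed

lemma Sigma11_disj:
  assumes "Sigma11 P" "Sigma11 Q" shows "Sigma11 (\<lambda>e s. P e s \<or> Q e s)"
proof -
  from assms obtain A B where A: "Arith A" "\<And>e s. P e s \<longleftrightarrow> (\<exists>Z. A e (case_nat Z s))"
    and B: "Arith B" "\<And>e s. Q e s \<longleftrightarrow> (\<exists>Z. B e (case_nat Z s))" by (auto elim!: Sigma11E)
  show ?thesis by (rule Sigma11I[OF Arith_disj[OF A(1) B(1)]]) (auto simp: A B)
qed

lemma Sigma11_exS:
  assumes "Sigma11 (\<lambda>e s. P (s 0) e (sh s))" shows "Sigma11 (\<lambda>e s. \<exists>Z. P Z e s)"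
proof -
  from assms obtain A where A: "Arith A" "\<And>e s. P (s 0) e (sh s) \<longleftrightarrow> (\<exists>Z. A e (case_nat Z s))" by (auto elim!: Sigma11E)
  have A2: "P U e s \<longleftrightarrow> (\<exists>Z. A e (case_nat Z (case_nat U s)))" for U e s
    using A(2)[of "case_nat U s"] by simp
  show ?thesis
  proof (rule Sigma11I)
    \<comment> \<open>Two substitutions in turn: here the real at index 1 is replaced by its slice
      1; afterwards slice 0 of the combined real is put in front, which moves that real to index
      1.\<close>
    have 1: "Arith (\<lambda>e s. A e (case_nat (s 0) (case_nat (\<lambda>x. s 1 (pr 1 x)) (\<lambda>i. s (Suc (Suc i))))))"
    proof -
      have "Arith (\<lambda>e s. A e (\<lambda>i. if i = 1 then (\<lambda>x. s 1 (pr 1 x)) else s i))"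
      proof (rule Arith_subst[OF A(1)])
        fix i
        show "Arith (\<lambda>e s. (if i = 1 then (\<lambda>x. s 1 (pr 1 x)) else s i) (e 0))"
          by (cases "i = 1") (simp_all add: Arith_mem Arith_mem_pr_const)
      qed
      moreover have "(\<lambda>i. if i = 1 then (\<lambda>x. s 1 (pr 1 x)) else s i) = (case_nat (s 0) (case_nat (\<lambda>x. s 1 (pr 1 x)) (\<lambda>i. s (Suc (Suc i)))))"
        for s :: "nat \<Rightarrow> cantor"
        by (auto split: nat.splits)
      ultimately show ?thesis by simp
    qed
    have "Arith (\<lambda>e s. (\<lambda>e s. A e (case_nat (s 0) (case_nat (\<lambda>x. s 1 (pr 1 x)) (\<lambda>i. s (Suc (Suc i))))))
       e (case_nat (\<lambda>x. s 0 (pr 0 x)) (\<lambda>i. s i)))"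
      by (rule Arith_subst0[OF 1]) (rule Arith_mem_pr_const)
    then show "Arith (\<lambda>e s. A e (case_nat (\<lambda>x. s 0 (pr 0 x)) (case_nat (\<lambda>x. s 0 (pr 1 x)) (\<lambda>i. s (Suc i)))))"
      by simp
    fix e s
    show "(\<exists>Z. P Z e s) = (\<exists>Z. A e (case_nat (\<lambda>x. case_nat Z s 0 (pr 0 x)) (case_nat (\<lambda>x. case_nat Z s 0 (pr 1 x)) (\<lambda>i. case_nat Z s (Suc i)))))" (is "_ = ?R")
    proof
      assume "\<exists>Z. P Z e s"
      then obtain U V where "A e (case_nat V (case_nat U s))" using A2 by auto
      then show ?R
        by (intro exI[of _ "\<lambda>z. case prod_decode z of (i, x) \<Rightarrow> if i = 0 then V x else U x"]) simp
    next
      assume ?R then show "\<exists>Z. P Z e s" by (simp add: A2) blast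
    qed
  qed
qed

lemma Sigma11_ex:
  assumes "Sigma11 (\<lambda>e s. P (e 0) (sh e) s)" shows "Sigma11 (\<lambda>e s. \<exists>n. P n e s)"
proof -
  from assms obtain A where A: "Arith A" "\<And>e s. P (e 0) (sh e) s \<longleftrightarrow> (\<exists>Z. A e (case_nat Z s))" by (auto elim!: Sigma11E)
  have A2: "P n e s \<longleftrightarrow> (\<exists>Z. A (case_nat n e) (case_nat Z s))" for n e s
    using A(2)[of "case_nat n e"] by simp
  show ?thesis
  proof (rule Sigma11I)
    have [simp]: "case_nat (e 0) (sh e) = e" for e :: "nat \<Rightarrow> nat" by (auto split: nat.splits)
    show "Arith (\<lambda>e s. \<exists>n. A (case_nat n e) s)"
      by (rule Arith_ex) (use A(1) in simp)
  qed (auto simp: A2)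
qed

text \<open>Countable choice: one real, sliced by \<open>n\<close>, stores a witness for every
  \<open>n\<close>, so the number quantifier moves inside the set quantifier.\<close>

lemma Sigma11_all:
  assumes "Sigma11 (\<lambda>e s. P (e 0) (sh e) s)" shows "Sigma11 (\<lambda>e s. \<forall>n. P n e s)"
proof -
  from assms obtain A where A: "Arith A" "\<And>e s. P (e 0) (sh e) s \<longleftrightarrow> (\<exists>Z. A e (case_nat Z s))" by (auto elim!: Sigma11E)
  have A2: "P n e s \<longleftrightarrow> (\<exists>Z. A (case_nat n e) (case_nat Z s))" for n e s
    using A(2)[of "case_nat n e"] by simp
  show ?thesis
  proof (rule Sigma11I)
    have [simp]: "case_nat (e 0) (sh e) = e" for e :: "nat \<Rightarrow> nat" by (auto split: nat.splits)
    have "Arith (\<lambda>e s. A e (case_nat (\<lambda>x. s 0 (pr (e 0) x)) (\<lambda>i. s (Suc i))))"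
      by (rule Arith_subst0[OF A(1)]) (rule Arith_mem_pr)
    then show "Arith (\<lambda>e s. \<forall>n. A (case_nat n e) (case_nat (\<lambda>x. s 0 (pr n x)) (\<lambda>i. s (Suc i))))"
      by (intro Arith_all) simp
    fix e s
    show "(\<forall>n. P n e s) = (\<exists>Z. \<forall>n. A (case_nat n e) (case_nat (\<lambda>x. case_nat Z s 0 (pr n x)) (\<lambda>i. case_nat Z s (Suc i))))" (is "_ = ?R")
    proof
      assume "\<forall>n. P n e s"
      then obtain U where "\<And>n. A (case_nat n e) (case_nat (U n) s)" unfolding A2 by metis
      then show ?R
        by (intro exI[of _ "\<lambda>z. case prod_decode z of (i, x) \<Rightarrow> U i x"]) simp
    next
      assume ?R then show "\<forall>n. P n e s" unfolding A2 by auto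
    qed
  qed
qed

lemma Sigma11_ren:
  assumes "Sigma11 P" shows "Sigma11 (\<lambda>e s. P (\<lambda>j. e (r j)) (\<lambda>j. s (q j)))"
proof -
  from assms obtain A where A: "Arith A" "\<And>e s. P e s \<longleftrightarrow> (\<exists>Z. A e (case_nat Z s))" by (auto elim!: Sigma11E)
  show ?thesis
  proof (rule Sigma11I)
    show "Arith (\<lambda>e s. A (\<lambda>j. e (r j)) (\<lambda>j. s (case_nat 0 (\<lambda>j. Suc (q j)) j)))" by (rule Arith_ren[OF A(1)])
    fix e and s :: "nat \<Rightarrow> cantor"
    have "(\<lambda>j. case_nat Z s (case_nat 0 (\<lambda>j. Suc (q j)) j)) = case_nat Z (\<lambda>j. s (q j))" for Z
      by (auto split: nat.splits)
    then show "P (\<lambda>j. e (r j)) (\<lambda>j. s (q j)) = (\<exists>Z. A (\<lambda>j. e (r j)) (\<lambda>j. case_nat Z s (case_nat 0 (\<lambda>j. Suc (q j)) j)))"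
      by (simp add: A(2))
  qed
qed

lemma Sigma11_of_Sigma11_form: "Sigma11_form f \<Longrightarrow> Sigma11 (\<lambda>e s. sat e s f)"
proof (induction rule: Sigma11_form.induct)
  case (1 f)
  then show ?case by (intro Arith_Sigma11) (auto simp: Arith_def)
next
  case (2 f Y)
  have "Sigma11 (\<lambda>e s. \<exists>Z. sat e (s(Y := Z)) f)"
  proof (rule Sigma11_exS)
    have "(\<lambda>j. s (((\<lambda>j. Suc j)(Y := 0)) j)) = (sh s)(Y := s 0)" for s :: "nat \<Rightarrow> cantor" by auto
    then show "Sigma11 (\<lambda>e s. sat e ((sh s)(Y := s 0)) f)"
      using Sigma11_ren[OF 2(2), of "\<lambda>j. j" "(\<lambda>j. Suc j)(Y := 0)"] by (simp only:)
  qed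
  then show ?case by simp
qed

section \<open>From predicates back to formulas\<close>

primrec set_bound :: "form \<Rightarrow> nat" where
  "set_bound (Eq a b) = 0"
| "set_bound (Less a b) = 0"
| "set_bound (Mem a Y) = Suc Y"
| "set_bound (Neg f) = set_bound f"
| "set_bound (Conj f g) = max (set_bound f) (set_bound g)"
| "set_bound (ExNum x f) = set_bound f"
| "set_bound (ExSet Y f) = max (Suc Y) (set_bound f)"
| "set_bound (AllSet Y f) = max (Suc Y) (set_bound f)"

lemma sat_cong_set:
  "arithmetical f \<Longrightarrow> (\<And>i. i < set_bound f \<Longrightarrow> s i = s' i) \<Longrightarrow> sat e s f = sat e s' f"
proof (induction f arbitrary: e)
  case (Conj f g)
  have "sat e s f = sat e s' f" "sat e s g = sat e s' g"
    by (rule Conj; use Conj.prems in simp)+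
  then show ?case by simp
qed auto

lemma Sigma11_form_of_Sigma11:
  assumes "Sigma11 P" shows "\<exists>f. Sigma11_form f \<and> (\<forall>e s. sat e s f = P e s)"
proof -
  from assms obtain A where A: "Arith A" "\<And>e s. P e s \<longleftrightarrow> (\<exists>Z. A e (case_nat Z s))" by (auto elim!: Sigma11E)
  then obtain f where f: "arithmetical f" "\<And>e s. sat e s f = A e s" unfolding Arith_def by auto
  define m where "m = set_bound f"
  have "sat e (s(m := Z)) (ren f id (case_nat m id)) = A e (case_nat Z s)" for e s Z
  proof -
    have "sat e (s(m := Z)) (ren f id (case_nat m id)) = sat e ((s(m := Z)) \<circ> case_nat m id) f"
      using f by (simp add: sat_ren)
    also have "\<dots> = sat e (case_nat Z s) f"
      by (rule sat_cong_set[OF f(1)]) (auto simp: m_def split: nat.splits)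
    finally show ?thesis using f by simp
  qed
  then show ?thesis
    by (intro exI[of _ "ExSet m (ren f id (case_nat m id))"])
      (auto intro!: Sigma11_form.intros arithmetical_ren f simp: A)
qed

lemma Sigma11_class_iff: "Sigma11_class A \<longleftrightarrow> Sigma11 (\<lambda>e s. s 0 \<in> A)"
proof
  assume "Sigma11_class A"
  then obtain f where f: "Sigma11_form f" "\<And>X e s. X \<in> A \<longleftrightarrow> sat e (s(0 := X)) f"
    unfolding Sigma11_class_def by auto
  show "Sigma11 (\<lambda>e s. s 0 \<in> A)"
    by (rule Sigma11_cong[OF Sigma11_of_Sigma11_form[OF f(1)]]) (metis f(2) fun_upd_triv)
next
  assume "Sigma11 (\<lambda>e s. s 0 \<in> A)"
  then show "Sigma11_class A"
    unfolding Sigma11_class_def using Sigma11_form_of_Sigma11 by fastforce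
qed

lemma uniformly_Sigma11_iff: "uniformly_Sigma11 F \<longleftrightarrow> Sigma11 (\<lambda>e s. s 0 \<in> F (e 0))"
proof
  assume "uniformly_Sigma11 F"
  then obtain f where f: "Sigma11_form f" "\<And>n X e s. X \<in> F n \<longleftrightarrow> sat (e(0 := n)) (s(0 := X)) f"
    unfolding uniformly_Sigma11_def by auto
  show "Sigma11 (\<lambda>e s. s 0 \<in> F (e 0))"
    by (rule Sigma11_cong[OF Sigma11_of_Sigma11_form[OF f(1)]]) (metis f(2) fun_upd_triv)
next
  assume "Sigma11 (\<lambda>e s. s 0 \<in> F (e 0))"
  then show "uniformly_Sigma11 F"
    unfolding uniformly_Sigma11_def using Sigma11_form_of_Sigma11 by fastforce
qed

lemma Sigma11_form_negation:
  assumes "Pi11_form f"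
  shows "\<exists>g. Sigma11_form g \<and> (\<forall>e s. sat e s g = (\<not> sat e s f))"
  using assms
proof induction
  case (1 f) then show ?case by (intro exI[of _ "Neg f"]) (auto intro: Sigma11_form.intros)
next
  case (2 f Y) then obtain g where "Sigma11_form g" "(\<forall>e s. sat e s g = (\<not> sat e s f))" by auto
  then show ?case by (intro exI[of _ "ExSet Y g"]) (auto intro: Sigma11_form.intros)
qed

lemma Pi11_class_iff: "Pi11_class A \<longleftrightarrow> Sigma11 (\<lambda>e s. s 0 \<notin> A)"
proof
  assume "Pi11_class A"
  then obtain f where "Pi11_form f" "\<And>X e s. X \<in> A \<longleftrightarrow> sat e (s(0 := X)) f"
    unfolding Pi11_class_def by auto
  then have "Sigma11_class (- A)"
    unfolding Sigma11_class_def using Sigma11_form_negation[of f] by auto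
  then show "Sigma11 (\<lambda>e s. s 0 \<notin> A)" by (simp add: Sigma11_class_iff)
next
  assume "Sigma11 (\<lambda>e s. s 0 \<notin> A)"
  then have "Sigma11_class (- A)" by (simp add: Sigma11_class_iff)
  then show "Pi11_class A" using Pi11_class_Compl by fastforce
qed

section \<open>\<open>\<Delta>\<^sup>1\<^sub>1\<close> predicates and functions\<close>

definition Delta11 :: "((nat \<Rightarrow> nat) \<Rightarrow> (nat \<Rightarrow> cantor) \<Rightarrow> bool) \<Rightarrow> bool" where
  "Delta11 P \<longleftrightarrow> Sigma11 P \<and> Sigma11 (\<lambda>e s. \<not> P e s)"

text \<open>A \<open>Sigma11\<close> graph suffices: the value being unique, a statement about it
  can be written with an existential quantifier over the value, and so can its negation
  (\<open>Delta11_let\<close>).\<close>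

definition Delta11_num :: "((nat \<Rightarrow> nat) \<Rightarrow> (nat \<Rightarrow> cantor) \<Rightarrow> nat) \<Rightarrow> bool" where
  "Delta11_num f \<longleftrightarrow> Sigma11 (\<lambda>e s. e 0 = f (sh e) s)"

definition Delta11_real :: "((nat \<Rightarrow> nat) \<Rightarrow> (nat \<Rightarrow> cantor) \<Rightarrow> cantor) \<Rightarrow> bool" where
  "Delta11_real F \<longleftrightarrow> Delta11 (\<lambda>e s. F (sh e) s (e 0))"

lemma Sigma11_Delta11: "Delta11 P \<Longrightarrow> Sigma11 P"
  by (simp add: Delta11_def)

lemma Arith_Delta11: "Arith P \<Longrightarrow> Delta11 P"
  by (simp add: Delta11_def Arith_Sigma11 Arith_not)

lemma Delta11_not: "Delta11 P \<Longrightarrow> Delta11 (\<lambda>e s. \<not> P e s)"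
  by (simp add: Delta11_def)

lemma Delta11_conj: "Delta11 P \<Longrightarrow> Delta11 Q \<Longrightarrow> Delta11 (\<lambda>e s. P e s \<and> Q e s)"
  unfolding Delta11_def de_Morgan_conj by (elim conjE, intro conjI Sigma11_conj Sigma11_disj)

lemma Delta11_disj: "Delta11 P \<Longrightarrow> Delta11 Q \<Longrightarrow> Delta11 (\<lambda>e s. P e s \<or> Q e s)"
  unfolding Delta11_def de_Morgan_disj by (elim conjE, intro conjI Sigma11_conj Sigma11_disj)

lemma Delta11_imp: "Delta11 P \<Longrightarrow> Delta11 Q \<Longrightarrow> Delta11 (\<lambda>e s. P e s \<longrightarrow> Q e s)"
  unfolding imp_conv_disj by (intro Delta11_disj Delta11_not)

lemma Sigma11_imp: "Delta11 P \<Longrightarrow> Sigma11 Q \<Longrightarrow> Sigma11 (\<lambda>e s. P e s \<longrightarrow> Q e s)"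
  unfolding imp_conv_disj by (intro Sigma11_disj) (simp_all add: Delta11_def)

lemma Delta11_iff: "Delta11 P \<Longrightarrow> Delta11 Q \<Longrightarrow> Delta11 (\<lambda>e s. P e s \<longleftrightarrow> Q e s)"
  unfolding iff_conv_conj_imp by (intro Delta11_conj Delta11_imp)

lemma Delta11_ex: "Delta11 (\<lambda>e s. P (e 0) (sh e) s) \<Longrightarrow> Delta11 (\<lambda>e s. \<exists>n. P n e s)"
  unfolding Delta11_def not_ex by (elim conjE, intro conjI Sigma11_ex Sigma11_all)

lemma Delta11_all: "Delta11 (\<lambda>e s. P (e 0) (sh e) s) \<Longrightarrow> Delta11 (\<lambda>e s. \<forall>n. P n e s)"
  unfolding Delta11_def not_all by (elim conjE, intro conjI Sigma11_ex Sigma11_all)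

lemma Delta11_ren: "Delta11 P \<Longrightarrow> Delta11 (\<lambda>e s. P (\<lambda>j. e (r j)) (\<lambda>j. s (q j)))"
  unfolding Delta11_def by (auto intro: Sigma11_ren[of P] Sigma11_ren[of "\<lambda>e s. \<not> P e s"])

lemma Delta11_num_ren: assumes "Delta11_num f" shows "Delta11_num (\<lambda>e s. f (\<lambda>j. e (r j)) (\<lambda>j. s (q j)))"
  using Sigma11_ren[OF assms[unfolded Delta11_num_def], where r = "case_nat 0 (\<lambda>j. Suc (r j))" and q = q]
  unfolding Delta11_num_def by simp

lemma Delta11_real_ren: assumes "Delta11_real F" shows "Delta11_real (\<lambda>e s. F (\<lambda>j. e (r j)) (\<lambda>j. s (q j)))"
  using Delta11_ren[OF assms[unfolded Delta11_real_def], where r = "case_nat 0 (\<lambda>j. Suc (r j))" and q = q]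
  unfolding Delta11_real_def by simp

section \<open>Substitution of definable functions\<close>

lemma Sigma11_let:
  assumes "Delta11_num f" "Sigma11 (\<lambda>e s. P (e 0) (sh e) s)"
  shows "Sigma11 (\<lambda>e s. P (f e s) e s)"
proof -
  have "Sigma11 (\<lambda>e s. \<exists>n. n = f e s \<and> P n e s)"
    by (intro Sigma11_ex Sigma11_conj assms assms[unfolded Delta11_num_def])
  then show ?thesis by simp
qed

lemma Delta11_let:
  assumes "Delta11_num f" "Delta11 (\<lambda>e s. P (e 0) (sh e) s)"
  shows "Delta11 (\<lambda>e s. P (f e s) e s)"
  using Sigma11_let[OF assms(1), of P] Sigma11_let[OF assms(1), of "\<lambda>n e s. \<not> P n e s"] assms(2)
  by (simp add: Delta11_def)

text \<open>The value is quantified as a real \<open>Z\<close> required to agree with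
  \<open>F\<close> at every number; this agreement is \<open>Sigma11\<close> because both membership
  and non-membership in \<open>F\<close> are.\<close>

lemma Sigma11_letS:
  assumes F: "Delta11_real F" and P: "Sigma11 (\<lambda>e s. P (s 0) e (sh s))"
  shows "Sigma11 (\<lambda>e s. P (F e s) e s)"
proof -
  have "Delta11 (\<lambda>e s. s 0 (e 0) \<longleftrightarrow> F (sh e) (sh s) (e 0))"
    using Delta11_ren[OF F[unfolded Delta11_real_def], where r = "\<lambda>j. j" and q = Suc]
    by (intro Delta11_iff Arith_Delta11[OF Arith_mem]) simp
  then have "Sigma11 (\<lambda>e s. \<exists>Z. (\<forall>x. Z x \<longleftrightarrow> F e s x) \<and> P Z e s)"
    by (intro Sigma11_exS Sigma11_conj P Sigma11_all Sigma11_Delta11)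
  moreover have "(\<exists>Z. (\<forall>x. Z x \<longleftrightarrow> F e s x) \<and> P Z e s) \<longleftrightarrow> P (F e s) e s" for e s
  proof -
    have "(\<forall>x. Z x \<longleftrightarrow> F e s x) \<longleftrightarrow> Z = F e s" for Z by (auto simp: fun_eq_iff)
    then show ?thesis by simp
  qed
  ultimately show ?thesis by simp
qed

text \<open>Definability of a relation is proved once, at variables; its arguments are substituted
  afterwards, one by one. Five numbers and one real are what membership in \<open>inner\<close>
  takes.\<close>

lemma Sigma11_inst:
  assumes R: "Sigma11 (\<lambda>e s. R (e 0) (e (Suc 0)) (e (Suc (Suc 0))) (e (Suc (Suc (Suc 0)))) (e (Suc (Suc (Suc (Suc 0))))) (s 0))"
    and a: "Delta11_num a" and b: "Delta11_num b" and c: "Delta11_num c" and d: "Delta11_num d" and f: "Delta11_num f" and F: "Delta11_real F"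
  shows "Sigma11 (\<lambda>e s. R (a e s) (b e s) (c e s) (d e s) (f e s) (F e s))"
proof -
  have "Sigma11 (\<lambda>e s. R (e 0) (e (Suc 0)) (e (Suc (Suc 0))) (e (Suc (Suc (Suc 0)))) (e (Suc (Suc (Suc (Suc 0))))) (F (\<lambda>j. e (Suc (Suc (Suc (Suc (Suc j)))))) s))"
    by (rule Sigma11_letS[where P = "\<lambda>Z e s. R (e 0) (e (Suc 0)) (e (Suc (Suc 0))) (e (Suc (Suc (Suc 0)))) (e (Suc (Suc (Suc (Suc 0))))) Z", OF Delta11_real_ren[OF F, where q = "\<lambda>j. j"] R])
  then have "Sigma11 (\<lambda>e s. R (a (\<lambda>j. e (Suc (Suc (Suc (Suc j))))) s) (e 0) (e (Suc 0)) (e (Suc (Suc 0))) (e (Suc (Suc (Suc 0)))) (F (\<lambda>j. e (Suc (Suc (Suc (Suc j))))) s))"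
    by (rule Sigma11_let[where P = "\<lambda>n e s. R  n (e 0) (e (Suc 0)) (e (Suc (Suc 0))) (e (Suc (Suc (Suc 0)))) (F (\<lambda>j. e (Suc (Suc (Suc (Suc j))))) s)", OF Delta11_num_ren[OF a, where q = "\<lambda>j. j"]])
  then have "Sigma11 (\<lambda>e s. R (a (\<lambda>j. e (Suc (Suc (Suc j)))) s) (b (\<lambda>j. e (Suc (Suc (Suc j)))) s) (e 0) (e (Suc 0)) (e (Suc (Suc 0))) (F (\<lambda>j. e (Suc (Suc (Suc j)))) s))"
    by (rule Sigma11_let[where P = "\<lambda>n e s. R (a (\<lambda>j. e (Suc (Suc (Suc j)))) s) n (e 0) (e (Suc 0)) (e (Suc (Suc 0))) (F (\<lambda>j. e (Suc (Suc (Suc j)))) s)", OF Delta11_num_ren[OF b, where q = "\<lambda>j. j"]])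
  then have "Sigma11 (\<lambda>e s. R (a (\<lambda>j. e (Suc (Suc j))) s) (b (\<lambda>j. e (Suc (Suc j))) s) (c (\<lambda>j. e (Suc (Suc j))) s) (e 0) (e (Suc 0)) (F (\<lambda>j. e (Suc (Suc j))) s))"
    by (rule Sigma11_let[where P = "\<lambda>n e s. R (a (\<lambda>j. e (Suc (Suc j))) s) (b (\<lambda>j. e (Suc (Suc j))) s) n (e 0) (e (Suc 0)) (F (\<lambda>j. e (Suc (Suc j))) s)", OF Delta11_num_ren[OF c, where q = "\<lambda>j. j"]])
  then have "Sigma11 (\<lambda>e s. R (a (\<lambda>j. e (Suc j)) s) (b (\<lambda>j. e (Suc j)) s) (c (\<lambda>j. e (Suc j)) s) (d (\<lambda>j. e (Suc j)) s) (e 0) (F (\<lambda>j. e (Suc j)) s))"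
    by (rule Sigma11_let[where P = "\<lambda>n e s. R (a (\<lambda>j. e (Suc j)) s) (b (\<lambda>j. e (Suc j)) s) (c (\<lambda>j. e (Suc j)) s) n (e 0) (F (\<lambda>j. e (Suc j)) s)", OF Delta11_num_ren[OF d, where q = "\<lambda>j. j"]])
  then have "Sigma11 (\<lambda>e s. R (a e s) (b e s) (c e s) (d e s) (f e s)  (F e s))"
    by (rule Sigma11_let[where P = "\<lambda>n e s. R (a e s) (b e s) (c e s) (d e s) n  (F e s)", OF Delta11_num_ren[OF f, where q = "\<lambda>j. j"]])
  then show ?thesis .
qed

lemma Delta11_inst:
  assumes R: "Delta11 (\<lambda>e s. R (e 0) (e (Suc 0)) (e (Suc (Suc 0))) (e (Suc (Suc (Suc 0)))) (e (Suc (Suc (Suc (Suc 0))))) (s 0))"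
    and "Delta11_num a" "Delta11_num b" "Delta11_num c" "Delta11_num d" "Delta11_num f" "Delta11_real F"
  shows "Delta11 (\<lambda>e s. R (a e s) (b e s) (c e s) (d e s) (f e s) (F e s))"
  using Sigma11_inst[of R, OF _ assms(2-7)] Sigma11_inst[of "\<lambda>a b c d f F. \<not> R a b c d f F", OF _ assms(2-7)] R
  unfolding Delta11_def by blast

lemma Delta11_num_var: "Delta11_num (\<lambda>e s. e i)"
  unfolding Delta11_num_def using Arith_Eq[of "Var 0" "Var (Suc i)"] by (auto intro: Arith_Sigma11)

lemma Delta11_num_const: "Delta11_num (\<lambda>e s. c)"
  unfolding Delta11_num_def by (intro Arith_Sigma11 Arith_const_eq)

lemma Delta11_real_var: "Delta11_real (\<lambda>e s. s i)"
  unfolding Delta11_real_def by (intro Arith_Delta11 Arith_mem)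

lemma Delta11_real_empty: "Delta11_real (\<lambda>e s x. False)"
  unfolding Delta11_real_def
  by (intro Arith_Delta11) (auto simp: Arith_def intro!: exI[of _ "Neg (Eq Zero Zero)"])

lemma Sigma11_inst3:
  assumes "Sigma11 (\<lambda>e s. R (e 0) (e (Suc 0)) (e (Suc (Suc 0))))" "Delta11_num a" "Delta11_num b" "Delta11_num c"
  shows "Sigma11 (\<lambda>e s. R (a e s) (b e s) (c e s))"
  by (rule Sigma11_inst[of "\<lambda>a b c d f F. R a b c", OF assms Delta11_num_const Delta11_num_const Delta11_real_empty])

lemma Delta11_inst3:
  assumes "Delta11 (\<lambda>e s. R (e 0) (e (Suc 0)) (e (Suc (Suc 0))))" "Delta11_num a" "Delta11_num b" "Delta11_num c"
  shows "Delta11 (\<lambda>e s. R (a e s) (b e s) (c e s))"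
  by (rule Delta11_inst[of "\<lambda>a b c d f F. R a b c", OF assms Delta11_num_const Delta11_num_const Delta11_real_empty])

lemma Delta11_mem: "Delta11_num f \<Longrightarrow> Delta11 (\<lambda>e s. s i (f e s))"
  by (rule Delta11_let[where P = "\<lambda>n e s. s i n"]) (assumption, intro Arith_Delta11 Arith_mem)

lemma Delta11_eq: assumes "Delta11_num f" "Delta11_num g" shows "Delta11 (\<lambda>e s. f e s = g e s)"
proof (rule Delta11_inst3[where R = "\<lambda>a b c. a = b", OF _ assms Delta11_num_const])
  show "Delta11 (\<lambda>e s. e 0 = e (Suc 0))"
    using Arith_Eq[of "Var 0" "Var (Suc 0)"] by (auto intro: Arith_Delta11)
qed

lemma Delta11_less: assumes "Delta11_num f" "Delta11_num g" shows "Delta11 (\<lambda>e s. f e s < g e s)"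
  by (rule Delta11_inst3[where R = "\<lambda>a b c. a < b", OF _ assms Delta11_num_const]) (intro Arith_Delta11 Arith_less)

lemma Delta11_le: assumes "Delta11_num f" "Delta11_num g" shows "Delta11 (\<lambda>e s. f e s \<le> g e s)"
  unfolding not_less[symmetric] by (intro Delta11_not Delta11_less assms)

lemma Delta11_num_inst2:
  assumes "Sigma11 (\<lambda>e s. e 0 = g (e (Suc 0)) (e (Suc (Suc 0))))" "Delta11_num a" "Delta11_num b"
  shows "Delta11_num (\<lambda>e s. g (a e s) (b e s))"
  unfolding Delta11_num_def
  by (rule Sigma11_inst3[of "\<lambda>x y z. x = g y z", OF assms(1)])
    (use Delta11_num_ren[OF assms(2), where r = Suc and q = "\<lambda>j. j"] Delta11_num_ren[OF assms(3), where r = Suc and q = "\<lambda>j. j"] Delta11_num_var in auto)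

lemma Delta11_num_plus: assumes "Delta11_num f" "Delta11_num g" shows "Delta11_num (\<lambda>e s. f e s + g e s)"
  by (rule Delta11_num_inst2[OF _ assms])
    (use Arith_Eq[of "Var 0" "Plus (Var (Suc 0)) (Var (Suc (Suc 0)))"] in \<open>auto intro: Arith_Sigma11\<close>)

lemma Delta11_num_times: assumes "Delta11_num f" "Delta11_num g" shows "Delta11_num (\<lambda>e s. f e s * g e s)"
  by (rule Delta11_num_inst2[OF _ assms])
    (use Arith_Eq[of "Var 0" "Times (Var (Suc 0)) (Var (Suc (Suc 0)))"] in \<open>auto intro: Arith_Sigma11\<close>)

lemma Delta11_num_pr: assumes "Delta11_num f" "Delta11_num g" shows "Delta11_num (\<lambda>e s. pr (f e s) (g e s))"
  by (rule Delta11_num_inst2[OF _ assms]) (intro Arith_Sigma11 Arith_pr)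

lemma Delta11_num_Suc: assumes "Delta11_num f" shows "Delta11_num (\<lambda>e s. Suc (f e s))"
  using Delta11_num_plus[OF assms Delta11_num_const[of 1]] by simp

lemmas Delta11_num_intros = Delta11_num_var Delta11_num_const Delta11_num_plus Delta11_num_times Delta11_num_pr Delta11_num_Suc Delta11_real_var Delta11_real_empty
lemmas Delta11_intros = Delta11_not Delta11_conj Delta11_disj Delta11_imp Delta11_iff Delta11_ex Delta11_all Delta11_mem Delta11_eq Delta11_less Delta11_le Delta11_num_intros
lemmas Sigma11_intros = Sigma11_conj Sigma11_disj Sigma11_ex Sigma11_all Sigma11_exS Sigma11_imp

text \<open>Implicit definition: since \<open>W\<close> is the only solution \<open>Z\<close>,
  membership in \<open>W\<close> and its negation say that some solution contains, respectively
  omits, the number. This takes the place of coding computation histories when a recursion is to be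
  defined.\<close>

lemma Delta11_fixpoint:
  assumes H: "Delta11 (\<lambda>e s. H (s 0) (e 0))"
    and W: "\<And>Z. (\<forall>x. Z x \<longleftrightarrow> H Z x) \<longleftrightarrow> Z = W"
  shows "Delta11 (\<lambda>e s. W (e 0))"
proof -
  have 1: "Delta11 (\<lambda>e s. s 0 (e 0) \<longleftrightarrow> H (s 0) (e 0))"
    by (intro Delta11_iff H Delta11_mem Delta11_num_var)
  have "Sigma11 (\<lambda>e s. \<exists>Z. (\<forall>x. Z x \<longleftrightarrow> H Z x) \<and> Z (e 0))"
    by (intro Sigma11_exS Sigma11_conj Sigma11_all Sigma11_Delta11[OF 1] Sigma11_Delta11[OF Delta11_mem] Delta11_num_var)
  moreover have "Sigma11 (\<lambda>e s. \<exists>Z. (\<forall>x. Z x \<longleftrightarrow> H Z x) \<and> \<not> Z (e 0))"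
    by (intro Sigma11_exS Sigma11_conj Sigma11_all Sigma11_Delta11[OF 1] Sigma11_Delta11[OF Delta11_not] Delta11_mem Delta11_num_var)
  ultimately show ?thesis by (simp add: Delta11_def W)
qed

lemma Delta11_relation_fixpoint:
  assumes H: "Delta11 (\<lambda>e s. H (\<lambda>x y z. s 0 (pr x (pr y z))) (e 0) (e (Suc 0)) (e (Suc (Suc 0))))"
    and W: "\<And>x y z. W x y z \<longleftrightarrow> H W x y z"
    and unique: "\<And>Z. (\<And>x y z. Z x y z \<longleftrightarrow> H Z x y z) \<Longrightarrow> Z = W"
    and "Delta11_num a" "Delta11_num b" "Delta11_num c"
  shows "Delta11 (\<lambda>e s. W (a e s) (b e s) (c e s))"
proof (rule Delta11_inst3[OF _ assms(4-6)])
  define U where "U u \<longleftrightarrow> (\<exists>x y z. u = pr x (pr y z) \<and> W x y z)" for u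
  have ex3: "\<exists>x y z. u = pr x (pr y z)" for u
    by (metis prod_decode_inverse surj_pair)
  have "Delta11 (\<lambda>e s. U (e 0))"
  proof (rule Delta11_fixpoint[where H = "\<lambda>Z u. \<exists>x y z. u = pr x (pr y z) \<and> H (\<lambda>x y z. Z (pr x (pr y z))) x y z"])
    have H': "Delta11 (\<lambda>e s. H (\<lambda>x y z. s 0 (pr x (pr y z))) (e (Suc (Suc 0))) (e (Suc 0)) (e 0))"
      using Delta11_ren[OF H, where r = "\<lambda>j. if j = 0 then 2 else if j = 1 then 1 else 0" and q = "\<lambda>j. j"]
      by (simp add: numeral_2_eq_2)
    show "Delta11 (\<lambda>e s. \<exists>x y z. e 0 = pr x (pr y z) \<and> H (\<lambda>x y z. s 0 (pr x (pr y z))) x y z)"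
      by (intro Delta11_ex Delta11_conj Delta11_eq Delta11_num_intros H')
    fix Z
    show "(\<forall>x. Z x = (\<exists>xa y z. x = pr xa (pr y z) \<and> H (\<lambda>x y z. Z (pr x (pr y z))) xa y z)) \<longleftrightarrow> Z = U"
      (is "?L \<longleftrightarrow> _")
    proof
      assume L: ?L
      have "Z (pr x (pr y z)) \<longleftrightarrow> H (\<lambda>x y z. Z (pr x (pr y z))) x y z" for x y z
        using L[rule_format, of "pr x (pr y z)"] by simp
      then have "(\<lambda>x y z. Z (pr x (pr y z))) = W" by (rule unique)
      then have "Z (pr x (pr y z)) = W x y z" for x y z by (auto simp: fun_eq_iff)
      then show "Z = U" using ex3 unfolding U_def fun_eq_iff
        by (metis prod.inject prod_encode_eq)
    next
      assume "Z = U"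
      moreover have "(\<lambda>x y z. U (pr x (pr y z))) = W" by (auto simp: U_def fun_eq_iff)
      ultimately show ?L using W by (auto simp: U_def)
    qed
  qed
  then have "Delta11 (\<lambda>e s. U (pr (e 0) (pr (e (Suc 0)) (e (Suc (Suc 0))))))"
    by (rule Delta11_let[where P = "\<lambda>n e s. U n", rotated]) (intro Delta11_num_intros)
  then show "Delta11 (\<lambda>e s. W (e 0) (e (Suc 0)) (e (Suc (Suc 0))))" by (simp add: U_def)
qed

lemma less_pr_Suc: "y < pr (Suc k) y"
  by (simp add: prod_encode_def)

lemma Delta11_num_power2: assumes "Delta11_num f" shows "Delta11_num (\<lambda>e s. 2 ^ f e s)"
proof -
  define W where "W n w z \<longleftrightarrow> w = (2::nat) ^ n" for n w z :: nat
  define H :: "(nat \<Rightarrow> nat \<Rightarrow> nat \<Rightarrow> bool) \<Rightarrow> nat \<Rightarrow> nat \<Rightarrow> nat \<Rightarrow> bool"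
    where "H Z n w (z::nat) \<longleftrightarrow> n = 0 \<and> w = 1 \<or> (\<exists>m v. n = Suc m \<and> Z m v (0::nat) \<and> w = v + v)"
    for Z n w z
  have Delta11_W: "Delta11 (\<lambda>e s. W (e 0) (e (Suc 0)) 0)"
  proof (rule Delta11_relation_fixpoint[where H = H])
    show "Delta11 (\<lambda>e s. H (\<lambda>x y z. s 0 (pr x (pr y z))) (e 0) (e (Suc 0)) (e (Suc (Suc 0))))"
      unfolding H_def by (intro Delta11_intros)
    show "W x y z = H W x y z" for x y z
      by (cases x) (auto simp: W_def H_def)
    fix Z assume Z: "\<And>x y z. Z x y z \<longleftrightarrow> H Z x y z"
    have "Z n w z \<longleftrightarrow> w = 2 ^ n" for n w z
    proof (induction n arbitrary: w z)
      case 0 show ?case by (subst Z) (simp add: H_def)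
    next
      case (Suc n) show ?case by (subst Z) (auto simp: H_def Suc)
    qed
    then show "Z = W" by (auto simp: W_def fun_eq_iff)
  qed (intro Delta11_num_intros)+
  show ?thesis
    by (rule Delta11_num_inst2[where g = "\<lambda>x y. 2 ^ x", OF _ assms assms])
      (use Sigma11_ren[OF Sigma11_Delta11[OF Delta11_W], where r = "\<lambda>j. if j = 0 then 1 else 0"] in \<open>simp add: W_def\<close>)
qed

text \<open>Each number codes an infinite sequence, \<open>pr v b\<close> being \<open>v\<close>
  followed by the sequence of \<open>b\<close>. So no lengths are stored, every number is an
  assignment, and every finite prefix occurs (\<open>ex_entry_prefix\<close>).\<close>

primrec entry :: "nat \<Rightarrow> nat \<Rightarrow> nat" where
  "entry a 0 = fst (prod_decode a)"
| "entry a (Suc x) = entry (snd (prod_decode a)) x"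

lemma entry_pr [simp]: "entry (pr v b) 0 = v" "entry (pr v b) (Suc x) = entry b x"
  by simp_all

declare entry.simps [simp del]

lemma pr_cases: obtains x y where "z = pr x y"
  by (metis prod_decode_inverse surj_pair)

lemma Delta11_num_entry: assumes "Delta11_num f" "Delta11_num g" shows "Delta11_num (\<lambda>e s. entry (f e s) (g e s))"
proof -
  define W where "W x a w \<longleftrightarrow> w = entry a x" for x a w
  define H where "H Z x a w \<longleftrightarrow> (\<exists>v b. a = pr v b \<and> (x = 0 \<and> w = v \<or> (\<exists>y. x = Suc y \<and> Z y b w)))"
    for Z x a w
  have Delta11_W: "Delta11 (\<lambda>e s. W (e 0) (e (Suc 0)) (e (Suc (Suc 0))))"
  proof (rule Delta11_relation_fixpoint[where H = H])
    show "Delta11 (\<lambda>e s. H (\<lambda>x y z. s 0 (pr x (pr y z))) (e 0) (e (Suc 0)) (e (Suc (Suc 0))))"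
      unfolding H_def by (intro Delta11_intros)
    show "W x y z = H W x y z" for x y z
      by (cases x; cases y rule: pr_cases) (auto simp: W_def H_def)
    fix Z assume Z: "\<And>x y z. Z x y z \<longleftrightarrow> H Z x y z"
    have "Z x a w \<longleftrightarrow> w = entry a x" for x a w
    proof (induction x arbitrary: a w)
      case 0 show ?case by (cases a rule: pr_cases; subst Z) (auto simp: H_def)
    next
      case (Suc n) show ?case by (cases a rule: pr_cases; subst Z) (auto simp: H_def Suc)
    qed
    then show "Z = W" by (auto simp: W_def fun_eq_iff)
  qed (intro Delta11_num_intros)+
  show ?thesis
    by (rule Delta11_num_inst2[OF _ assms])
      (use Sigma11_ren[OF Sigma11_Delta11[OF Delta11_W], where r = "\<lambda>j. if j = 0 then 2 else if j = 1 then 1 else 0"]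
        in \<open>simp add: W_def numeral_2_eq_2\<close>)
qed

lemma ex_entry_upd: "\<exists>b. entry b = (entry a)(x := n)"
proof (induction x arbitrary: a)
  case 0
  obtain v c where "a = pr v c" by (rule pr_cases)
  then have "entry (pr n c) i = ((entry a)(0 := n)) i" for i by (cases i) auto
  then show ?case by blast
next
  case (Suc x)
  obtain v c where a: "a = pr v c" by (rule pr_cases)
  obtain b where b: "entry b = (entry c)(x := n)" using Suc by blast
  have "entry (pr v b) i = ((entry a)(Suc x := n)) i" for i by (cases i) (auto simp: a b)
  then show ?case by blast
qed

lemma ex_entry_prefix: "\<exists>r. \<forall>p<l. entry r p = f p"
proof (induction l)
  case (Suc l)
  then obtain r where "\<forall>p<l. entry r p = f p" by blast
  moreover obtain b where "entry b = (entry r)(l := f l)" using ex_entry_upd by blast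
  ultimately show ?case by (intro exI[of _ b]) (auto simp: less_Suc_eq)
qed auto

section \<open>Evaluation of coded terms\<close>

primrec encode_tm :: "tm \<Rightarrow> nat" where
  "encode_tm (Var x) = pr 0 x"
| "encode_tm Zero = pr 1 0"
| "encode_tm One = pr 2 0"
| "encode_tm (Plus t u) = pr 3 (pr (encode_tm t) (encode_tm u))"
| "encode_tm (Times t u) = pr 4 (pr (encode_tm t) (encode_tm u))"

text \<open>A relation rather than a function, so that numbers coding no term simply have no
  value.\<close>

inductive term_value :: "nat \<Rightarrow> nat \<Rightarrow> nat \<Rightarrow> bool" where
  "term_value (pr 0 x) a (entry a x)"
| "term_value (pr 1 0) a 0"
| "term_value (pr 2 0) a 1"
| "term_value t a v \<Longrightarrow> term_value u a w \<Longrightarrow> term_value (pr 3 (pr t u)) a (v + w)"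
| "term_value t a v \<Longrightarrow> term_value u a w \<Longrightarrow> term_value (pr 4 (pr t u)) a (v * w)"

lemma term_value_encode_tm: "term_value (encode_tm t) a w \<longleftrightarrow> w = tmval (entry a) t"
proof (induction t arbitrary: w)
  case (Var x) then show ?case by (subst term_value.simps) auto
next
  case Zero then show ?case by (subst term_value.simps) auto
next
  case One then show ?case by (subst term_value.simps) auto
next
  case (Plus t u) then show ?case by (subst term_value.simps) auto
next
  case (Times t u) then show ?case by (subst term_value.simps) auto
qed

lemma Delta11_term_value:
  assumes "Delta11_num f" "Delta11_num g" "Delta11_num h" shows "Delta11 (\<lambda>e s. term_value (f e s) (g e s) (h e s))"
proof -
  define H where "H Z c a w \<longleftrightarrow>
      (\<exists>x. c = pr 0 x \<and> w = entry a x) \<or> c = pr 1 0 \<and> w = 0 \<or> c = pr 2 0 \<and> w = 1 \<or>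
      (\<exists>t u v v'. c = pr 3 (pr t u) \<and> w = v + v' \<and> Z t a v \<and> Z u a v') \<or>
      (\<exists>t u v v'. c = pr 4 (pr t u) \<and> w = v * v' \<and> Z t a v \<and> Z u a v')" for Z c a w
  show ?thesis
  proof (rule Delta11_relation_fixpoint[where H = H, OF _ _ _ assms])
    show "Delta11 (\<lambda>e s. H (\<lambda>x y z. s 0 (pr x (pr y z))) (e 0) (e (Suc 0)) (e (Suc (Suc 0))))"
      unfolding H_def by (intro Delta11_intros Delta11_num_entry)
    show "term_value c a w = H term_value c a w" for c a w
      unfolding H_def by (subst term_value.simps) blast
    fix Z assume Z: "\<And>x y z. Z x y z \<longleftrightarrow> H Z x y z"
    have V: "\<And>c a w. term_value c a w \<longleftrightarrow> H term_value c a w" unfolding H_def by (subst term_value.simps) blast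
    have "Z c a w \<longleftrightarrow> term_value c a w" for c a w
    proof (induction c arbitrary: a w rule: less_induct)
      case (less c)
      \<comment> \<open>As the tags 3 and 4 are positive, both components are smaller than the code.
        With tag 0 this would fail, since \<open>pr 0 0 = 0\<close>.\<close>
      have sub: "t < pr (Suc k) (pr t u)" "u < pr (Suc k) (pr t u)" for t u k
        using less_pr_Suc[of "pr t u" k] le_prod_encode_1[of t u] le_prod_encode_2[of u t] by linarith+
      have "Z t a v = term_value t a v" "Z u a v = term_value u a v"
        if "c = pr 3 (pr t u) \<or> c = pr 4 (pr t u)" for t u v
        using that less[of t] less[of u] sub[where k = 2] sub[where k = 3]
        by (auto simp: numeral_3_eq_3 eval_nat_numeral)
      then show ?case unfolding Z[of c a w] V[of c a w] H_def
        by (intro disj_cong refl ex_cong1 conj_cong) simp_all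
    qed
    then show "Z = term_value" by (auto simp: fun_eq_iff)
  qed
qed

section \<open>The universal tree\<close>

primrec encode :: "form \<Rightarrow> nat" where
  "encode (Eq t u) = pr 0 (pr (encode_tm t) (encode_tm u))"
| "encode (Less t u) = pr 1 (pr (encode_tm t) (encode_tm u))"
| "encode (Mem t j) = pr 2 (pr (encode_tm t) j)"
| "encode (Neg f) = pr 3 (encode f)"
| "encode (Conj f g) = pr 4 (pr (encode f) (encode g))"
| "encode (ExNum x f) = pr 5 (pr x (encode f))"
| "encode (ExSet j f) = pr 6 (pr j (encode f))"
| "encode (AllSet j f) = pr 7 (pr j (encode f))"

lemma encode_tm_inject: "encode_tm t = encode_tm u \<longleftrightarrow> t = u"
proof (induction t arbitrary: u)
  case (Var x) then show ?case by (cases u) auto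
next
  case Zero then show ?case by (cases u) auto
next
  case One then show ?case by (cases u) auto
next
  case (Plus t1 t2) then show ?case by (cases u) auto
next
  case (Times t1 t2) then show ?case by (cases u) auto
qed

lemma encode_eq_iff:
  "encode f = pr 0 z \<longleftrightarrow> (\<exists>t u. f = Eq t u \<and> z = pr (encode_tm t) (encode_tm u))"
  "encode f = pr 1 z \<longleftrightarrow> (\<exists>t u. f = Less t u \<and> z = pr (encode_tm t) (encode_tm u))"
  "encode f = pr 2 z \<longleftrightarrow> (\<exists>t j. f = Mem t j \<and> z = pr (encode_tm t) j)"
  "encode f = pr 3 z \<longleftrightarrow> (\<exists>g. f = Neg g \<and> z = encode g)"
  "encode f = pr 4 z \<longleftrightarrow> (\<exists>g h. f = Conj g h \<and> z = pr (encode g) (encode h))"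
  "encode f = pr 5 z \<longleftrightarrow> (\<exists>x g. f = ExNum x g \<and> z = pr x (encode g))"
  "encode f = pr 6 z \<longleftrightarrow> (\<exists>x g. f = ExSet x g \<and> z = pr x (encode g))"
  "encode f = pr 7 z \<longleftrightarrow> (\<exists>x g. f = AllSet x g \<and> z = pr x (encode g))"
  by (cases f; auto)+

lemma encode_inject: "encode f = encode g \<longleftrightarrow> f = g"
proof (induction f arbitrary: g)
  case (Eq t u) then show ?case by (cases g) (auto simp: encode_tm_inject)
next
  case (Less t u) then show ?case by (cases g) (auto simp: encode_tm_inject)
next
  case (Mem t j) then show ?case by (cases g) (auto simp: encode_tm_inject)
next
  case (Neg f) then show ?case by (cases g) auto
next
  case (Conj f1 f2) then show ?case by (cases g) auto
next
  case (ExNum x f) then show ?case by (cases g) auto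
next
  case (ExSet x f) then show ?case by (cases g) auto
next
  case (AllSet x f) then show ?case by (cases g) auto
qed

text \<open>A function \<open>f\<close> obeying the constraints below witnesses a \<open>\<Sigma>\<^sup>1\<^sub>1\<close> statement: \<open>f (pr 0 (pr j x)) = 1\<close> says
  that \<open>x\<close> lies in the \<open>j\<close>th real; a positive value of \<open>f\<close> at \<open>pr 1 (pr \<phi> a)\<close> or \<open>pr 2 (pr \<phi> a)\<close> claims that the
  formula coded by \<open>\<phi>\<close> is true or false, respectively, under the assignment \<open>entry a\<close>, and the predecessor of the
  value is a witness. The index \<open>pr z (pr c n)\<close> asks for the truth of formula \<open>c\<close> at \<open>n\<close>; the real parameter is
  read as empty for \<open>z = 0\<close>.\<close>

definition claim_ok :: "nat \<Rightarrow> nat \<Rightarrow> nat \<Rightarrow> nat \<Rightarrow> bool" where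
  "claim_ok p k p' w' \<longleftrightarrow>
     (\<forall>t u a v v'. p = pr 1 (pr (pr 0 (pr t u)) a) \<and> term_value t a v \<and> term_value u a v' \<longrightarrow> v = v') \<and>
     (\<forall>t u a v v'. p = pr 2 (pr (pr 0 (pr t u)) a) \<and> term_value t a v \<and> term_value u a v' \<longrightarrow> v \<noteq> v') \<and>
     (\<forall>t u a v v'. p = pr 1 (pr (pr 1 (pr t u)) a) \<and> term_value t a v \<and> term_value u a v' \<longrightarrow> v < v') \<and>
     (\<forall>t u a v v'. p = pr 2 (pr (pr 1 (pr t u)) a) \<and> term_value t a v \<and> term_value u a v' \<longrightarrow> \<not> v < v') \<and>
     (\<forall>t j a v. p = pr 1 (pr (pr 2 (pr t j)) a) \<and> term_value t a v \<and> p' = pr 0 (pr j v) \<longrightarrow> w' = 1) \<and>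
     (\<forall>t j a v. p = pr 2 (pr (pr 2 (pr t j)) a) \<and> term_value t a v \<and> p' = pr 0 (pr j v) \<longrightarrow> w' \<noteq> 1) \<and>
     (\<forall>f a. p = pr 1 (pr (pr 3 f) a) \<and> p' = pr 2 (pr f a) \<longrightarrow> 0 < w') \<and>
     (\<forall>f a. p = pr 2 (pr (pr 3 f) a) \<and> p' = pr 1 (pr f a) \<longrightarrow> 0 < w') \<and>
     (\<forall>f g a. p = pr 1 (pr (pr 4 (pr f g)) a) \<and> (p' = pr 1 (pr f a) \<or> p' = pr 1 (pr g a)) \<longrightarrow> 0 < w') \<and>
     (\<forall>f g a. p = pr 2 (pr (pr 4 (pr f g)) a) \<and>
        (k = 0 \<and> p' = pr 2 (pr f a) \<or> k \<noteq> 0 \<and> p' = pr 2 (pr g a)) \<longrightarrow> 0 < w') \<and>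
     (\<forall>x f a. p = pr 1 (pr (pr 5 (pr x f)) a) \<longrightarrow>
        (\<forall>y. y \<noteq> x \<longrightarrow> entry k y = entry a y) \<and> (p' = pr 1 (pr f k) \<longrightarrow> 0 < w')) \<and>
     (\<forall>x f a b. p = pr 2 (pr (pr 5 (pr x f)) a) \<and> (\<forall>y. y \<noteq> x \<longrightarrow> entry b y = entry a y) \<and>
        p' = pr 2 (pr f b) \<longrightarrow> 0 < w')"

definition input_ok :: "nat \<Rightarrow> cantor \<Rightarrow> nat \<Rightarrow> nat \<Rightarrow> bool" where
  "input_ok i Y p w \<longleftrightarrow>
     (\<forall>x. p = pr 0 (pr 0 x) \<longrightarrow> (w = 1 \<longleftrightarrow> (\<exists>z c. i = pr (Suc z) c) \<and> Y x))"

text \<open>Each constraint concerns the values of the function at two positions only. Hence finite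
  segments can be tested, and the functions obeying all constraints are the infinite paths of a
  tree.\<close>

definition node_ok :: "nat \<Rightarrow> cantor \<Rightarrow> nat \<Rightarrow> nat \<Rightarrow> nat \<Rightarrow> nat \<Rightarrow> bool" where
  "node_ok i Y p w p' w' \<longleftrightarrow>
     input_ok i Y p w \<and>
     (\<forall>z c n. i = pr z (pr c n) \<and> p = pr 1 (pr c (pr n 0)) \<longrightarrow> 0 < w) \<and>
     (\<forall>k. w = Suc k \<longrightarrow> claim_ok p k p' w')"

text \<open>A claim forces claims about subformulas, down to the atoms, which are checked against
  the reals coded by \<open>f\<close>. The value 0 claims nothing, so for arbitrary \<open>f\<close>
  only this direction can hold.\<close>

lemma claim_sound:
  assumes ok: "\<And>p p'. node_ok i Y p (f p) p' (f p')"
  shows "arithmetical \<phi> \<Longrightarrow>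
    (0 < f (pr 1 (pr (encode \<phi>) a)) \<longrightarrow> sat (entry a) (\<lambda>j x. f (pr 0 (pr j x)) = 1) \<phi>) \<and>
    (0 < f (pr 2 (pr (encode \<phi>) a)) \<longrightarrow> \<not> sat (entry a) (\<lambda>j x. f (pr 0 (pr j x)) = 1) \<phi>)"
proof (induction \<phi> arbitrary: a)
  have cl: "claim_ok p (f p - 1) p' (f p')" if "0 < f p" for p p'
    using ok[of p p'] that unfolding node_ok_def by (cases "f p") auto
  {
    case (Eq t u)
    then show ?case
      using cl[of "pr 1 (pr (encode (Eq t u)) a)" 0] cl[of "pr 2 (pr (encode (Eq t u)) a)" 0]
      by (auto simp: claim_ok_def term_value_encode_tm)
  next
    case (Less t u)
    then show ?case
      using cl[of "pr 1 (pr (encode (Less t u)) a)" 0] cl[of "pr 2 (pr (encode (Less t u)) a)" 0]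
      by (auto simp: claim_ok_def term_value_encode_tm)
  next
    case (Mem t j)
    then show ?case
      using cl[of "pr 1 (pr (encode (Mem t j)) a)" "pr 0 (pr j (tmval (entry a) t))"]
        cl[of "pr 2 (pr (encode (Mem t j)) a)" "pr 0 (pr j (tmval (entry a) t))"]
      by (auto simp: claim_ok_def term_value_encode_tm)
  next
    case (Neg g)
    then show ?case
      using cl[of "pr 1 (pr (encode (Neg g)) a)" "pr 2 (pr (encode g) a)"]
        cl[of "pr 2 (pr (encode (Neg g)) a)" "pr 1 (pr (encode g) a)"]
      by (auto simp: claim_ok_def)
  next
    case (Conj g h)
    have "0 < f (pr 1 (pr (encode g) a)) \<and> 0 < f (pr 1 (pr (encode h) a))" if "0 < f (pr 1 (pr (encode (Conj g h)) a))"
      using cl[OF that, of "pr 1 (pr (encode g) a)"] cl[OF that, of "pr 1 (pr (encode h) a)"]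
      by (auto simp: claim_ok_def)
    moreover have "0 < f (pr 2 (pr (encode g) a)) \<or> 0 < f (pr 2 (pr (encode h) a))" if "0 < f (pr 2 (pr (encode (Conj g h)) a))"
      using cl[OF that, of "pr 2 (pr (encode g) a)"] cl[OF that, of "pr 2 (pr (encode h) a)"]
      by (auto simp: claim_ok_def)
    ultimately show ?case using Conj by auto
  next
    case (ExNum x g)
    have "\<exists>n. sat ((entry a)(x := n)) (\<lambda>j x. f (pr 0 (pr j x)) = 1) g" if pos: "0 < f (pr 1 (pr (encode (ExNum x g)) a))"
    proof -
      define k where "k = f (pr 1 (pr (encode (ExNum x g)) a)) - 1"
      have "\<forall>y. y \<noteq> x \<longrightarrow> entry k y = entry a y" "0 < f (pr 1 (pr (encode g) k))"
        using cl[OF pos, of "pr 1 (pr (encode g) k)"] by (auto simp: claim_ok_def k_def)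
      moreover from this have "entry k = (entry a)(x := entry k x)" by auto
      moreover have "arithmetical g" using ExNum by simp
      ultimately have "sat ((entry a)(x := entry k x)) (\<lambda>j x. f (pr 0 (pr j x)) = 1) g"
        using ExNum.IH[of k] by simp
      then show ?thesis by blast
    qed
    moreover have "\<not> sat ((entry a)(x := n)) (\<lambda>j x. f (pr 0 (pr j x)) = 1) g" if pos: "0 < f (pr 2 (pr (encode (ExNum x g)) a))" for n
    proof -
      obtain b where b: "entry b = (entry a)(x := n)" using ex_entry_upd by blast
      then have "0 < f (pr 2 (pr (encode g) b))"
        using cl[OF pos, of "pr 2 (pr (encode g) b)"] by (auto simp: claim_ok_def)
      then have "\<not> sat (entry b) (\<lambda>j x. f (pr 0 (pr j x)) = 1) g" using ExNum.IH[of b] ExNum.prems by auto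
      then show ?thesis by (simp only: b not_False_eq_True)
    qed
    ultimately show ?case by auto
  }
qed auto

text \<open>The function that serves for the converse: all true claims about \<open>s\<close> are
  made. The witness for a number quantifier is the code of a whole modified assignment, so that a
  constraint can compare it entry by entry with \<open>a\<close>.\<close>

definition claims :: "(nat \<Rightarrow> cantor) \<Rightarrow> nat \<Rightarrow> nat" where
  "claims s p = (case prod_decode p of (t, q) \<Rightarrow> case prod_decode q of (c, a) \<Rightarrow>
     if t = 0 then (if s c a then 1 else 0)
     else if c \<notin> range encode then 0
     else if t = 1 \<and> sat (entry a) s (inv encode c) then
       Suc (case inv encode c of ExNum x g \<Rightarrow> (SOME b. (\<forall>y. y \<noteq> x \<longrightarrow> entry b y = entry a y) \<and> sat (entry b) s g) | _ \<Rightarrow> 0)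
     else if t = 2 \<and> \<not> sat (entry a) s (inv encode c) then
       Suc (case inv encode c of Conj g h \<Rightarrow> (if sat (entry a) s g then 1 else 0) | _ \<Rightarrow> 0)
     else 0)"

lemma inv_encode [simp]: "inv encode (encode f) = f"
  by (simp add: encode_inject inj_def)

lemma claims_pos:
  "0 < claims s (pr 1 (pr (encode f) a)) \<longleftrightarrow> sat (entry a) s f"
  "0 < claims s (pr (Suc 0) (pr (encode f) a)) \<longleftrightarrow> sat (entry a) s f"
  "0 < claims s (pr 2 (pr (encode f) a)) \<longleftrightarrow> \<not> sat (entry a) s f"
  by (simp_all add: claims_def)

lemma claims_set: "claims s (pr 0 (pr j x)) = 1 \<longleftrightarrow> s j x"
   "claims s (pr 0 (pr j x)) = Suc 0 \<longleftrightarrow> s j x"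
  by (simp_all add: claims_def)

lemma claims_true:
  assumes "claims s (pr (Suc 0) (pr c a)) = Suc k"
  obtains f where "c = encode f" "sat (entry a) s f"
    "\<And>x g. f = ExNum x g \<Longrightarrow> (\<forall>y. y \<noteq> x \<longrightarrow> entry k y = entry a y) \<and> sat (entry k) s g"
proof -
  from assms obtain f where f: "c = encode f" "sat (entry a) s f"
    by (auto simp: claims_def split: if_splits)
  show ?thesis
  proof (rule that[OF f])
    fix x g assume fx: "f = ExNum x g"
    then obtain n where "sat ((entry a)(x := n)) s g" using f by auto
    moreover obtain b where "entry b = (entry a)(x := n)" using ex_entry_upd by blast
    ultimately have "\<exists>b. (\<forall>y. y \<noteq> x \<longrightarrow> entry b y = entry a y) \<and> sat (entry b) s g" by (intro exI[of _ b]) auto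
    note someI_ex[OF this]
    moreover have "k = (SOME b. (\<forall>y. y \<noteq> x \<longrightarrow> entry b y = entry a y) \<and> sat (entry b) s g)"
      using assms unfolding f(1) claims_def using f fx by (auto simp del: encode.simps)
    ultimately show "(\<forall>y. y \<noteq> x \<longrightarrow> entry k y = entry a y) \<and> sat (entry k) s g" by simp
  qed
qed

lemma claims_false:
  assumes "claims s (pr 2 (pr c a)) = Suc k"
  obtains f where "c = encode f" "\<not> sat (entry a) s f" "\<And>g h. f = Conj g h \<Longrightarrow> (k = 0 \<longleftrightarrow> \<not> sat (entry a) s g)"
proof -
  from assms obtain f where f: "c = encode f" "\<not> sat (entry a) s f"
    by (auto simp: claims_def split: if_splits)
  show ?thesis
  proof (rule that[OF f])
    fix g h assume fx: "f = Conj g h"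
    then show "k = 0 \<longleftrightarrow> \<not> sat (entry a) s g"
      using assms unfolding f(1) claims_def using f fx by (auto simp del: encode.simps split: if_splits)
  qed
qed

lemma claim_ok_claims:
  assumes k: "claims s p = Suc k"
  shows "claim_ok p k p' (claims s p')"
proof -
  have T: "\<exists>f. c = encode f \<and> sat (entry a) s f \<and>
      (\<forall>x g. f = ExNum x g \<longrightarrow> (\<forall>y. y \<noteq> x \<longrightarrow> entry k y = entry a y) \<and> sat (entry k) s g)"
    if "p = pr 1 (pr c a)" for c a
    using k that by (auto elim!: claims_true)
  have F: "\<exists>f. c = encode f \<and> \<not> sat (entry a) s f \<and> (\<forall>g h. f = Conj g h \<longrightarrow> (k = 0 \<longleftrightarrow> \<not> sat (entry a) s g))"
    if "p = pr 2 (pr c a)" for c a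
    using k that by (auto elim!: claims_false)
  show ?thesis
    unfolding claim_ok_def
  proof (intro conjI allI impI; (elim conjE)?)
    fix t u a v v' assume "p = pr 1 (pr (pr 0 (pr t u)) a)" "term_value t a v" "term_value u a v'"
    then show "v = v'" using T by (fastforce dest!: sym[of "pr _ _"] simp: encode_eq_iff term_value_encode_tm)
  next
    fix t u a v v' assume "p = pr 2 (pr (pr 0 (pr t u)) a)" "term_value t a v" "term_value u a v'"
    then show "v \<noteq> v'" using F by (fastforce dest!: sym[of "pr _ _"] simp: encode_eq_iff term_value_encode_tm)
  next
    fix t u a v v' assume p: "p = pr 1 (pr (pr 1 (pr t u)) a)" and V: "term_value t a v" "term_value u a v'"
    from T[OF p] obtain t' u' where "pr t u = pr (encode_tm t') (encode_tm u')" "sat (entry a) s (Less t' u')"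
      by (metis encode_eq_iff(2))
    then show "v < v'" using V by (auto simp: term_value_encode_tm)
  next
    fix t u a v v' assume p: "p = pr 2 (pr (pr 1 (pr t u)) a)" and V: "term_value t a v" "term_value u a v'"
    from F[OF p] obtain t' u' where "pr t u = pr (encode_tm t') (encode_tm u')" "\<not> sat (entry a) s (Less t' u')"
      by (metis encode_eq_iff(2))
    then show "\<not> v < v'" using V by (auto simp: term_value_encode_tm)
  next
    fix t j a v assume "p = pr 1 (pr (pr 2 (pr t j)) a)" "term_value t a v" "p' = pr 0 (pr j v)"
    then show "claims s p' = 1" using T by (fastforce dest!: sym[of "pr _ _"] simp: encode_eq_iff term_value_encode_tm claims_set)
  next
    fix t j a v assume "p = pr 2 (pr (pr 2 (pr t j)) a)" "term_value t a v" "p' = pr 0 (pr j v)"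
    then show "claims s p' \<noteq> 1" using F by (fastforce dest!: sym[of "pr _ _"] simp: encode_eq_iff term_value_encode_tm claims_set)
  next
    fix f a assume p: "p = pr 1 (pr (pr 3 f) a)" "p' = pr 2 (pr f a)"
    from T[OF p(1)] obtain g where "f = encode g" "\<not> sat (entry a) s g" by (metis encode_eq_iff(4) sat.simps(4))
    then show "0 < claims s p'" by (simp add: p claims_pos)
  next
    fix f a assume p: "p = pr 2 (pr (pr 3 f) a)" "p' = pr 1 (pr f a)"
    from F[OF p(1)] obtain g where "f = encode g" "sat (entry a) s g" by (metis encode_eq_iff(4) sat.simps(4))
    then show "0 < claims s p'" by (simp add: p claims_pos)
  next
    fix f g a assume p: "p = pr 1 (pr (pr 4 (pr f g)) a)" "p' = pr 1 (pr f a) \<or> p' = pr 1 (pr g a)"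
    from T[OF p(1)] obtain f' g' where "pr f g = pr (encode f') (encode g')" "sat (entry a) s f'" "sat (entry a) s g'"
      by (metis encode_eq_iff(5) sat.simps(5))
    then show "0 < claims s p'" using p by (auto simp: claims_pos)
  next
    fix f g a assume p: "p = pr 2 (pr (pr 4 (pr f g)) a)" "k = 0 \<and> p' = pr 2 (pr f a) \<or> k \<noteq> 0 \<and> p' = pr 2 (pr g a)"
    from F[OF p(1)] obtain f' g' where "pr f g = pr (encode f') (encode g')" "\<not> (sat (entry a) s f' \<and> sat (entry a) s g')"
      "k = 0 \<longleftrightarrow> \<not> sat (entry a) s f'"
      by (metis encode_eq_iff(5) sat.simps(5))
    then show "0 < claims s p'"
      using p claims_pos(3)[of s f' a] claims_pos(3)[of s g' a] by auto
  next
    fix x f a y assume p: "p = pr 1 (pr (pr 5 (pr x f)) a)" "y \<noteq> x"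
    from T[OF p(1)] obtain f' x' where "pr x f = pr x' (encode f')" "\<forall>y. y \<noteq> x' \<longrightarrow> entry k y = entry a y"
      by (metis encode_eq_iff(6))
    then show "entry k y = entry a y" using p by auto
  next
    fix x f a assume p: "p = pr 1 (pr (pr 5 (pr x f)) a)" "p' = pr 1 (pr f k)"
    from T[OF p(1)] obtain f' x' where "pr x f = pr x' (encode f')" "sat (entry k) s f'"
      by (metis encode_eq_iff(6))
    then show "0 < claims s p'" using p by (auto simp: claims_pos)
  next
    fix x f a b assume p: "p = pr 2 (pr (pr 5 (pr x f)) a)" "\<forall>y. y \<noteq> x \<longrightarrow> entry b y = entry a y" "p' = pr 2 (pr f b)"
    from F[OF p(1)] obtain f' x' where f': "pr x f = pr x' (encode f')" "\<And>n. \<not> sat ((entry a)(x' := n)) s f'"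
      by (metis encode_eq_iff(6) sat.simps(6))
    have "entry b = (entry a)(x := entry b x)" using p(2) by auto
    then have "\<not> sat (entry b) s f'" using f' by (metis Pair_inject prod_encode_eq)
    then show "0 < claims s p'" using p f' by (auto simp: claims_pos)
  qed
qed

text \<open>A node \<open>pr l r\<close> is the segment of length \<open>l\<close> of the sequence
  coded by \<open>r\<close>; the later entries of \<open>r\<close> are ignored, so a segment has
  many codes. The root is 0, which equals \<open>pr 0 0\<close>. A single edge consults finitely
  many bits of \<open>Y\<close>, whence \<open>clopen_Tr\<close>.\<close>

definition Tr :: "nat \<Rightarrow> cantor \<Rightarrow> nat \<Rightarrow> nat \<Rightarrow> bool" where
  "Tr i Y \<tau> \<tau>' \<longleftrightarrow> (\<exists>l r r'. \<tau> = pr l r \<and> \<tau>' = pr (Suc l) r' \<and> (\<forall>p. p < l \<longrightarrow> entry r' p = entry r p) \<and>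
     (\<forall>p p'. p < Suc l \<and> p' < Suc l \<longrightarrow> node_ok i Y p (entry r' p) p' (entry r' p')))"

definition ipath :: "('a \<Rightarrow> 'a \<Rightarrow> bool) \<Rightarrow> 'a \<Rightarrow> bool" where
  "ipath P a \<longleftrightarrow> (\<exists>g. g 0 = a \<and> (\<forall>n::nat. P (g n) (g (Suc n))))"

lemma ipath_Tr_iff: "ipath (Tr i Y) 0 \<longleftrightarrow> (\<exists>f. \<forall>p p'. node_ok i Y p (f p) p' (f p'))"
proof
  assume "ipath (Tr i Y) 0"
  then obtain g where g: "g 0 = 0" "\<And>n. Tr i Y (g n) (g (Suc n))" unfolding ipath_def by blast
  have "\<exists>r. g n = pr n r" for n
  proof (induction n)
    case 0 then show ?case using g(1) by (intro exI[of _ 0]) (simp add: prod_encode_def)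
  next
    case (Suc n) then show ?case using g(2)[of n] unfolding Tr_def by auto
  qed
  then obtain r where r: "\<And>n. g n = pr n (r n)" by metis
  have step: "entry (r (Suc n)) p = entry (r n) p" if "p < n" for n p
    using g(2)[of n] that by (auto simp: Tr_def r)
  have ok: "node_ok i Y p (entry (r (Suc n)) p) p' (entry (r (Suc n)) p')" if "p < Suc n" "p' < Suc n" for n p p'
    using g(2)[of n] that by (auto simp: Tr_def r)
  define f where "f p = entry (r (Suc p)) p" for p
  have f: "p < n \<Longrightarrow> entry (r n) p = f p" for n p
  proof (induction n)
    case (Suc n) then show ?case using step[of p n] by (cases "p = n") (auto simp: f_def)
  qed simp
  have "node_ok i Y p (f p) p' (f p')" for p p'
    using ok[of p "max p p'" p'] f[of p "Suc (max p p')"] f[of p' "Suc (max p p')"] by simp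
  then show "\<exists>f. \<forall>p p'. node_ok i Y p (f p) p' (f p')" by blast
next
  assume "\<exists>f. \<forall>p p'. node_ok i Y p (f p) p' (f p')"
  then obtain f where f: "\<And>p p'. node_ok i Y p (f p) p' (f p')" by blast
  have "\<forall>l. \<exists>r. \<forall>p<l. entry r p = f p" using ex_entry_prefix by blast
  then obtain r where r: "\<And>l p. p < l \<Longrightarrow> entry (r l) p = f p" by metis
  \<comment> \<open>Any number codes the empty segment; the choice 0 makes the path start at the
    root.\<close>
  define r' where "r' n = (if n = 0 then 0 else r n)" for n :: nat
  have r': "entry (r' l) p = f p" if "p < l" for l p using that r by (auto simp: r'_def)
  have "Tr i Y (pr n (r' n)) (pr (Suc n) (r' (Suc n)))" for n
    unfolding Tr_def
    by (intro exI[of _ n] exI[of _ "r' n"] exI[of _ "r' (Suc n)"])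
      (auto simp: r' f simp del: less_Suc_eq)
  moreover have "pr 0 (r' 0) = 0" by (simp add: r'_def prod_encode_def)
  ultimately show "ipath (Tr i Y) 0"
    unfolding ipath_def by (intro exI[of _ "\<lambda>n. pr n (r' n)"]) auto
qed

text \<open>The code of the formula and its number argument enter through the index alone, so the
  single \<open>Delta11\<close> relation \<open>Tr\<close> handles every \<open>Sigma11\<close>
  predicate. The flag \<open>z\<close> decides whether the real is read; with \<open>z = 0\<close>
  the tree is the same for all reals.\<close>

theorem universal_tree:
  assumes "Sigma11 (\<lambda>e s. B (e 0) (s 0))"
  obtains c where "\<And>z n Y. ipath (Tr (pr z (pr c n)) Y) 0 \<longleftrightarrow> B n (\<lambda>x. 0 < z \<and> Y x)"
proof -
  obtain Q where Q: "Arith Q" "\<And>e s. B (e 0) (s 0) \<longleftrightarrow> (\<exists>Z. Q e (case_nat Z s))"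
    using assms by (auto elim!: Sigma11E)
  then obtain f where f: "arithmetical f" "\<And>e s. sat e s f = Q e s" unfolding Arith_def by auto
  \<comment> \<open>\<open>Sigma11\<close> keeps the witness at index 0 and the real parameter at
    index 1, whereas \<open>input_ok\<close> ties the parameter to slice 0; \<open>q\<close>
    exchanges the two.\<close>
  define q where "q j = (if j = 0 then 1 else if j = 1 then 0 else j)" for j :: nat
  define h where "h = ren f id q"
  have h: "arithmetical h" "sat e s h = sat e (s \<circ> q) f" for e s
    using f by (auto simp: h_def arithmetical_ren sat_ren)
  have B: "B n Y \<longleftrightarrow> (\<exists>s. s 0 = Y \<and> sat (entry (pr n 0)) s h)" for n Y
  proof
    assume "B n Y"
    then obtain Z where "sat (entry (pr n 0)) (case_nat Z (\<lambda>_. Y)) f"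
      using Q(2)[of "entry (pr n 0)" "\<lambda>_. Y"] f by auto
    moreover have "(case_nat Z (\<lambda>_. Y) \<circ> q) \<circ> q = case_nat Z (\<lambda>_. Y)" by (auto simp: q_def fun_eq_iff)
    ultimately show "\<exists>s. s 0 = Y \<and> sat (entry (pr n 0)) s h"
      by (intro exI[of _ "case_nat Z (\<lambda>_. Y) \<circ> q"]) (simp add: h, simp add: q_def)
  next
    assume "\<exists>s. s 0 = Y \<and> sat (entry (pr n 0)) s h"
    then obtain s where s: "s 0 = Y" "sat (entry (pr n 0)) (s \<circ> q) f" using h by auto
    moreover have "s \<circ> q = case_nat (s 1) (\<lambda>j. s (q (Suc j)))" by (auto simp: q_def fun_eq_iff split: nat.splits)
    ultimately have "\<exists>Z. Q (entry (pr n 0)) (case_nat Z (\<lambda>j. s (q (Suc j))))" using f by metis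
    then show "B n Y" using Q(2)[of "entry (pr n 0)" "\<lambda>j. s (q (Suc j))"] s by (simp add: q_def)
  qed
  show ?thesis
  proof (rule that[of "encode h"])
    fix z n Y
    have posz: "(\<exists>z' c'. pr z (pr (encode h) n) = pr (Suc z') c') \<longleftrightarrow> 0 < z" by (cases z) auto
    show "ipath (Tr (pr z (pr (encode h) n)) Y) 0 \<longleftrightarrow> B n (\<lambda>x. 0 < z \<and> Y x)"
      unfolding ipath_Tr_iff B
    proof
      assume "\<exists>f. \<forall>p p'. node_ok (pr z (pr (encode h) n)) Y p (f p) p' (f p')"
      then obtain g where g: "\<And>p p'. node_ok (pr z (pr (encode h) n)) Y p (g p) p' (g p')" by blast
      have "0 < g (pr 1 (pr (encode h) (pr n 0)))"
        using g[of "pr 1 (pr (encode h) (pr n 0))" 0] by (auto simp: node_ok_def)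
      then have "sat (entry (pr n 0)) (\<lambda>j x. g (pr 0 (pr j x)) = 1) h"
        using claim_sound[OF g h(1)] by blast
      moreover have "g (pr 0 (pr 0 x)) = 1 \<longleftrightarrow> 0 < z \<and> Y x" for x
        using g[of "pr 0 (pr 0 x)" 0] posz by (auto simp: node_ok_def input_ok_def)
      ultimately show "\<exists>s. s 0 = (\<lambda>x. 0 < z \<and> Y x) \<and> sat (entry (pr n 0)) s h"
        by (intro exI[of _ "\<lambda>j x. g (pr 0 (pr j x)) = 1"]) auto
    next
      assume "\<exists>s. s 0 = (\<lambda>x. 0 < z \<and> Y x) \<and> sat (entry (pr n 0)) s h"
      then obtain s where s: "s 0 = (\<lambda>x. 0 < z \<and> Y x)" "sat (entry (pr n 0)) s h" by blast
      have "node_ok (pr z (pr (encode h) n)) Y p (claims s p) p' (claims s p')" for p p'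
        unfolding node_ok_def
      proof (intro conjI allI impI)
        show "input_ok (pr z (pr (encode h) n)) Y p (claims s p)"
          unfolding input_ok_def posz using s by (auto simp: claims_set)
      qed (auto simp: claims_pos s claim_ok_claims)
      then show "\<exists>f. \<forall>p p'. node_ok (pr z (pr (encode h) n)) Y p (f p) p' (f p')" by blast
    qed
  qed
qed

lemma Delta11_Tr:
  assumes "Delta11_num i" "Delta11_num t" "Delta11_num t'" "Delta11_real F"
  shows "Delta11 (\<lambda>e s. Tr (i e s) (F e s) (t e s) (t' e s))"
proof -
  have claim: "Delta11 (\<lambda>e s. claim_ok (p e s) (k e s) (p' e s) (w' e s))"
    if "Delta11_num p" "Delta11_num k" "Delta11_num p'" "Delta11_num w'" for p k p' w'
  proof (rule Delta11_inst[of "\<lambda>a b c d f F. claim_ok a b c d", OF _ that Delta11_num_const Delta11_real_empty])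
    show "Delta11 (\<lambda>e s. claim_ok (e 0) (e (Suc 0)) (e (Suc (Suc 0))) (e (Suc (Suc (Suc 0)))))"
      unfolding claim_ok_def by (intro Delta11_intros Delta11_num_entry Delta11_term_value)
  qed
  have "Delta11 (\<lambda>e s. Tr (e 0) (s 0) (e (Suc 0)) (e (Suc (Suc 0))))"
    unfolding Tr_def node_ok_def input_ok_def by (intro Delta11_intros Delta11_num_entry claim)
  from Delta11_inst[of "\<lambda>a b c d f F. Tr a F b c", OF this assms(1-3) Delta11_num_const Delta11_num_const assms(4)]
  show ?thesis .
qed

lemma Tr_no_input: "Tr (pr 0 c) Y = Tr (pr 0 c) Y'"
  by (simp add: Tr_def node_ok_def input_ok_def fun_eq_iff)

definition tree :: "nat \<Rightarrow> nat \<Rightarrow> nat \<Rightarrow> bool" where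
  "tree e = Tr (pr 0 (pr e e)) (\<lambda>_. False)"

text \<open>A code \<open>c\<close> of such a definition, evaluated at \<open>c\<close> itself,
  would give \<open>tree c\<close> a path exactly if it has none.\<close>

theorem wellfounded_trees_not_Sigma11: "\<not> Sigma11 (\<lambda>e s. \<not> ipath (tree (e 0)) 0)"
proof
  assume "Sigma11 (\<lambda>e s. \<not> ipath (tree (e 0)) 0)"
  from universal_tree[of "\<lambda>n Y. \<not> ipath (tree n) 0", OF this]
  obtain c where c: "\<And>z n Y. ipath (Tr (pr z (pr c n)) Y) 0 \<longleftrightarrow> \<not> ipath (tree n) 0" by metis
  from c[of 0 c "\<lambda>_. False"] show False by (simp add: tree_def)
qed

section \<open>Continuity of the tree in the real\<close>

lemma clopen_coordinate: "open {Y::cantor. Y x}" "closed {Y::cantor. Y x}"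
proof -
  have c: "continuous_on UNIV (\<lambda>Y::cantor. Y x)" by (rule continuous_on_product_coordinates)
  have "open ((\<lambda>Y::cantor. Y x) -` {True})"
    by (rule open_vimage[OF _ c]) (simp add: Topological_Spaces.open_discrete)
  moreover have "closed ((\<lambda>Y::cantor. Y x) -` {True})"
    by (rule closed_vimage[OF _ c]) simp
  moreover have "(\<lambda>Y::cantor. Y x) -` {True} = {Y. Y x}" by auto
  ultimately show "open {Y::cantor. Y x}" "closed {Y::cantor. Y x}" by simp_all
qed

lemma clopen_input_ok: "open {Y. input_ok i Y p w}" "closed {Y. input_ok i Y p w}"
proof -
  have "open {Y. input_ok i Y p w} \<and> closed {Y. input_ok i Y p w}"
  proof (cases "\<exists>x. p = pr 0 (pr 0 x)")
    case True
    then obtain x where "p = pr 0 (pr 0 x)" by blast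
    then have "{Y. input_ok i Y p w} = {Y. w = 1 \<longleftrightarrow> (\<exists>z c. i = pr (Suc z) c) \<and> Y x}"
      by (simp add: input_ok_def)
    moreover have "{Y. w = 1 \<longleftrightarrow> b \<and> Y x} \<in> {{}, UNIV, {Y. Y x}, - {Y. Y x}}" for b
      by (cases b; cases "w = 1") auto
    ultimately have "{Y. input_ok i Y p w} \<in> {{}, UNIV, {Y. Y x}, - {Y. Y x}}" by (simp only:)
    moreover have "open (- {Y::cantor. Y x})" "closed (- {Y::cantor. Y x})"
      using clopen_coordinate[of x] by (simp_all only: open_Compl closed_Compl)
    ultimately show ?thesis using clopen_coordinate[of x] by (elim insertE) simp_all
  qed (simp add: input_ok_def)
  then show "open {Y. input_ok i Y p w}" "closed {Y. input_ok i Y p w}" by auto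
qed

lemma clopen_node_ok: "open {Y. node_ok i Y p w p' w'}" "closed {Y. node_ok i Y p w p' w'}"
  unfolding node_ok_def Collect_conj_eq
  by (intro open_Int closed_Int clopen_input_ok open_Collect_const closed_Collect_const)+

lemma clopen_Tr: "open {Y. Tr i Y \<tau> \<tau>'}" "closed {Y. Tr i Y \<tau> \<tau>'}"
proof -
  obtain l r where t: "\<tau> = pr l r" by (rule pr_cases)
  obtain l' r' where t': "\<tau>' = pr l' r'" by (rule pr_cases)
  have eq: "{Y. Tr i Y \<tau> \<tau>'} = {Y. l' = Suc l \<and> (\<forall>p. p < l \<longrightarrow> entry r' p = entry r p)} \<inter>
     (\<Inter>p\<in>{..<Suc l}. \<Inter>p'\<in>{..<Suc l}. {Y. node_ok i Y p (entry r' p) p' (entry r' p')})"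
    unfolding Tr_def t t' by (auto simp del: less_Suc_eq)
  show "open {Y. Tr i Y \<tau> \<tau>'}" unfolding eq
    by (intro open_INT ballI finite_lessThan open_Int clopen_node_ok open_Collect_const)
  show "closed {Y. Tr i Y \<tau> \<tau>'}" unfolding eq
    by (intro closed_INT ballI closed_Int clopen_node_ok closed_Collect_const)
qed

section \<open>Comparison of ranks by simulations\<close>

text \<open>For \<open>H\<close> constantly true this says that the rank of \<open>s\<close> is at most that of \<open>a\<close>, where points with an infinite
  path have rank infinity; \<open>H\<close> restricts the admissible answers to the moves of \<open>P\<close>.\<close>

definition bsimul :: "(nat \<Rightarrow> nat \<Rightarrow> bool) \<Rightarrow> (nat \<Rightarrow> nat \<Rightarrow> bool) \<Rightarrow> (nat \<Rightarrow> nat \<Rightarrow> nat \<Rightarrow> nat \<Rightarrow> bool) \<Rightarrow> nat \<Rightarrow> nat \<Rightarrow> bool" where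
  "bsimul P Q H s a \<longleftrightarrow> (\<exists>S. S s a \<and>
     (\<forall>t b t'. S t b \<and> P t t' \<longrightarrow> (\<exists>b'. H t b t' b' \<and> Q b b' \<and> S t' b')))"

abbreviation simul :: "(nat \<Rightarrow> nat \<Rightarrow> bool) \<Rightarrow> (nat \<Rightarrow> nat \<Rightarrow> bool) \<Rightarrow> nat \<Rightarrow> nat \<Rightarrow> bool" where
  "simul P Q \<equiv> bsimul P Q (\<lambda>_ _ _ _. True)"

lemma bsimulI:
  assumes "S s a" "\<And>t b t'. S t b \<Longrightarrow> P t t' \<Longrightarrow> \<exists>b'. H t b t' b' \<and> Q b b' \<and> S t' b'"
  shows "bsimul P Q H s a"
  using assms unfolding bsimul_def by blast

lemma bsimul_step:
  assumes "bsimul P Q H s a" "P s s'"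
  shows "\<exists>a'. H s a s' a' \<and> Q a a' \<and> bsimul P Q H s' a'"
  using assms unfolding bsimul_def by blast

lemma bsimul_unfold:
  "bsimul P Q H s a \<longleftrightarrow> (\<forall>s'. P s s' \<longrightarrow> (\<exists>a'. H s a s' a' \<and> Q a a' \<and> bsimul P Q H s' a'))"
proof
  assume R: "\<forall>s'. P s s' \<longrightarrow> (\<exists>a'. H s a s' a' \<and> Q a a' \<and> bsimul P Q H s' a')"
  show "bsimul P Q H s a"
    by (rule bsimulI[where S = "\<lambda>t b. bsimul P Q H t b \<or> t = s \<and> b = a"])
      (use R bsimul_step[of P Q H] in blast)+
qed (use bsimul_step in blast)

lemma bsimul_mono: "bsimul P Q H s a \<Longrightarrow> simul P Q s a"
  by (rule bsimulI[where S = "bsimul P Q H"]) (use bsimul_step[of P Q H] in blast)+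

lemma simul_trans: "simul P Q s a \<Longrightarrow> simul Q R a u \<Longrightarrow> simul P R s u"
  by (rule bsimulI[where S = "\<lambda>t v. \<exists>b. simul P Q t b \<and> simul Q R b v"])
    (blast, use bsimul_step[of P Q "\<lambda>_ _ _ _. True"] bsimul_step[of Q R "\<lambda>_ _ _ _. True"] in blast)

lemma ipath_unfold: "ipath P a \<longleftrightarrow> (\<exists>b. P a b \<and> ipath P b)"
proof
  assume "ipath P a"
  then obtain g where "g 0 = a" "\<forall>n. P (g n) (g (Suc n))" unfolding ipath_def by blast
  then show "\<exists>b. P a b \<and> ipath P b"
    unfolding ipath_def by (intro exI[of _ "g 1"] conjI exI[of _ "\<lambda>n. g (Suc n)"]) auto
next
  assume "\<exists>b. P a b \<and> ipath P b"
  then obtain b g where g: "P a b" "g 0 = b" "\<forall>n. P (g n) (g (Suc n))" unfolding ipath_def by blast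
  then show "ipath P a"
    unfolding ipath_def by (intro exI[of _ "case_nat a g"]) (auto split: nat.splits)
qed

lemma ipath_coinduct:
  assumes "S a" "\<And>b. S b \<Longrightarrow> \<exists>b'. P b b' \<and> S b'"
  shows "ipath P a"
proof -
  have "\<exists>g. \<forall>n. (S (g n) \<and> (n = 0 \<longrightarrow> g n = a)) \<and> P (g n) (g (Suc n))"
    by (rule dependent_nat_choice) (use assms in auto)
  then show ?thesis unfolding ipath_def by metis
qed

lemma no_ipath_induct [consumes 1, case_names step]:
  assumes "\<not> ipath P a"
    and step: "\<And>x. \<not> ipath P x \<Longrightarrow> (\<And>y. P x y \<Longrightarrow> R y) \<Longrightarrow> R x"
  shows "R a"
proof (rule ccontr)
  assume "\<not> R a"
  have "ipath P a"
    by (rule ipath_coinduct[where S = "\<lambda>x. \<not> ipath P x \<and> \<not> R x"])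
      (use assms \<open>\<not> R a\<close> ipath_unfold[of P] in blast)+
  then show False using assms by simp
qed

lemma ipath_simul: "ipath P s \<Longrightarrow> simul P Q s a \<Longrightarrow> ipath Q a"
  by (rule ipath_coinduct[where S = "\<lambda>b. \<exists>t. ipath P t \<and> simul P Q t b"])
    (use bsimul_step[of P Q "\<lambda>_ _ _ _. True"] ipath_unfold[of P] in blast)+

lemma simul_of_ipath: "ipath Q a \<Longrightarrow> simul P Q s a"
  by (rule bsimulI[where S = "\<lambda>t b. ipath Q b"]) (use ipath_unfold[of Q] in blast)+

text \<open>Linearity of ranks, by induction along whichever side is well-founded. A move
  \<open>s'\<close> that no answer matches is the required child: by the induction hypothesis every
  child of \<open>a\<close> is simulated by some child of \<open>s'\<close>.\<close>

lemma not_simulD: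
  assumes "\<not> ipath P s \<or> \<not> ipath Q a" "\<not> simul P Q s a"
  shows "\<exists>s'. P s s' \<and> simul Q P a s'"
proof -
  have ex: "\<exists>s'. P s s' \<and> simul Q P a s'"
    if "\<not> simul P Q s a" and IH: "\<And>s' a'. P s s' \<Longrightarrow> Q a a' \<Longrightarrow> \<not> simul P Q s' a' \<Longrightarrow> \<exists>s''. P s' s'' \<and> simul Q P a' s''" for s a
  proof -
    from that(1) obtain s' where s': "P s s'" "\<And>a'. Q a a' \<Longrightarrow> \<not> simul P Q s' a'"
      using bsimul_unfold[of P Q "\<lambda>_ _ _ _. True" s a] by blast
    then have "simul Q P a s'" using IH[OF s'(1)] bsimul_unfold[of Q P "\<lambda>_ _ _ _. True" a s'] by blast
    with s' show ?thesis by blast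
  qed
  from assms(1) show ?thesis
  proof
    assume "\<not> ipath P s"
    from this assms(2) show ?thesis
    proof (induction arbitrary: a rule: no_ipath_induct)
      case (step s)
      then show ?case using ex by blast
    qed
  next
    assume "\<not> ipath Q a"
    from this assms(2) show ?thesis
    proof (induction arbitrary: s rule: no_ipath_induct)
      case (step a)
      then show ?case using ex by blast
    qed
  qed
qed

text \<open>If \<open>s\<close> were simulated by \<open>a\<close>, it would be simulated by its own
  child \<open>s'\<close>. Repeating this yields an infinite path from \<open>s\<close>, and then
  \<open>a\<close> has one too.\<close>

lemma not_simulI:
  assumes "\<not> ipath P s \<or> \<not> ipath Q a" "P s s'" "simul Q P a s'"
  shows "\<not> simul P Q s a"
proof
  assume sim: "simul P Q s a"
  have "ipath P s"
  proof (rule ipath_coinduct[where S = "\<lambda>t. \<exists>t'. P t t' \<and> simul P P t t'"])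
    show "\<exists>t'. P s t' \<and> simul P P s t'" using simul_trans[OF sim assms(3)] assms(2) by blast
    show "\<exists>b'. P b b' \<and> (\<exists>t'. P b' t' \<and> simul P P b' t')" if "\<exists>t'. P b t' \<and> simul P P b t'" for b
      using that bsimul_step[of P P "\<lambda>_ _ _ _. True"] by blast
  qed
  then show False using assms ipath_simul[OF _ sim] by blast
qed

text \<open>This is what makes simulations useful: with one side well-founded, the complement of a
  simulation is again expressed by simulations, hence is \<open>Sigma11\<close> for the trees at
  hand.\<close>

lemma not_simul_iff:
  "\<not> ipath P s \<or> \<not> ipath Q a \<Longrightarrow> \<not> simul P Q s a \<longleftrightarrow> (\<exists>s'. P s s' \<and> simul Q P a s')"
  using not_simulD[of P s Q a] not_simulI[of P s Q a] by blast

text \<open>Descend from \<open>r\<close> through children whose rank is still at least that of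
  \<open>t\<close>. The descent must stop, and it can only stop at equal rank.\<close>

lemma same_rank_node:
  assumes "\<not> ipath R r" "\<not> simul R T r t"
  shows "\<exists>a. simul R T a t \<and> simul T R t a"
  using assms
proof (induction rule: no_ipath_induct)
  case (step r)
  then obtain r' where "R r r'" "simul T R t r'" using not_simulD by blast
  then show ?case using step by blast
qed

lemma Sigma11_bsimul_Tr:
  assumes "Delta11_num i" "Delta11_num j" "Delta11_num t" "Delta11_num t'" "Delta11_real F"
  shows "Sigma11 (\<lambda>e s. simul (Tr (i e s) (F e s)) (Tr (j e s) (F e s)) (t e s) (t' e s))"
proof -
  have eq: "simul P Q t b \<longleftrightarrow> (\<exists>Z. Z (pr t b) \<and> 
    (\<forall>t b t'. Z (pr t b) \<and> P t t' \<longrightarrow> (\<exists>b'. Q b b' \<and> Z (pr t' b'))))" for P Q t b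
  proof
    assume "simul P Q t b"
    then show "\<exists>Z. Z (pr t b) \<and> (\<forall>t b t'. Z (pr t b) \<and> P t t' \<longrightarrow> (\<exists>b'. Q b b' \<and> Z (pr t' b')))"
      using bsimul_step[of P Q "\<lambda>_ _ _ _. True"]
      by (intro exI[of _ "\<lambda>z. case prod_decode z of (t, b) \<Rightarrow> simul P Q t b"]) auto
  next
    assume "\<exists>Z. Z (pr t b) \<and> (\<forall>t b t'. Z (pr t b) \<and> P t t' \<longrightarrow> (\<exists>b'. Q b b' \<and> Z (pr t' b')))"
    then obtain Z where "Z (pr t b)" "\<forall>t b t'. Z (pr t b) \<and> P t t' \<longrightarrow> (\<exists>b'. Q b b' \<and> Z (pr t' b'))" by blast
    then show "simul P Q t b" by (intro bsimulI[where S = "\<lambda>t b. Z (pr t b)"]) auto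
  qed
  have "Sigma11 (\<lambda>e s. simul (Tr (e 0) (s 0)) (Tr (e (Suc 0)) (s 0)) (e (Suc (Suc 0))) (e (Suc (Suc (Suc 0)))))"
    unfolding eq by (intro Sigma11_intros; (rule Sigma11_Delta11)?; intro Delta11_intros Delta11_Tr)
  from Sigma11_inst[of "\<lambda>a b c d f F. simul (Tr a F) (Tr b F) c d", OF this assms(1-4) Delta11_num_const assms(5)]
  show ?thesis .
qed

lemma Sigma11_ipath_Tr:
  assumes "Delta11_num i" "Delta11_real F"
  shows "Sigma11 (\<lambda>e s. ipath (Tr (i e s) (F e s)) a)"
proof -
  have eq: "ipath P a \<longleftrightarrow> (\<exists>Z. Z a \<and> (\<forall>t. Z t \<longrightarrow> (\<exists>t'. P t t' \<and> Z t')))" for P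
  proof
    assume "ipath P a"
    then show "\<exists>Z. Z a \<and> (\<forall>t. Z t \<longrightarrow> (\<exists>t'. P t t' \<and> Z t'))"
      using ipath_unfold[of P] by (intro exI[of _ "ipath P"]) blast
  next
    assume "\<exists>Z. Z a \<and> (\<forall>t. Z t \<longrightarrow> (\<exists>t'. P t t' \<and> Z t'))"
    then obtain Z where "Z a" "\<forall>t. Z t \<longrightarrow> (\<exists>t'. P t t' \<and> Z t')" by blast
    then show "ipath P a" by (intro ipath_coinduct[where S = Z]) auto
  qed
  have "Sigma11 (\<lambda>e s. ipath (Tr (e 0) (s 0)) a)"
    unfolding eq by (intro Sigma11_intros; (rule Sigma11_Delta11)?; intro Delta11_intros Delta11_Tr)
  from Sigma11_inst[of "\<lambda>i b c d f F. ipath (Tr i F) a", OF this assms(1) Delta11_num_const Delta11_num_const Delta11_num_const Delta11_num_const assms(2)]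
  show ?thesis .
qed

text \<open>The game stopped after \<open>n\<close> moves. With finitely many admissible answers
  these stages are closed, and they shrink to \<open>bsimul\<close>.\<close>

primrec nsimul where
  "nsimul P Q H 0 s a \<longleftrightarrow> True"
| "nsimul P Q H (Suc n) s a \<longleftrightarrow> (\<forall>s'. P s s' \<longrightarrow> (\<exists>a'. H s a s' a' \<and> Q a a' \<and> nsimul P Q H n s' a'))"

lemma nsimul_of_bsimul: "bsimul P Q H s a \<Longrightarrow> nsimul P Q H n s a"
proof (induction n arbitrary: s a)
  case (Suc n)
  then show ?case using bsimul_step[of P Q H s a] by fastforce
qed simp

lemma nsimul_Suc: "nsimul P Q H (Suc n) s a \<Longrightarrow> nsimul P Q H n s a"
proof (induction n arbitrary: s a)
  case (Suc n)
  then show ?case by (metis nsimul.simps(2))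
qed simp

lemma nsimul_antimono: "m \<le> n \<Longrightarrow> nsimul P Q H n s a \<Longrightarrow> nsimul P Q H m s a"
  by (induction rule: inc_induct) (auto dest: nsimul_Suc simp del: nsimul.simps)

text \<open>Compactness: among finitely many admissible answers, one survives every number of
  rounds. The invariant \<open>G\<close> confines the finiteness hypothesis to pairs that can be
  reached.\<close>

lemma bsimul_iff_nsimul:
  assumes fin: "\<And>t b t'. G t b \<Longrightarrow> finite {b'. H t b t' b'}"
    and G: "G s a" "\<And>t b t' b'. G t b \<Longrightarrow> P t t' \<Longrightarrow> Q b b' \<Longrightarrow> G t' b'"
  shows "bsimul P Q H s a \<longleftrightarrow> (\<forall>n. nsimul P Q H n s a)"
proof (intro iffI allI nsimul_of_bsimul)
  assume all: "\<forall>n. nsimul P Q H n s a"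
  show "bsimul P Q H s a"
  proof (rule bsimulI[where S = "\<lambda>t b. G t b \<and> (\<forall>n. nsimul P Q H n t b)"])
    show "G s a \<and> (\<forall>n. nsimul P Q H n s a)" using G all by simp
    fix t b t' assume t: "G t b \<and> (\<forall>n. nsimul P Q H n t b)" "P t t'"
    have "\<exists>b'. H t b t' b' \<and> Q b b' \<and> (\<forall>n. nsimul P Q H n t' b')"
    proof (rule ccontr)
      assume "\<not> ?thesis"
      then obtain N where N: "\<And>b'. H t b t' b' \<Longrightarrow> Q b b' \<Longrightarrow> \<not> nsimul P Q H (N b') t' b'" by metis
      have "finite (N ` {b'. H t b t' b'})" using fin t by simp
      then obtain m where m: "\<And>b'. H t b t' b' \<Longrightarrow> N b' \<le> m"
        by (auto simp: finite_nat_set_iff_bounded_le)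
      have "nsimul P Q H (Suc m) t b" using t by blast
      then obtain b' where "H t b t' b'" "Q b b'" "nsimul P Q H m t' b'" using t by auto
      then show False
        using N[of b'] m[of b'] nsimul_antimono[of "N b'" m P Q H t' b'] by blast
    qed
    then show "\<exists>b'. H t b t' b' \<and> Q b b' \<and> G t' b' \<and> (\<forall>n. nsimul P Q H n t' b')"
      using t G by blast
  qed
qed

lemma closed_nsimul:
  fixes P Q :: "cantor \<Rightarrow> nat \<Rightarrow> nat \<Rightarrow> bool"
  assumes P: "\<And>t t'. open {Y. P Y t t'}" "\<And>t t'. closed {Y. P Y t t'}" and Q: "\<And>b b'. closed {Y. Q Y b b'}"
    and fin: "\<And>t b t'. G t b \<Longrightarrow> finite {b'. H t b t' b'}"
    and G: "\<And>Y t b t' b'. G t b \<Longrightarrow> P Y t t' \<Longrightarrow> Q Y b b' \<Longrightarrow> G t' b'"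
  shows "G s a \<Longrightarrow> closed {Y. nsimul (P Y) (Q Y) H n s a}"
proof (induction n arbitrary: s a)
  case (Suc n)
  \<comment> \<open>Both moves stay in the intersection because \<open>G s' a'\<close>, which the
    induction hypothesis asks for, is known only if some \<open>Y\<close> allows both.\<close>
  have "closed ({Y. P Y s s'} \<inter> {Y. Q Y a a'} \<inter> {Y. nsimul (P Y) (Q Y) H n s' a'})" for s' a'
  proof (cases "{Y. P Y s s'} \<inter> {Y. Q Y a a'} = {}")
    case False
    then have "G s' a'" using G Suc.prems by blast
    then show ?thesis by (intro closed_Int P Q Suc.IH)
  qed simp
  then have "closed (\<Inter>s'. - {Y. P Y s s'} \<union> (\<Union>a'\<in>{a'. H s a s' a'}.
    {Y. P Y s s'} \<inter> {Y. Q Y a a'} \<inter> {Y. nsimul (P Y) (Q Y) H n s' a'}))"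
    by (intro closed_INT ballI closed_Un closed_UN fin Suc.prems) (auto simp: P closed_def)
  also have "(\<Inter>s'. - {Y. P Y s s'} \<union> (\<Union>a'\<in>{a'. H s a s' a'}.
    {Y. P Y s s'} \<inter> {Y. Q Y a a'} \<inter> {Y. nsimul (P Y) (Q Y) H n s' a'})) = {Y. nsimul (P Y) (Q Y) H (Suc n) s a}"
    by (auto 0 4)
  finally show ?case .
qed simp

lemma closed_bsimul:
  fixes P Q :: "cantor \<Rightarrow> nat \<Rightarrow> nat \<Rightarrow> bool"
  assumes P: "\<And>t t'. open {Y. P Y t t'}" "\<And>t t'. closed {Y. P Y t t'}" and Q: "\<And>b b'. closed {Y. Q Y b b'}"
    and fin: "\<And>t b t'. G t b \<Longrightarrow> finite {b'. H t b t' b'}"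
    and G: "\<And>Y t b t' b'. G t b \<Longrightarrow> P Y t t' \<Longrightarrow> Q Y b b' \<Longrightarrow> G t' b'" "G s a"
  shows "closed {Y. bsimul (P Y) (Q Y) H s a}"
proof -
  have "bsimul (P Y) (Q Y) H s a \<longleftrightarrow> (\<forall>n. nsimul (P Y) (Q Y) H n s a)" for Y
    by (rule bsimul_iff_nsimul[where G = G]) (use fin G in blast)+
  then have "{Y. bsimul (P Y) (Q Y) H s a} = (\<Inter>n. {Y. nsimul (P Y) (Q Y) H n s a})"
    by auto
  then show ?thesis
    using closed_nsimul[of P Q G H, OF P Q fin G(1) G(2)] by (simp add: closed_INT)
qed

section \<open>Measure of \<open>\<Sigma>\<^sup>1\<^sub>1\<close> classes\<close>

abbreviation "M \<equiv> cantor_measure"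

interpretation CM: prob_space M
proof -
  interpret product_prob_space "\<lambda>_::nat. measure_pmf (bernoulli_pmf (1/2))" UNIV
    by unfold_locales
  show "prob_space M" unfolding cantor_measure_def by (rule prob_space_completion)
qed

interpretation CM: complete_measure M
  unfolding cantor_measure_def by (rule completion.complete_measure_axioms)

lemma space_M [simp]: "space M = UNIV"
  by (simp add: cantor_measure_def space_PiM)

lemma open_in_sets_cantor_measure:
  fixes F :: "cantor set"
  shows "open F \<Longrightarrow> F \<in> sets M"
  using closed_in_sets_cantor_measure[of "- F"] sets.compl_sets[of "- F" M]
  by (auto simp: Compl_eq_Diff_UNIV[symmetric] closed_def)

section \<open>Cylinders and counting\<close>

definition cyl :: "nat \<Rightarrow> cantor \<Rightarrow> cantor set" where
  "cyl l X = {Y. \<forall>j<l. Y j = X j}"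

lemma clopen_cyl: "open (cyl l X)" "closed (cyl l X)"
proof -
  have eq: "cyl l X = (\<Inter>j\<in>{..<l}. if X j then {Y. Y j} else - {Y. Y j})"
    by (auto simp: cyl_def split: if_splits)
  show "open (cyl l X)" unfolding eq
    by (intro open_INT ballI finite_lessThan) (auto simp: clopen_coordinate open_Compl)
  show "closed (cyl l X)" unfolding eq
    by (intro closed_INT ballI) (auto simp: clopen_coordinate closed_Compl)
qed

lemma sets_cyl [measurable]: "cyl l X \<in> sets M"
  by (intro closed_in_sets_cantor_measure clopen_cyl)

lemma measure_cyl: "measure M (cyl l X) = 1 / 2 ^ l"
proof -
  let ?B = "\<lambda>_::nat. measure_pmf (bernoulli_pmf (1/2))"
  have cyl: "cyl l X = prod_emb UNIV ?B {..<l} (Pi\<^sub>E {..<l} (\<lambda>j. {X j}))"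
    by (auto simp: cyl_def prod_emb_def PiE_def extensional_def Pi_def)
  then have S: "cyl l X \<in> sets (PiM UNIV ?B)" by (auto intro!: sets_PiM_I)
  have "emeasure M (cyl l X) = emeasure (PiM UNIV ?B) (cyl l X)"
    unfolding cantor_measure_def using S by simp
  also have "\<dots> = (\<Prod>j<l. emeasure (measure_pmf (bernoulli_pmf (1/2))) {X j})"
    unfolding cyl by (rule emeasure_PiM_emb) (auto simp: measure_pmf.prob_space_axioms)
  also have "\<dots> = (\<Prod>j<l. ennreal (1/2))"
    by (intro prod.cong refl) (simp add: emeasure_pmf_single pmf_bernoulli_half)
  also have "\<dots> = ennreal ((1/2) ^ l)"
    by (subst prod_constant, subst ennreal_power) simp_all
  finally show ?thesis by (simp add: measure_def power_one_over)
qed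

lemma open_contains_cyl:
  fixes U :: "cantor set"
  assumes "open U" "X \<in> U"
  shows "\<exists>l. cyl l X \<subseteq> U"
proof -
  have "openin (product_topology (\<lambda>_. euclidean) UNIV) U"
    using assms(1) unfolding euclidean_product_topology by (rule open_openin[THEN iffD1])
  from this[unfolded openin_product_topology_alt, rule_format, OF assms(2)]
  obtain A where A: "finite {i. A i \<noteq> (UNIV :: bool set)}" "X \<in> Pi\<^sub>E UNIV A" "Pi\<^sub>E UNIV A \<subseteq> U"
    by (elim exE conjE) simp
  then obtain l where l: "\<And>i. A i \<noteq> UNIV \<Longrightarrow> i < l" by (auto simp: finite_nat_set_iff_bounded)
  have "Y \<in> U" if "Y \<in> cyl l X" for Y
  proof -
    have "Y i \<in> A i" for i
    proof (cases "A i = UNIV")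
      case False
      then have "Y i = X i" using l that by (auto simp: cyl_def)
      then show ?thesis using A(2) by (auto simp: PiE_def Pi_def)
    qed simp
    then show ?thesis using A(3) by (auto simp: PiE_def Pi_def)
  qed
  then show ?thesis by blast
qed

definition truncations :: "nat \<Rightarrow> cantor set \<Rightarrow> nat set set" where
  "truncations l K = (\<lambda>Z. {j. j < l \<and> Z j}) ` K"

lemma finite_truncations: "finite (truncations l K)"
  by (rule finite_subset[of _ "Pow {..<l}"]) (auto simp: truncations_def)

lemma measure_UN_cyl: "measure M (\<Union>Z\<in>K. cyl l Z) = card (truncations l K) / 2 ^ l"
proof -
  have eq: "(\<Union>Z\<in>K. cyl l Z) = (\<Union>A\<in>truncations l K. cyl l (\<lambda>j. j \<in> A))"
    by (auto simp: truncations_def cyl_def)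
  have disj: "disjoint_family_on (\<lambda>A. cyl l (\<lambda>j. j \<in> A)) (truncations l K)"
    unfolding disjoint_family_on_def truncations_def cyl_def by (auto; blast)
  show ?thesis unfolding eq
    by (subst CM.finite_measure_finite_Union[OF finite_truncations _ disj]) (auto simp: measure_cyl)
qed

text \<open>A closed set is the decreasing intersection of its neighbourhoods by cylinders of length
  \<open>l\<close>, whose measures are counts of truncations.\<close>

lemma measure_closed_ge_iff:
  assumes "closed K"
  shows "q \<le> measure M K \<longleftrightarrow> (\<forall>l. q * 2 ^ l \<le> card (truncations l K))"
proof -
  define U where "U l = (\<Union>Z\<in>K. cyl l Z)" for l
  have U: "U l \<in> sets M" for l
    unfolding U_def by (intro open_in_sets_cantor_measure open_UN ballI clopen_cyl)
  have dec: "decseq U" by (auto simp: decseq_def U_def cyl_def)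
  have K: "K = (\<Inter>l. U l)"
  proof
    show "K \<subseteq> (\<Inter>l. U l)" by (auto simp: U_def cyl_def)
    show "(\<Inter>l. U l) \<subseteq> K"
    proof (rule ccontr)
      assume "\<not> ?thesis"
      then obtain X where X: "X \<in> (\<Inter>l. U l)" "X \<in> - K" by blast
      then obtain l where "cyl l X \<subseteq> - K" using open_contains_cyl[of "- K" X] assms by auto
      moreover obtain Z where "Z \<in> K" "X \<in> cyl l Z" using X by (auto simp: U_def)
      ultimately show False by (auto simp: cyl_def)
    qed
  qed
  have lim: "(\<lambda>l. measure M (U l)) \<longlonglongrightarrow> measure M K"
    unfolding K using U by (intro CM.finite_Lim_measure_decseq dec) auto
  have "q \<le> measure M K \<longleftrightarrow> (\<forall>l. q \<le> measure M (U l))"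
  proof
    assume "q \<le> measure M K"
    moreover have "measure M K \<le> measure M (U l)" for l
      by (rule CM.finite_measure_mono) (auto simp: K U)
    ultimately show "\<forall>l. q \<le> measure M (U l)" by (meson order_trans)
  qed (use LIMSEQ_le_const[OF lim] in auto)
  also have "\<dots> \<longleftrightarrow> (\<forall>l. q * 2 ^ l \<le> card (truncations l K))"
    by (simp add: U_def measure_UN_cyl field_simps)
  finally show ?thesis .
qed

text \<open>Counting by exhibiting members of \<open>K\<close> that pairwise differ below
  \<open>l\<close> keeps the statement \<open>Sigma11\<close> whenever membership in
  \<open>K\<close> is.\<close>

lemma card_truncations_ge_iff:
  "N \<le> card (truncations l K) \<longleftrightarrow>
   (\<exists>W::nat \<Rightarrow> cantor. (\<forall>n<N. W n \<in> K) \<and> (\<forall>n n'. n < n' \<and> n' < N \<longrightarrow> (\<exists>j<l. \<not> (W n j \<longleftrightarrow> W n' j))))"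
proof
  assume N: "N \<le> card (truncations l K)"
  obtain h where h: "bij_betw h {0..<card (truncations l K)} (truncations l K)"
    using ex_bij_betw_nat_finite[OF finite_truncations] by blast
  have "\<forall>n\<in>{0..<card (truncations l K)}. \<exists>Z\<in>K. h n = {j. j < l \<and> Z j}"
  proof
    fix n assume "n \<in> {0..<card (truncations l K)}"
    then have "h n \<in> truncations l K" by (rule bij_betwE[OF h, rule_format])
    then show "\<exists>Z\<in>K. h n = {j. j < l \<and> Z j}" unfolding truncations_def by blast
  qed
  then have "\<exists>W. \<forall>n\<in>{0..<card (truncations l K)}. W n \<in> K \<and> h n = {j. j < l \<and> W n j}"
    by (intro bchoice) blast
  then obtain W where "\<forall>n\<in>{0..<card (truncations l K)}. W n \<in> K \<and> h n = {j. j < l \<and> W n j}"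
    by blast
  then have W: "\<And>n. n < card (truncations l K) \<Longrightarrow> W n \<in> K \<and> h n = {j. j < l \<and> W n j}"
    by simp
  have "\<exists>j<l. \<not> (W n j \<longleftrightarrow> W n' j)" if "n < n'" "n' < N" for n n'
  proof -
    have "h n \<noteq> h n'"
      using inj_on_contraD[OF bij_betw_imp_inj_on[OF h], of n n'] that N by simp
    then show ?thesis using W[of n] W[of n'] that N by auto
  qed
  then show "\<exists>W::nat \<Rightarrow> cantor. (\<forall>n<N. W n \<in> K) \<and> (\<forall>n n'. n < n' \<and> n' < N \<longrightarrow> (\<exists>j<l. \<not> (W n j \<longleftrightarrow> W n' j)))"
    using W N by (intro exI[of _ W]) auto
next
  assume "\<exists>W::nat \<Rightarrow> cantor. (\<forall>n<N. W n \<in> K) \<and> (\<forall>n n'. n < n' \<and> n' < N \<longrightarrow> (\<exists>j<l. \<not> (W n j \<longleftrightarrow> W n' j)))"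
  then obtain W where W: "\<And>n. n < N \<Longrightarrow> W n \<in> K" "\<And>n n'. n < n' \<Longrightarrow> n' < N \<Longrightarrow> \<exists>j<l. \<not> (W n j \<longleftrightarrow> W n' j)"
    by blast
  have "inj_on (\<lambda>n. {j. j < l \<and> W n j}) {..<N}"
  proof (rule linorder_inj_onI)
    fix n n' assume "n < n'" "n \<in> {..<N}" "n' \<in> {..<N}"
    then obtain j where "j < l" "\<not> (W n j \<longleftrightarrow> W n' j)" using W(2)[of n n'] by blast
    then show "{j. j < l \<and> W n j} \<noteq> {j. j < l \<and> W n' j}" by auto
  qed auto
  moreover have "(\<lambda>n. {j. j < l \<and> W n j}) ` {..<N} \<subseteq> truncations l K" using W by (auto simp: truncations_def)
  ultimately show "N \<le> card (truncations l K)" using card_inj_on_le[OF _ _ finite_truncations] by fastforce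
qed

section \<open>Inner regularity of analytic classes\<close>

abbreviation chain :: "nat \<Rightarrow> nat \<Rightarrow> bool" where "chain n n' \<equiv> n' = Suc n"

lemma ipath_chain: "ipath chain n"
  by (rule ipath_coinduct[where S = "\<lambda>_. True"]) auto

text \<open>\<open>chain\<close> offers exactly one move, so playing it against \<open>P\<close>
  traces an infinite path of \<open>P\<close> while the first component counts the steps. In this
  way classes of bounded paths fall under \<open>closed_bsimul\<close>.\<close>

lemma ipath_of_bsimul_chain: "bsimul chain P H n a \<Longrightarrow> ipath P a"
  using ipath_simul[OF ipath_chain bsimul_mono] .

text \<open>Capacitability of analytic sets. The bounds on the values of a path are chosen one after
  the other, each so large that the outer measure stays above \<open>q\<close>; compactness then
  gives a path bounded throughout. Outer measure is used because measurability of the class is only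
  a consequence (\<open>sets_ipath\<close>).\<close>

lemma analytic_approx:
  fixes P :: "cantor \<Rightarrow> nat \<Rightarrow> nat \<Rightarrow> bool"
  assumes P: "\<And>t t'. closed {Y. P Y t t'}"
    and q: "ennreal q < outer_measure_of M {Y. ipath (P Y) 0}"
  shows "\<exists>v. q \<le> measure M {Y. bsimul chain (P Y) (\<lambda>t b t' b'. b' \<le> v t') 0 0}"
proof -
  define A where "A n v = {Y. \<exists>f. f 0 = 0 \<and> (\<forall>k. P Y (f k) (f (Suc k))) \<and> (\<forall>j\<le>n. f j \<le> v j)}"
    for n and v :: "nat \<Rightarrow> nat"
  have "\<exists>v. \<forall>n. ennreal q < outer_measure_of M (A n (v n)) \<and> (\<forall>j\<le>n. v (Suc n) j = v n j)"
  proof (rule dependent_nat_choice)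
    \<comment> \<open>Paths start at 0, so bounding the first value by 0 loses nothing.\<close>
    have "A 0 (\<lambda>_. 0) = {Y. ipath (P Y) 0}" by (auto simp: A_def ipath_def)
    then show "\<exists>v. ennreal q < outer_measure_of M (A 0 v)" using q by metis
    fix v n assume v: "ennreal q < outer_measure_of M (A n v)"
    have "A n v = (\<Union>b. A (Suc n) (v(Suc n := b)))"
    proof (intro set_eqI iffI)
      fix Y assume "Y \<in> A n v"
      then obtain f where f: "f 0 = 0" "\<forall>k. P Y (f k) (f (Suc k))" "\<forall>j\<le>n. f j \<le> v j" by (auto simp: A_def)
      then have "Y \<in> A (Suc n) (v(Suc n := f (Suc n)))"
        unfolding A_def by (intro CollectI exI[of _ f]) (auto simp: le_Suc_eq)
      then show "Y \<in> (\<Union>b. A (Suc n) (v(Suc n := b)))" by blast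
    next
      fix Y assume "Y \<in> (\<Union>b. A (Suc n) (v(Suc n := b)))"
      then obtain b f where f: "f 0 = 0" "\<forall>k. P Y (f k) (f (Suc k))" "\<forall>j\<le>Suc n. f j \<le> (v(Suc n := b)) j"
        by (auto simp: A_def)
      have "f j \<le> v j" if "j \<le> n" for j using f(3)[rule_format, of j] that by auto
      with f show "Y \<in> A n v" by (auto simp: A_def)
    qed
    moreover have "incseq (\<lambda>b. A (Suc n) (v(Suc n := b)))"
      unfolding incseq_def A_def by (auto simp: le_Suc_eq) (metis order_trans)
    ultimately have "ennreal q < (SUP b. outer_measure_of M (A (Suc n) (v(Suc n := b))))"
      using v by (subst SUP_outer_measure_of_incseq) auto
    then obtain b where "ennreal q < outer_measure_of M (A (Suc n) (v(Suc n := b)))"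
      by (auto simp: less_SUP_iff)
    then show "\<exists>w. ennreal q < outer_measure_of M (A (Suc n) w) \<and> (\<forall>j\<le>n. w j = v j)"
      by (intro exI[of _ "v(Suc n := b)"]) auto
  qed
  then obtain u where u: "\<And>n. ennreal q < outer_measure_of M (A n (u n))" "\<And>n j. j \<le> n \<Longrightarrow> u (Suc n) j = u n j"
    by blast
  define v where "v j = u j j" for j
  have uv: "u n j = v j" if "j \<le> n" for n j
    using that by (induction rule: dec_induct) (auto simp: v_def u(2))
  define H where "H = (\<lambda>(t::nat) (b::nat) t' b'. b' \<le> v t')"
  define C where "C n = {Y. nsimul chain (P Y) H n 0 0}" for n
  have C: "closed (C n)" for n
    unfolding C_def by (rule closed_nsimul[where G = "\<lambda>_ _. True" and P = "\<lambda>_. chain" and Q = P]) (auto simp: P H_def)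
  have AC: "A n (u n) \<subseteq> C n" for n
  proof
    fix Y assume "Y \<in> A n (u n)"
    then obtain f where f: "f 0 = 0" "\<And>k. P Y (f k) (f (Suc k))" "\<And>j. j \<le> n \<Longrightarrow> f j \<le> v j"
      using uv by (auto simp: A_def)
    have "nsimul chain (P Y) H m k (f k)" if "k + m \<le> n" for m k
      using that
    proof (induction m arbitrary: k)
      case (Suc m)
      then have "nsimul chain (P Y) H m (Suc k) (f (Suc k))" "f (Suc k) \<le> v (Suc k)" using f(3) by auto
      then show ?case using f(2)[of k] by (auto simp: H_def)
    qed simp
    from this[of 0 n] show "Y \<in> C n" using f by (simp add: C_def)
  qed
  have ge: "q \<le> measure M (C n)" for n
  proof -
    have "ennreal q < emeasure M (C n)"
      using u(1)[of n] outer_measure_of_mono[OF AC, of M n] closed_in_sets_cantor_measure[OF C]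
      by (metis order_less_le_trans outer_measure_of_eq)
    then show ?thesis
      by (metis CM.emeasure_eq_measure ennreal_leI linorder_not_le nle_le)
  qed
  have "bsimul chain (P Y) H 0 0 \<longleftrightarrow> (\<forall>n. nsimul chain (P Y) H n 0 0)" for Y
    by (rule bsimul_iff_nsimul[where G = "\<lambda>_ _. True"]) (auto simp: H_def)
  then have eq: "{Y. bsimul chain (P Y) H 0 0} = (\<Inter>n. C n)"
    by (auto simp: C_def)
  have "decseq C" unfolding decseq_def C_def by (auto intro: nsimul_antimono)
  then have "(\<lambda>n. measure M (C n)) \<longlonglongrightarrow> measure M (\<Inter>n. C n)"
    using closed_in_sets_cantor_measure[OF C] by (intro CM.finite_Lim_measure_decseq) auto
  then have "q \<le> measure M (\<Inter>n. C n)" using ge by (intro LIMSEQ_le_const) auto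
  then show ?thesis using eq unfolding H_def by metis
qed

lemma closed_bsimul_chain:
  fixes P :: "cantor \<Rightarrow> nat \<Rightarrow> nat \<Rightarrow> bool"
  assumes P: "\<And>t t'. closed {Y. P Y t t'}" and H: "\<And>t b t'. finite {b'. H t b t' b'}"
  shows "closed {Y. bsimul chain (P Y) H 0 0}"
  by (rule closed_bsimul[where G = "\<lambda>_ _. True" and P = "\<lambda>_. chain" and Q = P]) (use assms in auto)

text \<open>Closed subsets come within \<open>1 / Suc n\<close> of the measure of a measurable hull
  \<open>E\<close>. The class thus lies between their union and \<open>E\<close>, two sets of equal
  measure, and the measure is complete.\<close>

lemma sets_ipath:
  fixes P :: "cantor \<Rightarrow> nat \<Rightarrow> nat \<Rightarrow> bool"
  assumes P: "\<And>t t'. closed {Y. P Y t t'}"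
  shows "{Y. ipath (P Y) 0} \<in> sets M"
proof -
  let ?V = "{Y. ipath (P Y) 0}"
  obtain E where E: "E \<in> sets M" "?V \<subseteq> E" "outer_measure_of M ?V = emeasure M E"
    using outer_measure_of_attain[of ?V M] by auto
  have "\<exists>K. closed K \<and> K \<subseteq> ?V \<and> measure M E - 1 / Suc n \<le> measure M K" for n
  proof (cases "measure M E - 1 / Suc n < 0")
    case True
    then show ?thesis by (intro exI[of _ "{}"]) auto
  next
    case False
    then have "ennreal (measure M E - 1 / Suc n) < outer_measure_of M ?V"
      unfolding E(3) CM.emeasure_eq_measure by (intro ennreal_lessI) (auto simp: measure_nonneg less_le)
    from analytic_approx[OF P this] obtain v
      where "measure M E - 1 / Suc n \<le> measure M {Y. bsimul chain (P Y) (\<lambda>t b t' b'. b' \<le> v t') 0 0}" by blast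
    moreover have "closed {Y. bsimul chain (P Y) (\<lambda>t b t' b'. b' \<le> v t') 0 0}"
      by (rule closed_bsimul_chain[OF P]) auto
    ultimately show ?thesis using ipath_of_bsimul_chain by blast
  qed
  then obtain K where K: "\<And>n. closed (K n)" "\<And>n. K n \<subseteq> ?V" "\<And>n. measure M E - 1 / Suc n \<le> measure M (K n)"
    by metis
  have UK: "(\<Union>n. K n) \<in> sets M" using K(1) by (auto intro: closed_in_sets_cantor_measure)
  have "measure M E - measure M (\<Union>n. K n) \<le> 1 / Suc n" for n
  proof -
    have "measure M (K n) \<le> measure M (\<Union>n. K n)" by (rule CM.finite_measure_mono[OF _ UK]) blast
    then show ?thesis using K(3)[of n] by linarith
  qed
  then have "measure M E \<le> measure M (\<Union>n. K n)"
    by (metis LIMSEQ_inverse_real_of_nat LIMSEQ_le_const inverse_eq_divide le_iff_diff_le_0)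
  moreover have "measure M (\<Union>n. K n) \<le> measure M E"
    using K(2) E by (intro CM.finite_measure_mono) auto
  ultimately have "emeasure M (\<Union>n. K n) = emeasure M E" by (simp add: CM.emeasure_eq_measure)
  moreover have "(\<Union>n. K n) \<subseteq> ?V" using K(2) by blast
  moreover have "emeasure M (\<Union>n. K n) < \<infinity>" by (simp add: CM.emeasure_eq_measure)
  ultimately show ?thesis using CM.complete_sets_sandwich[OF UK E(1) _ E(2)] by blast
qed

lemma sets_Sigma11:
  assumes "Sigma11 (\<lambda>e s. B (e 0) (s 0))"
  shows "{Y. B n Y} \<in> sets M"
proof -
  obtain c where "\<And>z n Y. ipath (Tr (pr z (pr c n)) Y) 0 \<longleftrightarrow> B n (\<lambda>x. 0 < z \<and> Y x)"
    using universal_tree[OF assms] by metis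
  then have "{Y. B n Y} = {Y. ipath (Tr (pr 1 (pr c n)) Y) 0}" by simp
  then show ?thesis using sets_ipath clopen_Tr by metis
qed

section \<open>Definability of measure\<close>

lemma Delta11_real_slice: assumes "Delta11_num f" shows "Delta11_real (\<lambda>e s x. s i (pr (f e s) x))"
  unfolding Delta11_real_def
  using Delta11_num_ren[OF assms, where r = Suc and q = "\<lambda>j. j"] by (intro Delta11_mem Delta11_num_pr Delta11_num_var)

lemma dyadic_between:
  fixes a b :: real
  assumes "0 \<le> a" "a < b"
  shows "\<exists>k m. a < real k / 2 ^ m \<and> real k / 2 ^ m < b"
proof -
  obtain m where m: "(1/2) ^ m < b - a" using real_arch_pow_inv[of "b - a" "1/2"] assms by auto
  define k where "k = nat \<lfloor>a * 2 ^ m\<rfloor> + 1"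
  have k: "real k = \<lfloor>a * 2 ^ m\<rfloor> + 1" using assms by (simp add: k_def)
  have "a * 2 ^ m < real k" "real k \<le> a * 2 ^ m + 1" unfolding k by linarith+
  moreover have "a * 2 ^ m + 1 < b * 2 ^ m"
    using m by (simp add: power_one_over field_simps)
  ultimately show ?thesis by (intro exI[of _ k] exI[of _ m]) (auto simp: field_simps)
qed

text \<open>The measure exceeds a number iff some closed subset, given by bounds on the paths, has
  measure at least a larger dyadic number. The bounds form a real, and the measure of a closed set
  is a matter of counting. Strictness leaves room for the loss in passing to a closed
  subset.\<close>

theorem Sigma11_measure:
  assumes B: "Sigma11 (\<lambda>e s. B (e 0) (s 0))" and "Delta11_num i" "Delta11_num k" "Delta11_num m"
  shows "Sigma11 (\<lambda>e s. real (k e s) / 2 ^ m e s < measure M {Y. B (i e s) Y})"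
proof (rule Sigma11_inst3[where R = "\<lambda>i k m. real k / 2 ^ m < measure M {Y. B i Y}", OF _ assms(2-4)])
  obtain c where c': "\<And>z n Y. ipath (Tr (pr z (pr c n)) Y) 0 \<longleftrightarrow> B n (\<lambda>x. 0 < z \<and> Y x)"
    using universal_tree[OF B] by metis
  have c: "ipath (Tr (pr 1 (pr c n)) Y) 0 \<longleftrightarrow> B n Y" for n Y by (simp add: c')
  define K where "K V n = {Y. bsimul chain (Tr (pr 1 (pr c n)) Y) (\<lambda>t b t' b'. V (pr t' b')) 0 0}" for V n
  have KB: "K V n \<subseteq> {Y. B n Y}" for V n
    unfolding K_def using ipath_of_bsimul_chain c by blast
  have closed_K: "closed (K V n)" if "\<forall>t. \<exists>b. \<forall>x. V (pr t x) \<longrightarrow> x \<le> b" for V n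
    unfolding K_def
  proof (rule closed_bsimul_chain)
    show "finite {b'. V (pr t' b')}" for t' using that by (auto simp: finite_nat_set_iff_bounded_le)
  qed (rule clopen_Tr)
  have K_iff: "Y \<in> K V n \<longleftrightarrow> (\<exists>Z. Z (pr 0 0) \<and> (\<forall>t b. Z (pr t b) \<longrightarrow>
      (\<exists>b'. V (pr (Suc t) b') \<and> Tr (pr 1 (pr c n)) Y b b' \<and> Z (pr (Suc t) b'))))" for V n Y
  proof
    assume Y: "Y \<in> K V n"
    let ?S = "bsimul chain (Tr (pr 1 (pr c n)) Y) (\<lambda>t b t' b'. V (pr t' b'))"
    have "\<exists>b'. V (pr (Suc t) b') \<and> Tr (pr 1 (pr c n)) Y b b' \<and> ?S (Suc t) b'" if "?S t b" for t b
      using bsimul_step[OF that] by blast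
    then show "\<exists>Z. Z (pr 0 0) \<and> (\<forall>t b. Z (pr t b) \<longrightarrow>
      (\<exists>b'. V (pr (Suc t) b') \<and> Tr (pr 1 (pr c n)) Y b b' \<and> Z (pr (Suc t) b')))"
      using Y unfolding K_def
      by (intro exI[of _ "\<lambda>z. case prod_decode z of (t, b) \<Rightarrow> ?S t b"]) auto
  next
    assume "\<exists>Z. Z (pr 0 0) \<and> (\<forall>t b. Z (pr t b) \<longrightarrow>
      (\<exists>b'. V (pr (Suc t) b') \<and> Tr (pr 1 (pr c n)) Y b b' \<and> Z (pr (Suc t) b')))"
    then obtain Z where "Z (pr 0 0)" "\<forall>t b. Z (pr t b) \<longrightarrow>
      (\<exists>b'. V (pr (Suc t) b') \<and> Tr (pr 1 (pr c n)) Y b b' \<and> Z (pr (Suc t) b'))" by blast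
    then show "Y \<in> K V n"
      unfolding K_def by (auto intro!: bsimulI[where S = "\<lambda>t b. Z (pr t b)"])
  qed
  have eq: "real k / 2 ^ m < measure M {Y. B n Y} \<longleftrightarrow>
     (\<exists>V. (\<forall>t. \<exists>b. \<forall>x. V (pr t x) \<longrightarrow> x \<le> b) \<and> (\<exists>k' m'. k * 2 ^ m' < k' * 2 ^ m \<and>
       (\<forall>l. \<exists>N. k' * 2 ^ l \<le> N * 2 ^ m' \<and> (\<exists>W. (\<forall>i. i < N \<longrightarrow> (\<lambda>x. W (pr i x)) \<in> K V n) \<and>
          (\<forall>i i'. i < i' \<and> i' < N \<longrightarrow> (\<exists>j. j < l \<and> \<not> (W (pr i j) \<longleftrightarrow> W (pr i' j))))))))"
    (is "_ \<longleftrightarrow> ?R") for k m n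
  proof -
    have W: "(\<exists>W::cantor. (\<forall>i. i < N \<longrightarrow> (\<lambda>x. W (pr i x)) \<in> K V n) \<and>
          (\<forall>i i'. i < i' \<and> i' < N \<longrightarrow> (\<exists>j. j < l \<and> \<not> (W (pr i j) \<longleftrightarrow> W (pr i' j))))) \<longleftrightarrow>
       N \<le> card (truncations l (K V n))" for N l V
      unfolding card_truncations_ge_iff
    proof (intro iffI; elim exE)
      fix W :: "nat \<Rightarrow> cantor"
      assume "(\<forall>n'<N. W n' \<in> K V n) \<and> (\<forall>n n'. n < n' \<and> n' < N \<longrightarrow> (\<exists>j<l. \<not> (W n j \<longleftrightarrow> W n' j)))"
      then show "\<exists>W::cantor. (\<forall>i. i < N \<longrightarrow> (\<lambda>x. W (pr i x)) \<in> K V n) \<and>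
          (\<forall>i i'. i < i' \<and> i' < N \<longrightarrow> (\<exists>j. j < l \<and> \<not> (W (pr i j) \<longleftrightarrow> W (pr i' j))))"
        by (intro exI[of _ "\<lambda>z. case prod_decode z of (t, b) \<Rightarrow> W t b"]) simp
    next
      fix W :: cantor
      assume "(\<forall>i. i < N \<longrightarrow> (\<lambda>x. W (pr i x)) \<in> K V n) \<and>
          (\<forall>i i'. i < i' \<and> i' < N \<longrightarrow> (\<exists>j. j < l \<and> \<not> (W (pr i j) \<longleftrightarrow> W (pr i' j))))"
      then show "\<exists>W::nat \<Rightarrow> cantor. (\<forall>n'<N. W n' \<in> K V n) \<and> (\<forall>n n'. n < n' \<and> n' < N \<longrightarrow> (\<exists>j<l. \<not> (W n j \<longleftrightarrow> W n' j)))"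
        by (intro exI[of _ "\<lambda>i x. W (pr i x)"]) simp
    qed
    have count: "(\<exists>N. k' * 2 ^ l \<le> N * 2 ^ m' \<and> N \<le> C) \<longleftrightarrow> real k' / 2 ^ m' * 2 ^ l \<le> real C" for k' l m' C :: nat
    proof -
      have "(\<exists>N. k' * 2 ^ l \<le> N * 2 ^ m' \<and> N \<le> C) \<longleftrightarrow> k' * 2 ^ l \<le> C * 2 ^ m'"
        by (meson dual_order.trans mult_le_mono1 order_refl)
      also have "\<dots> \<longleftrightarrow> real (k' * 2 ^ l) \<le> real (C * 2 ^ m')" by (simp only: of_nat_le_iff)
      also have "\<dots> \<longleftrightarrow> real k' / 2 ^ m' * 2 ^ l \<le> real C" by (simp add: field_simps)
      finally show ?thesis .
    qed
    have less: "k * 2 ^ m' < k' * 2 ^ m \<longleftrightarrow> real k / 2 ^ m < real k' / 2 ^ m'" for k' m'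
    proof -
      have "k * 2 ^ m' < k' * 2 ^ m \<longleftrightarrow> real (k * 2 ^ m') < real (k' * 2 ^ m)" by (simp only: of_nat_less_iff)
      also have "\<dots> \<longleftrightarrow> real k / 2 ^ m < real k' / 2 ^ m'" by (simp add: field_simps)
      finally show ?thesis .
    qed
    have "?R \<longleftrightarrow> (\<exists>V. (\<forall>t. \<exists>b. \<forall>x. V (pr t x) \<longrightarrow> x \<le> b) \<and>
       (\<exists>k' m'. real k / 2 ^ m < real k' / 2 ^ m' \<and> real k' / 2 ^ m' \<le> measure M (K V n)))"
      unfolding W count less
      by (intro ex_cong1 conj_cong refl) (simp add: measure_closed_ge_iff[OF closed_K])
    also have "\<dots> \<longleftrightarrow> real k / 2 ^ m < measure M {Y. B n Y}"
    proof
      assume "\<exists>V. (\<forall>t. \<exists>b. \<forall>x. V (pr t x) \<longrightarrow> x \<le> b) \<and>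
       (\<exists>k' m'. real k / 2 ^ m < real k' / 2 ^ m' \<and> real k' / 2 ^ m' \<le> measure M (K V n))"
      then obtain V where "real k / 2 ^ m < measure M (K V n)"
        by (meson less_le_trans)
      moreover have "measure M (K V n) \<le> measure M {Y. B n Y}"
        by (rule CM.finite_measure_mono[OF KB sets_Sigma11[OF B]])
      ultimately show "real k / 2 ^ m < measure M {Y. B n Y}" by simp
    next
      assume less: "real k / 2 ^ m < measure M {Y. B n Y}"
      obtain k' m' where k': "real k / 2 ^ m < real k' / 2 ^ m'" "real k' / 2 ^ m' < measure M {Y. B n Y}"
        using dyadic_between[OF _ less] by auto
      have "ennreal (real k' / 2 ^ m') < outer_measure_of M {Y. ipath (Tr (pr 1 (pr c n)) Y) 0}"
        unfolding c outer_measure_of_eq[OF sets_Sigma11[OF B]] CM.emeasure_eq_measure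
        using k' by (intro ennreal_lessI) (auto intro: le_less_trans[of 0 "real k' / 2 ^ m'"])
      from analytic_approx[OF clopen_Tr(2) this] obtain v where v:
        "real k' / 2 ^ m' \<le> measure M {Y. bsimul chain (Tr (pr 1 (pr c n)) Y) (\<lambda>t b t' b'. b' \<le> v t') 0 0}"
        by blast
      define V where "V z = (case prod_decode z of (t, b) \<Rightarrow> b \<le> v t)" for z
      have "K V n = {Y. bsimul chain (Tr (pr 1 (pr c n)) Y) (\<lambda>t b t' b'. b' \<le> v t') 0 0}"
        by (simp add: K_def V_def)
      then show "\<exists>V. (\<forall>t. \<exists>b. \<forall>x. V (pr t x) \<longrightarrow> x \<le> b) \<and>
       (\<exists>k' m'. real k / 2 ^ m < real k' / 2 ^ m' \<and> real k' / 2 ^ m' \<le> measure M (K V n))"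
        using k' v by (intro exI[of _ V]) (auto simp: V_def)
    qed
    finally show ?thesis by blast
  qed
  show "Sigma11 (\<lambda>e s. real (e (Suc 0)) / 2 ^ e (Suc (Suc 0)) < measure M {Y. B (e 0) Y})"
    unfolding eq K_iff
    by (intro Sigma11_intros; (rule Sigma11_Delta11)?; intro Delta11_intros Delta11_num_power2 Delta11_Tr Delta11_real_slice)
qed

section \<open>Closed inner approximations\<close>

text \<open>Independence of the real lets one condition on nodes serve for all \<open>Y\<close> at
  once, as required of the invariant \<open>G\<close> in \<open>closed_bsimul\<close>;
  well-foundedness gives access to \<open>not_simul_iff\<close>.\<close>

definition stable :: "nat \<Rightarrow> nat \<Rightarrow> bool" where
  "stable i t \<longleftrightarrow> (\<forall>Y. Tr i Y = Tr i (\<lambda>_. False)) \<and> \<not> ipath (Tr i (\<lambda>_. False)) t"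

lemma stable_step: "stable i t \<Longrightarrow> Tr i Y t t' \<Longrightarrow> stable i t'"
  unfolding stable_def using ipath_unfold[of "Tr i (\<lambda>_. False)" t] by metis

lemma stable_no_ipath: "stable i t \<Longrightarrow> \<not> ipath (Tr i Y) t"
  unfolding stable_def by metis

lemma stable_step2:
  "stable i t \<or> stable j b \<Longrightarrow> Tr i Y t t' \<Longrightarrow> Tr j Y b b' \<Longrightarrow> stable i t' \<or> stable j b'"
  using stable_step by blast

lemma not_simul_Tr_iff:
  "stable i t \<or> stable j b \<Longrightarrow>
   \<not> simul (Tr i Y) (Tr j Y) t b \<longleftrightarrow> (\<exists>t'. Tr i Y t t' \<and> simul (Tr j Y) (Tr i Y) b t')"
  using not_simul_iff stable_no_ipath by blast

text \<open>For pairs with a stable component, the points for which all answers \<open>b' \<le> w\<close> to the move \<open>t'\<close> fail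
  although some answer is correct. Failure of an answer is expressed in its dual, \<open>\<Sigma>\<^sup>1\<^sub>1\<close> form.\<close>

definition gap :: "nat \<Rightarrow> nat \<Rightarrow> nat \<Rightarrow> nat \<Rightarrow> nat \<Rightarrow> nat \<Rightarrow> cantor set" where
  "gap i j t b t' w = {Y. Tr i Y t t' \<and> (\<exists>b'. Tr j Y b b' \<and> simul (Tr i Y) (Tr j Y) t' b') \<and>
     (\<forall>b'. b' \<le> w \<longrightarrow> \<not> Tr j Y b b' \<or> (\<exists>t''. Tr i Y t' t'' \<and> simul (Tr j Y) (Tr i Y) b' t''))}"

text \<open>For pairs with a stable component this says that \<open>b'\<close> is at most the least
  \<open>w\<close> whose gap is small (\<open>inner_cutoff\<close>), phrased through lower bounds on
  measures because those are \<open>Sigma11\<close>. The thresholds, taken over all codes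
  \<open>pr t (pr b t')\<close>, sum to \<open>1 / 2 ^ m\<close>.\<close>

definition inner_bound :: "nat \<Rightarrow> nat \<Rightarrow> nat \<Rightarrow> nat \<Rightarrow> nat \<Rightarrow> nat \<Rightarrow> nat \<Rightarrow> bool" where
  "inner_bound i j m t b t' b' \<longleftrightarrow>
     (\<forall>w. w < b' \<longrightarrow> real 1 / 2 ^ (m + Suc (pr t (pr b t'))) < measure M (gap i j t b t' w))"

definition inner :: "nat \<Rightarrow> nat \<Rightarrow> nat \<Rightarrow> nat \<Rightarrow> nat \<Rightarrow> cantor set" where
  "inner i j m s a = {Y. bsimul (Tr i Y) (Tr j Y) (inner_bound i j m) s a}"

lemma inner_subset: "inner i j m s a \<subseteq> {Y. simul (Tr i Y) (Tr j Y) s a}"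
  unfolding inner_def using bsimul_mono by blast

text \<open>The six parameters are packed into one number because \<open>Sigma11_measure\<close>
  treats families with a single index.\<close>

lemma Sigma11_gap:
  "Sigma11 (\<lambda>e s. \<exists>i j t b t' w. e 0 = pr i (pr j (pr t (pr b (pr t' w)))) \<and> s 0 \<in> gap i j t b t' w)"
  unfolding gap_def mem_Collect_eq
  by (intro Sigma11_intros Sigma11_bsimul_Tr; (rule Sigma11_Delta11)?; intro Delta11_intros Delta11_Tr)

lemma sets_gap [measurable]: "gap i j t b t' w \<in> sets M"
  using sets_Sigma11[OF Sigma11_gap, of "pr i (pr j (pr t (pr b (pr t' w))))"] by simp

lemma Sigma11_inner_bound:
  assumes "Delta11_num i" "Delta11_num j" "Delta11_num m" "Delta11_num t" "Delta11_num b" "Delta11_num t'" "Delta11_num b'"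
  shows "Sigma11 (\<lambda>e s. inner_bound (i e s) (j e s) (m e s) (t e s) (b e s) (t' e s) (b' e s))"
proof -
  have shift: "Delta11_num f \<Longrightarrow> Delta11_num (\<lambda>e s. f (sh e) s)" for f
    using Delta11_num_ren[where r = Suc and q = "\<lambda>j. j"] by simp
  have "Sigma11 (\<lambda>e s. real (Suc 0) / 2 ^ (m e s + Suc (pr (t e s) (pr (b e s) (t' e s)))) <
     measure M {Y. \<exists>i' j' t'' b'' t''' w'. pr (i e s) (pr (j e s) (pr (t e s) (pr (b e s) (pr (t' e s) (w e s))))) =
       pr i' (pr j' (pr t'' (pr b'' (pr t''' w')))) \<and> Y \<in> gap i' j' t'' b'' t''' w'})"
    if "Delta11_num i" "Delta11_num j" "Delta11_num m" "Delta11_num t" "Delta11_num b" "Delta11_num t'" "Delta11_num w" for i j m t b t' w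
    by (rule Sigma11_measure[OF Sigma11_gap]) (intro Delta11_num_intros that)+
  then have meas: "Sigma11 (\<lambda>e s. real (Suc 0) / 2 ^ (m e s + Suc (pr (t e s) (pr (b e s) (t' e s)))) <
     measure M (gap (i e s) (j e s) (t e s) (b e s) (t' e s) (w e s)))"
    if "Delta11_num i" "Delta11_num j" "Delta11_num m" "Delta11_num t" "Delta11_num b" "Delta11_num t'" "Delta11_num w" for i j m t b t' w
    using that by simp
  show ?thesis
    unfolding inner_bound_def One_nat_def
    by (intro Sigma11_all Sigma11_imp meas Delta11_less Delta11_num_var shift assms)
qed

lemma Sigma11_inner:
  assumes "Delta11_num i" "Delta11_num j" "Delta11_num m" "Delta11_num t" "Delta11_num a" "Delta11_real F"
  shows "Sigma11 (\<lambda>e s. F e s \<in> inner (i e s) (j e s) (m e s) (t e s) (a e s))"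
proof -
  have eq: "Y \<in> inner i j m t a \<longleftrightarrow> (\<exists>Z. Z (pr t a) \<and> (\<forall>t b t'. Z (pr t b) \<and> Tr i Y t t' \<longrightarrow>
     (\<exists>b'. inner_bound i j m t b t' b' \<and> Tr j Y b b' \<and> Z (pr t' b'))))" for i j m t a Y
  proof
    assume Y: "Y \<in> inner i j m t a"
    let ?S = "bsimul (Tr i Y) (Tr j Y) (inner_bound i j m)"
    show "\<exists>Z. Z (pr t a) \<and> (\<forall>t b t'. Z (pr t b) \<and> Tr i Y t t' \<longrightarrow>
     (\<exists>b'. inner_bound i j m t b t' b' \<and> Tr j Y b b' \<and> Z (pr t' b')))"
      using bsimul_step[of "Tr i Y" "Tr j Y" "inner_bound i j m"] Y unfolding inner_def
      by (intro exI[of _ "\<lambda>z. case prod_decode z of (t, b) \<Rightarrow> ?S t b"]) auto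
  next
    assume "\<exists>Z. Z (pr t a) \<and> (\<forall>t b t'. Z (pr t b) \<and> Tr i Y t t' \<longrightarrow>
     (\<exists>b'. inner_bound i j m t b t' b' \<and> Tr j Y b b' \<and> Z (pr t' b')))"
    then obtain Z where "Z (pr t a)" "\<forall>t b t'. Z (pr t b) \<and> Tr i Y t t' \<longrightarrow>
     (\<exists>b'. inner_bound i j m t b t' b' \<and> Tr j Y b b' \<and> Z (pr t' b'))" by blast
    then show "Y \<in> inner i j m t a"
      unfolding inner_def by (auto intro!: bsimulI[where S = "\<lambda>t b. Z (pr t b)"])
  qed
  have "Sigma11 (\<lambda>e s. s 0 \<in> inner (e 0) (e (Suc 0)) (e (Suc (Suc 0))) (e (Suc (Suc (Suc 0)))) (e (Suc (Suc (Suc (Suc 0))))))"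
    unfolding eq by (intro Sigma11_intros Sigma11_inner_bound; (rule Sigma11_Delta11)?; intro Delta11_intros Delta11_Tr)
  from Sigma11_inst[of "\<lambda>a b c d f F. F \<in> inner a b c d f", OF this assms] show ?thesis .
qed

lemma sets_simul_Tr [measurable]: "{Y. simul (Tr i Y) (Tr j Y) s a} \<in> sets M"
  using sets_Sigma11[of "\<lambda>n Y. simul (Tr i Y) (Tr j Y) s a" 0] by (simp add: Sigma11_bsimul_Tr Delta11_num_intros)

text \<open>The gaps decrease in \<open>w\<close> and have empty intersection: a point in all of
  them has a correct answer \<open>b'\<close>, which the gap at \<open>w = b'\<close> declares
  wrong. Stability is what makes the two contradict each other.\<close>

lemma inner_cutoff:
  assumes G: "stable i t \<or> stable j b"
  obtains w where "measure M (gap i j t b t' w) \<le> 1 / 2 ^ (m + Suc (pr t (pr b t')))"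
    "\<And>b'. inner_bound i j m t b t' b' \<longleftrightarrow> b' \<le> w"
proof -
  let ?e = "1 / 2 ^ (m + Suc (pr t (pr b t'))) :: real"
  have "(\<Inter>w. gap i j t b t' w) = {}"
  proof (rule ccontr)
    assume "\<not> ?thesis"
    then obtain Y where Y: "\<And>w. Y \<in> gap i j t b t' w" by blast
    then obtain b' where b': "Tr i Y t t'" "Tr j Y b b'" "simul (Tr i Y) (Tr j Y) t' b'"
      unfolding gap_def by blast
    then have "stable i t' \<or> stable j b'" using stable_step2[OF G] by blast
    moreover have "\<exists>t''. Tr i Y t' t'' \<and> simul (Tr j Y) (Tr i Y) b' t''"
      using Y[of b'] b' unfolding gap_def by blast
    ultimately show False using not_simul_Tr_iff b' by blast
  qed
  moreover have "decseq (gap i j t b t')"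
    unfolding decseq_def gap_def by (auto dest: order_trans)
  then have "(\<lambda>w. measure M (gap i j t b t' w)) \<longlonglongrightarrow> measure M (\<Inter>w. gap i j t b t' w)"
    by (intro CM.finite_Lim_measure_decseq) auto
  ultimately have "eventually (\<lambda>w. measure M (gap i j t b t' w) < ?e) sequentially"
    by (intro order_tendstoD(2)) auto
  then obtain w where w: "measure M (gap i j t b t' w) \<le> ?e"
    by (meson eventually_happens less_imp_le sequentially_bot)
  define v where "v = (LEAST w. measure M (gap i j t b t' w) \<le> ?e)"
  have v: "measure M (gap i j t b t' v) \<le> ?e" unfolding v_def using w by (rule LeastI)
  have below: "?e < measure M (gap i j t b t' w)" if "w < v" for w
    using not_less_Least[of w "\<lambda>w. measure M (gap i j t b t' w) \<le> ?e"] that unfolding v_def by auto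
  have "inner_bound i j m t b t' b' \<longleftrightarrow> b' \<le> v" for b'
  proof
    assume "inner_bound i j m t b t' b'"
    then have "\<not> v < b'" using v unfolding inner_bound_def by fastforce
    then show "b' \<le> v" by simp
  next
    assume "b' \<le> v"
    then show "inner_bound i j m t b t' b'" using below unfolding inner_bound_def by simp
  qed
  with v show ?thesis using that by blast
qed

lemma closed_inner:
  assumes "stable i s \<or> stable j a"
  shows "closed (inner i j m s a)"
  unfolding inner_def
proof (rule closed_bsimul[where G = "\<lambda>t b. stable i t \<or> stable j b" and P = "Tr i" and Q = "Tr j"])
  fix t b t' assume "stable i t \<or> stable j b"
  then obtain w where "\<And>b'. inner_bound i j m t b t' b' \<longleftrightarrow> b' \<le> w"
    using inner_cutoff by metis
  then show "finite {b'. inner_bound i j m t b t' b'}" by simp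
qed (use assms stable_step2 in \<open>blast intro: clopen_Tr\<close>)+

lemma sets_inner:
  "stable i s \<or> stable j a \<Longrightarrow> inner i j m s a \<in> sets M"
  by (intro closed_in_sets_cantor_measure closed_inner)

lemma null_sets_iff: "A \<in> sets M \<Longrightarrow> A \<in> null_sets M \<longleftrightarrow> measure M A = 0"
  by (simp add: null_sets_def CM.emeasure_eq_measure)

lemma null_sets_mono: "A \<in> null_sets M \<Longrightarrow> B \<subseteq> A \<Longrightarrow> B \<in> null_sets M"
  using CM.complete null_sets_subset by blast

lemma measure_UN_le:
  assumes T: "\<And>n. T n \<in> sets M" "\<And>n::nat. measure M (T n) \<le> 1 / 2 ^ (m + Suc n)"
  shows "measure M (\<Union>n. T n) \<le> 1 / 2 ^ m"
proof -
  have sum: "(\<lambda>n. 1 / 2 ^ (m + Suc n) :: real) sums (1 / 2 ^ m)"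
    using sums_mult[OF power_half_series, of "1 / 2 ^ m"] by (simp add: power_add power_one_over mult_ac)
  have summable: "summable (\<lambda>n. measure M (T n))"
    by (rule summable_comparison_test[OF _ sums_summable[OF sum]]) (use T in auto)
  have "measure M (\<Union>n. T n) \<le> (\<Sum>n. measure M (T n))"
    using T summable by (intro CM.finite_measure_subadditive_countably) auto
  also have "\<dots> \<le> (\<Sum>n. 1 / 2 ^ (m + Suc n))"
    by (rule suminf_le[OF T(2) summable sums_summable[OF sum]])
  also have "\<dots> = 1 / 2 ^ m" using sum by (simp add: sums_iff)
  finally show ?thesis .
qed

lemma null_sets_of_le_dyadic:
  assumes "N \<in> sets M" "\<And>m. measure M N \<le> 1 / 2 ^ m"
  shows "N \<in> null_sets M"
proof -
  have "(\<lambda>m. 1 / 2 ^ m :: real) \<longlonglongrightarrow> 0"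
    using LIMSEQ_power_zero[of "1/2 :: real"] by (simp add: power_one_over)
  then have "measure M N \<le> 0" using assms(2) by (intro LIMSEQ_le_const) auto
  then show ?thesis using assms(1) measure_nonneg[of M N] by (simp add: null_sets_iff)
qed

text \<open>A point outside all gaps taken at their cutoffs has, at each pair of the simulation and
  each move, a correct answer within the bound. Hence it wins the bounded game, and the loss is at
  most the sum of the thresholds.\<close>

lemma measure_simul_minus_inner:
  assumes G: "stable i s \<or> stable j a"
  shows "measure M ({Y. simul (Tr i Y) (Tr j Y) s a} - inner i j m s a) \<le> 1 / 2 ^ m"
proof -
  let ?G = "\<lambda>t b. stable i t \<or> stable j b"
  have "\<forall>t b t'. \<exists>w. ?G t b \<longrightarrow> measure M (gap i j t b t' w) \<le> 1 / 2 ^ (m + Suc (pr t (pr b t'))) \<and>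
    (\<forall>b'. inner_bound i j m t b t' b' \<longleftrightarrow> b' \<le> w)"
    using inner_cutoff by metis
  then obtain w where w: "\<And>t b t'. ?G t b \<Longrightarrow> measure M (gap i j t b t' (w t b t')) \<le> 1 / 2 ^ (m + Suc (pr t (pr b t')))"
     "\<And>t b t' b'. ?G t b \<Longrightarrow> inner_bound i j m t b t' b' \<longleftrightarrow> b' \<le> w t b t'"
    by metis
  \<comment> \<open>Cutoffs are available only at pairs with a stable component, so \<open>T\<close>
    is empty elsewhere; play from \<open>s\<close> and \<open>a\<close> never leaves such
    pairs.\<close>
  define T where "T n = (case prod_decode n of (t, u) \<Rightarrow> case prod_decode u of (b, t') \<Rightarrow>
     if ?G t b then gap i j t b t' (w t b t') else {})" for n
  have T: "T n \<in> sets M" "measure M (T n) \<le> 1 / 2 ^ (m + Suc n)" for n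
  proof -
    obtain t u where n: "n = pr t u" by (rule pr_cases)
    obtain b t' where u: "u = pr b t'" by (rule pr_cases)
    show "T n \<in> sets M" "measure M (T n) \<le> 1 / 2 ^ (m + Suc n)"
      using w(1)[of t b t'] by (auto simp: T_def n u)
  qed
  have sub: "{Y. simul (Tr i Y) (Tr j Y) s a} - inner i j m s a \<subseteq> (\<Union>n. T n)"
  proof (rule ccontr)
    assume "\<not> ?thesis"
    then obtain Y where Y: "simul (Tr i Y) (Tr j Y) s a" "Y \<notin> inner i j m s a" "\<And>n. Y \<notin> T n" by blast
    have no_gap: "Y \<notin> gap i j t b t' (w t b t')" if "?G t b" for t b t'
      using Y(3)[of "pr t (pr b t')"] that by (simp add: T_def)
    have "Y \<in> inner i j m s a"
      unfolding inner_def mem_Collect_eq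
    proof (rule bsimulI[where S = "\<lambda>t b. ?G t b \<and> simul (Tr i Y) (Tr j Y) t b"])
      show "?G s a \<and> simul (Tr i Y) (Tr j Y) s a" using G Y by blast
      fix t b t' assume t: "?G t b \<and> simul (Tr i Y) (Tr j Y) t b" "Tr i Y t t'"
      then obtain b1 where "Tr j Y b b1" "simul (Tr i Y) (Tr j Y) t' b1"
        using bsimul_step[of "Tr i Y" "Tr j Y" "\<lambda>_ _ _ _. True" t b] by blast
      then obtain b' where b': "b' \<le> w t b t'" "Tr j Y b b'" 
          "\<not> (\<exists>t''. Tr i Y t' t'' \<and> simul (Tr j Y) (Tr i Y) b' t'')"
        using no_gap[of t b t'] t unfolding gap_def by blast
      have "?G t' b'" using stable_step2 t b' by blast
      moreover have "simul (Tr i Y) (Tr j Y) t' b'" using not_simul_Tr_iff[OF \<open>?G t' b'\<close>] b' by blast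
      ultimately show "\<exists>b'. inner_bound i j m t b t' b' \<and> Tr j Y b b' \<and> ?G t' b' \<and> simul (Tr i Y) (Tr j Y) t' b'"
        using w(2)[of t b] t b' by blast
    qed
    then show False using Y by blast
  qed
  have "measure M ({Y. simul (Tr i Y) (Tr j Y) s a} - inner i j m s a) \<le> measure M (\<Union>n. T n)"
    using T by (intro CM.finite_measure_mono sub) auto
  also have "\<dots> \<le> 1 / 2 ^ m" by (rule measure_UN_le[OF T])
  finally show ?thesis .
qed

lemma null_simul_minus_inner:
  assumes G: "stable i s \<or> stable j a"
  shows "{Y. simul (Tr i Y) (Tr j Y) s a} - (\<Union>m. inner i j m s a) \<in> null_sets M"
proof -
  let ?N = "{Y. simul (Tr i Y) (Tr j Y) s a} - (\<Union>m. inner i j m s a)"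
  have N: "?N \<in> sets M" by (intro sets.Diff sets_simul_Tr sets.countable_UN) (use sets_inner[OF G] in auto)
  show ?thesis
  proof (rule null_sets_of_le_dyadic[OF N])
    fix m
    have "measure M ?N \<le> measure M ({Y. simul (Tr i Y) (Tr j Y) s a} - inner i j m s a)"
      by (rule CM.finite_measure_mono) (auto intro!: sets.Diff sets_simul_Tr sets_inner G)
    then show "measure M ?N \<le> 1 / 2 ^ m" using measure_simul_minus_inner[OF G, of m] by linarith
  qed
qed

section \<open>Randomness and genericity\<close>

lemma Tr_diag: "Tr (pr 0 (pr e e)) Y = tree e"
  unfolding tree_def by (rule Tr_no_input)

lemma stable_diag: "stable (pr 0 (pr e e)) a \<longleftrightarrow> \<not> ipath (tree e) a"
  unfolding stable_def Tr_diag by simp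

lemma measure_diag:
  assumes "Sigma11 (\<lambda>e s. B (e 0) (s 0))"
  shows "\<not> (\<forall>e. \<not> ipath (tree e) 0 \<longleftrightarrow> real k / 2 ^ m < measure M {Y. B e Y})"
proof
  assume eq: "\<forall>e. \<not> ipath (tree e) 0 \<longleftrightarrow> real k / 2 ^ m < measure M {Y. B e Y}"
  have "Sigma11 (\<lambda>e s. real k / 2 ^ m < measure M {Y. B (e 0) Y})"
    by (rule Sigma11_measure[OF assms]) (intro Delta11_num_intros)+
  then have "Sigma11 (\<lambda>e s. \<not> ipath (tree (e 0)) 0)" by (simp add: eq)
  then show False using wellfounded_trees_not_Sigma11 by blast
qed

lemma Sigma11_class_tree:
  assumes "Sigma11 (\<lambda>e s. s 0 \<in> A)"
  shows "\<exists>i. \<forall>Y. Y \<in> A \<longleftrightarrow> ipath (Tr i Y) 0"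
proof -
  obtain c where "\<And>z n Y. ipath (Tr (pr z (pr c n)) Y) 0 \<longleftrightarrow> (\<lambda>x. 0 < z \<and> Y x) \<in> A"
    using universal_tree[of "\<lambda>n Y. Y \<in> A", OF assms] by metis
  then show ?thesis by (intro exI[of _ "pr 1 (pr c 0)"]) simp
qed

lemma sets_Sigma11_class: "Sigma11 (\<lambda>e s. s 0 \<in> A) \<Longrightarrow> A \<in> sets M"
  using sets_Sigma11[of "\<lambda>n Y. Y \<in> A" 0] by simp

lemma sets_ipath_Tr: "{Y. ipath (Tr i Y) 0} \<in> sets M"
  by (rule sets_ipath) (rule clopen_Tr)

text \<open>Comparing with the measure of the ill-founded trees would make the set of well-founded trees \<open>\<Sigma>\<^sup>1\<^sub>1\<close>.\<close>

lemma null_large_rank: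
  "{Y. \<not> ipath (Tr i Y) 0 \<and> (\<forall>e. \<not> ipath (tree e) 0 \<longrightarrow> simul (tree e) (Tr i Y) 0 0)} \<in> null_sets M"
  (is "?Z \<in> _")
proof -
  define W where "W = {Y. ipath (Tr i Y) 0}"
  define V where "V e = {Y. simul (Tr (pr 0 (pr e e)) Y) (Tr i Y) 0 0}" for e
  have W: "W \<in> sets M" unfolding W_def by (rule sets_ipath_Tr)
  have V: "V e \<in> sets M" for e unfolding V_def by (rule sets_simul_Tr)
  have "?Z = (UNIV - W) \<inter> (\<Inter>e. if ipath (tree e) 0 then UNIV else V e)"
    by (auto simp: W_def V_def Tr_diag split: if_splits)
  moreover have "(UNIV - W) \<inter> (\<Inter>e. if ipath (tree e) 0 then UNIV else V e) \<in> sets M"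
    using W V sets.top[of M] by (intro sets.Int sets.countable_INT' sets.Diff) auto
  ultimately have Z: "?Z \<in> sets M" by simp
  have "measure M ?Z = 0"
  proof (rule ccontr)
    assume "measure M ?Z \<noteq> 0"
    then have "measure M W < measure M W + measure M ?Z" using measure_nonneg[of M ?Z] by linarith
    \<comment> \<open>\<open>V e\<close> contains both \<open>W\<close> and \<open>?Z\<close> when
      \<open>tree e\<close> is well-founded and lies inside \<open>W\<close> otherwise. A dyadic
      number between the two measures therefore separates the cases.\<close>
    from dyadic_between[OF measure_nonneg this] obtain k m
      where km: "measure M W < real k / 2 ^ m" "real k / 2 ^ m < measure M W + measure M ?Z" by blast
    have "\<not> ipath (tree e) 0 \<longleftrightarrow> real k / 2 ^ m < measure M (V e)" for e
    proof
      assume wf: "\<not> ipath (tree e) 0"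
      have "measure M W + measure M ?Z = measure M (W \<union> ?Z)"
        by (rule CM.finite_measure_Union[symmetric]) (use W Z in \<open>auto simp: W_def\<close>)
      also have "\<dots> \<le> measure M (V e)"
        using wf by (intro CM.finite_measure_mono V) (auto simp: W_def V_def Tr_diag simul_of_ipath)
      finally show "real k / 2 ^ m < measure M (V e)" using km by simp
    next
      assume less: "real k / 2 ^ m < measure M (V e)"
      show "\<not> ipath (tree e) 0"
      proof
        assume "ipath (tree e) 0"
        then have "V e \<subseteq> W" by (auto simp: W_def V_def Tr_diag intro: ipath_simul)
        then show False using CM.finite_measure_mono[of "V e" W] W km less by simp
      qed
    qed
    moreover have "Sigma11 (\<lambda>e s. simul (Tr (pr 0 (pr (e 0) (e 0))) (s 0)) (Tr i (s 0)) 0 0)"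
      by (intro Sigma11_bsimul_Tr Delta11_num_intros)
    note measure_diag[of "\<lambda>e Y. simul (Tr (pr 0 (pr e e)) Y) (Tr i Y) 0 0", OF this, of k m]
    ultimately show False by (simp add: V_def)
  qed
  then show ?thesis using Z by (simp add: null_sets_iff)
qed

section \<open>From randomness to genericity\<close>

theorem Pi11_random_imp_generic:
  assumes X: "Pi11_random X"
  shows "Solovay_Sigma11_generic X"
  unfolding Solovay_Sigma11_generic_def
proof (intro allI impI)
  fix F assume F: "uniformly_Sigma11 F \<and> (\<forall>n. closed (F n) \<and> emeasure M (F n) > 0)"
  show "(\<exists>n. X \<in> F n) \<or>
        (\<exists>G. Sigma11_class G \<and> closed G \<and> emeasure M G > 0 \<and> G \<inter> (\<Union>n. F n) = {} \<and> X \<in> G)"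
  proof (cases "\<exists>n. X \<in> F n")
    case False
    have avoid: "X \<notin> A" if "Sigma11 (\<lambda>e s. s 0 \<notin> A)" "A \<in> null_sets M" for A
      using X that unfolding Pi11_random_def Pi11_class_iff by blast
    have "Sigma11 (\<lambda>e s. \<exists>n. s 0 \<in> F n)"
      by (intro Sigma11_ex) (use F in \<open>simp add: uniformly_Sigma11_iff\<close>)
    then have "Sigma11 (\<lambda>e s. s 0 \<in> (\<Union>n. F n))" by simp
    then obtain i where "\<forall>Y. Y \<in> (\<Union>n. F n) \<longleftrightarrow> ipath (Tr i Y) 0"
      using Sigma11_class_tree by blast
    then have i: "Y \<in> (\<Union>n. F n) \<longleftrightarrow> ipath (Tr i Y) 0" for Y by blast
    define A where "A = {Y. \<not> ipath (Tr i Y) 0 \<and>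
      (\<forall>e a. \<not> (simul (Tr (pr 0 (pr e e)) Y) (Tr i Y) a 0 \<and> simul (Tr i Y) (Tr (pr 0 (pr e e)) Y) 0 a))}"
    have "Sigma11 (\<lambda>e s. ipath (Tr i (s 0)) 0 \<or> (\<exists>d a. simul (Tr (pr 0 (pr d d)) (s 0)) (Tr i (s 0)) a 0 \<and>
        simul (Tr i (s 0)) (Tr (pr 0 (pr d d)) (s 0)) 0 a))"
      by (intro Sigma11_intros Sigma11_ipath_Tr Sigma11_bsimul_Tr Delta11_num_intros)
    then have "Sigma11 (\<lambda>e s. s 0 \<notin> A)" by (simp add: A_def)
    moreover have "A \<in> null_sets M"
      by (rule null_sets_mono[OF null_large_rank[of i]])
        (use same_rank_node in \<open>fastforce simp: A_def Tr_diag\<close>)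
    ultimately have "X \<notin> A" by (rule avoid)
    moreover have X_wf: "\<not> ipath (Tr i X) 0" using False i[of X] by blast
    ultimately obtain e a where e: "simul (tree e) (Tr i X) a 0" "simul (Tr i X) (tree e) 0 a"
      unfolding A_def Tr_diag by blast
    define j where "j = pr 0 (pr e e)"
    have st: "stable i 0 \<or> stable j a"
      using X_wf e(1) ipath_simul unfolding j_def stable_diag by blast
    then have wf: "\<not> ipath (tree e) a"
      using X_wf e(1) ipath_simul by blast
    define V where "V = {Y. simul (Tr i Y) (Tr j Y) 0 a}"
    have XV: "X \<in> V" using e by (simp add: V_def j_def Tr_diag)
    have dual: "Y \<notin> V \<longleftrightarrow> (\<exists>t. Tr i Y 0 t \<and> simul (Tr j Y) (Tr i Y) a t)" for Y
      unfolding V_def mem_Collect_eq by (rule not_simul_Tr_iff[OF st])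
    have V_co: "Sigma11 (\<lambda>e s. s 0 \<notin> V)"
      unfolding dual by (intro Sigma11_intros Sigma11_bsimul_Tr; (rule Sigma11_Delta11)?; intro Delta11_intros Delta11_Tr)
    have V_sets: "V \<in> sets M" unfolding V_def by (rule sets_simul_Tr)
    define K where "K m = inner i j m 0 a" for m
    have K: "closed (K m)" "K m \<in> sets M" "K m \<subseteq> V" for m
      using closed_inner[OF st] sets_inner[OF st] inner_subset by (auto simp: K_def V_def)
    have Sigma11_K: "Sigma11 (\<lambda>e s. s 0 \<in> K (f e s))" if "Delta11_num f" for f
      unfolding K_def by (intro Sigma11_inner Delta11_num_intros that)
    have "Sigma11 (\<lambda>e s. s 0 \<notin> V \<or> (\<exists>m. s 0 \<in> K m))"
      by (intro Sigma11_intros V_co Sigma11_K Delta11_num_intros)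
    then have "Sigma11 (\<lambda>e s. s 0 \<notin> V - (\<Union>m. K m))" by simp
    moreover have "V - (\<Union>m. K m) \<in> null_sets M"
      unfolding V_def K_def by (rule null_simul_minus_inner[OF st])
    ultimately have "X \<notin> V - (\<Union>m. K m)" by (rule avoid)
    then obtain m where m: "X \<in> K m" using XV by blast
    \<comment> \<open>By \<open>dual\<close> the complement of \<open>V\<close> is
      \<open>Sigma11\<close>, so a random real in \<open>V\<close> forbids \<open>V\<close> to be
      null.\<close>
    have "V \<notin> null_sets M" using avoid[OF V_co] XV by blast
    then have "0 < measure M V" using V_sets measure_nonneg[of M V] by (simp add: null_sets_iff less_le)
    then obtain m0 where m0: "1 / 2 ^ m0 < measure M V"
      using real_arch_pow_inv[of "measure M V" "1/2"] by (auto simp: power_one_over)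
    have "measure M V - measure M (K m0) = measure M (V - K m0)"
      by (rule CM.finite_measure_Diff[OF V_sets K(2,3), symmetric])
    also have "\<dots> \<le> 1 / 2 ^ m0" unfolding V_def K_def by (rule measure_simul_minus_inner[OF st])
    finally have pos: "0 < measure M (K m0)" using m0 by linarith
    \<comment> \<open>\<open>K m\<close> contains \<open>X\<close>, but it is only known to be
      \<open>Sigma11\<close>, so randomness does not directly give it positive measure;
      \<open>K m0\<close> supplies this.\<close>
    define G where "G = K m \<union> K m0"
    have "Sigma11 (\<lambda>e s. s 0 \<in> K m \<or> s 0 \<in> K m0)"
      by (intro Sigma11_intros Sigma11_K Delta11_num_intros)
    then have "Sigma11_class G" by (simp add: Sigma11_class_iff G_def)
    moreover have "closed G" using K by (auto simp: G_def)
    moreover have "measure M (K m0) \<le> measure M G"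
      using K by (intro CM.finite_measure_mono) (auto simp: G_def)
    then have "emeasure M G > 0" using pos by (simp add: CM.emeasure_eq_measure)
    moreover have "V \<inter> (\<Union>n. F n) = {}"
      using ipath_simul[of "Tr i _" 0 "Tr j _" a] wf i unfolding V_def j_def Tr_diag by blast
    then have "G \<inter> (\<Union>n. F n) = {}"
      using K(3)[of m] K(3)[of m0] unfolding G_def by blast
    moreover have "X \<in> G" using m by (simp add: G_def)
    ultimately show ?thesis by blast
  qed simp
qed

section \<open>From genericity to randomness\<close>

text \<open>Positivity of the measure of the members of the family costs nothing: add the cylinder of all \<open>Y\<close> with
  \<open>Y 0 \<noteq> X 0\<close>.\<close>

lemma generic_separation:
  assumes X: "Solovay_Sigma11_generic X"
    and F: "Sigma11 (\<lambda>e s. s 0 \<in> F (e 0))" "\<And>n. closed (F n)" "\<And>n. X \<notin> F n"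
  shows "\<exists>G. Sigma11 (\<lambda>e s. s 0 \<in> G) \<and> closed G \<and> 0 < measure M G \<and> (\<forall>n. G \<inter> F n = {}) \<and> X \<in> G"
proof -
  define C where "C = cyl 1 (\<lambda>_. \<not> X 0)"
  have "Sigma11 (\<lambda>e s. s 0 \<in> C)"
    unfolding C_def cyl_def by (cases "X 0") (auto intro!: Sigma11_Delta11 Delta11_intros)
  then have "Sigma11 (\<lambda>e s. s 0 \<in> F (e 0) \<or> s 0 \<in> C)" by (intro Sigma11_disj F)
  then have "uniformly_Sigma11 (\<lambda>n. F n \<union> C)" by (simp add: uniformly_Sigma11_iff)
  moreover have "closed (F n \<union> C)" for n using F(2) clopen_cyl by (auto simp: C_def)
  moreover have "emeasure M (F n \<union> C) > 0" for n
  proof -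
    have "0 < measure M C" by (simp add: C_def measure_cyl)
    then have "0 < emeasure M C" by (simp add: CM.emeasure_eq_measure)
    also have "\<dots> \<le> emeasure M (F n \<union> C)"
      using F(2) by (intro emeasure_mono) (auto simp: C_def closed_in_sets_cantor_measure)
    finally show ?thesis .
  qed
  moreover have "X \<notin> F n \<union> C" for n using F(3) by (auto simp: C_def cyl_def)
  ultimately obtain G where G: "Sigma11_class G" "closed G" "emeasure M G > 0" "G \<inter> (\<Union>n. F n \<union> C) = {}" "X \<in> G"
    using X unfolding Solovay_Sigma11_generic_def by (metis (no_types, lifting))
  show ?thesis
    by (rule exI[of _ G]) (use G in \<open>auto simp: Sigma11_class_iff CM.emeasure_eq_measure\<close>)
qed

text \<open>Up to a null set, the complement of the class is the union of closed approximations to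
  its dual form, one family for each child of \<open>s\<close>. A real in the class avoids them all,
  so genericity gives a class of positive measure that is almost contained in the original one; this
  cannot be null.\<close>

lemma generic_not_simul:
  assumes X: "Solovay_Sigma11_generic X"
    and st: "stable i s \<or> stable j a"
    and null: "{Y. simul (Tr i Y) (Tr j Y) s a} \<in> null_sets M"
  shows "\<not> simul (Tr i X) (Tr j X) s a"
proof
  assume sim: "simul (Tr i X) (Tr j X) s a"
  define F where "F n = {Y. \<exists>t m. n = pr t m \<and> Tr i Y s t \<and> Y \<in> inner j i m a t}" for n
  have dual: "\<not> simul (Tr i Y) (Tr j Y) s a \<longleftrightarrow> (\<exists>t. Tr i Y s t \<and> simul (Tr j Y) (Tr i Y) a t)" for Y
    by (rule not_simul_Tr_iff[OF st])
  have st': "stable j a \<or> stable i t" if "Tr i Y s t" for Y t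
    using st stable_step[OF _ that] by blast
  have F_pr: "F (pr t m) = {Y. Tr i Y s t} \<inter> inner j i m a t" for t m by (auto simp: F_def)
  have closed_F: "closed (F n)" for n
  proof -
    obtain t m where n: "n = pr t m" by (rule pr_cases)
    show ?thesis
    \<comment> \<open>Stability passes to \<open>t\<close> only if some \<open>Y\<close> has the
      edge; otherwise \<open>F n\<close> is empty.\<close>
    proof (cases "{Y. Tr i Y s t} = {}")
      case False
      then have "closed (inner j i m a t)" using st' by (intro closed_inner) blast
      then show ?thesis unfolding n F_pr by (intro closed_Int clopen_Tr)
    qed (simp add: n F_pr)
  qed
  have Sigma11_F: "Sigma11 (\<lambda>e s'. s' 0 \<in> F (e 0))"
    unfolding F_def mem_Collect_eq by (intro Sigma11_intros Sigma11_inner; (rule Sigma11_Delta11)?; intro Delta11_intros Delta11_Tr)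
  have X_F: "X \<notin> F n" for n
    using sim dual[of X] inner_subset[of j i] unfolding F_def by blast
  obtain G where G: "closed G" "0 < measure M G" "\<forall>n. G \<inter> F n = {}"
    using generic_separation[OF X Sigma11_F closed_F X_F] by blast
  define N where "N t = (if stable j a \<or> stable i t then
    {Y. simul (Tr j Y) (Tr i Y) a t} - (\<Union>m. inner j i m a t) else {})" for t
  have N: "N t \<in> null_sets M" for t
    unfolding N_def using null_simul_minus_inner[of j a i t] by auto
  have "G \<subseteq> {Y. simul (Tr i Y) (Tr j Y) s a} \<union> (\<Union>t. N t)"
  proof
    fix Y assume Y: "Y \<in> G"
    show "Y \<in> {Y. simul (Tr i Y) (Tr j Y) s a} \<union> (\<Union>t. N t)"
    proof (cases "simul (Tr i Y) (Tr j Y) s a")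
      case False
      then obtain t where t: "Tr i Y s t" "simul (Tr j Y) (Tr i Y) a t" using dual by blast
      have "Y \<notin> inner j i m a t" for m using G(3)[rule_format, of "pr t m"] Y t unfolding F_pr by blast
      then have "Y \<in> N t" using t st'[OF t(1)] by (simp add: N_def)
      then show ?thesis by blast
    qed simp
  qed
  moreover have "{Y. simul (Tr i Y) (Tr j Y) s a} \<union> (\<Union>t. N t) \<in> null_sets M"
    by (intro null_sets.Un null null_sets_UN N)
  ultimately have "G \<in> null_sets M" by (rule null_sets_mono[rotated])
  then show False using G by (simp add: null_sets_def CM.emeasure_eq_measure)
qed

text \<open>The class \<open>V e\<close> of reals whose tree has at least the rank of
  \<open>tree e\<close> contains \<open>N\<close>, and lies inside it when \<open>tree e\<close> is
  ill-founded. If all well-founded \<open>e\<close> gave positive measure, they would be separated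
  from the others. So some well-founded \<open>e\<close> gives a null \<open>V e\<close>, to which
  \<open>generic_not_simul\<close> applies.\<close>

lemma generic_avoids_null_Sigma11:
  assumes X: "Solovay_Sigma11_generic X" and N: "Sigma11 (\<lambda>e s. s 0 \<in> N)" "N \<in> null_sets M"
  shows "X \<notin> N"
proof
  assume "X \<in> N"
  obtain i where i: "\<forall>Y. Y \<in> N \<longleftrightarrow> ipath (Tr i Y) 0" using Sigma11_class_tree[OF N(1)] by blast
  define V where "V e = {Y. simul (Tr (pr 0 (pr e e)) Y) (Tr i Y) 0 0}" for e
  have V: "V e \<in> sets M" for e unfolding V_def by (rule sets_simul_Tr)
  have "Sigma11 (\<lambda>e s. simul (Tr (pr 0 (pr (e 0) (e 0))) (s 0)) (Tr i (s 0)) 0 0)"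
    by (intro Sigma11_bsimul_Tr Delta11_num_intros)
  from measure_diag[of "\<lambda>e Y. simul (Tr (pr 0 (pr e e)) Y) (Tr i Y) 0 0", OF this, of 0 0]
  obtain e where e: "ipath (tree e) 0 \<longleftrightarrow> 0 < measure M (V e)" unfolding V_def by auto
  have "\<not> ipath (tree e) 0"
  proof
    assume path: "ipath (tree e) 0"
    then have "V e \<subseteq> N" by (auto simp: V_def Tr_diag i intro: ipath_simul)
    then have "V e \<in> null_sets M" using N(2) null_sets_mono by blast
    then show False using e path V by (simp add: null_sets_iff)
  qed
  moreover from this have "V e \<in> null_sets M"
    using e V measure_nonneg[of M "V e"] by (simp add: null_sets_iff)
  ultimately have "\<not> simul (Tr (pr 0 (pr e e)) X) (Tr i X) 0 0"
    unfolding V_def by (intro generic_not_simul[OF X]) (simp_all add: stable_diag)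
  moreover have "ipath (Tr i X) 0" using \<open>X \<in> N\<close> i by simp
  ultimately show False using simul_of_ipath by blast
qed

theorem generic_imp_Pi11_random:
  assumes X: "Solovay_Sigma11_generic X"
  shows "Pi11_random X"
  unfolding Pi11_random_def
proof
  assume "\<exists>A. Pi11_class A \<and> A \<in> null_sets M \<and> X \<in> A"
  then obtain A where A: "Pi11_class A" "A \<in> null_sets M" "X \<in> A" by blast
  from A(1) have "Sigma11 (\<lambda>e s. s 0 \<in> - A)" by (simp add: Pi11_class_iff)
  then obtain i where "\<forall>Y. Y \<in> - A \<longleftrightarrow> ipath (Tr i Y) 0" using Sigma11_class_tree by blast
  then have i: "Y \<in> A \<longleftrightarrow> \<not> ipath (Tr i Y) 0" for Y by blast
  have no_path: "\<not> ipath (Tr i X) 0" using A i by blast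
  define Bad where "Bad t \<longleftrightarrow> (\<forall>e. \<not> ipath (tree e) 0 \<longrightarrow> simul (tree e) (Tr i X) 0 t)" for t
  have "Bad 0"
    unfolding Bad_def
  proof (intro allI impI, rule ccontr)
    \<comment> \<open>A failure at \<open>e\<close> bounds the rank of the tree of \<open>X\<close>
      by that of a node \<open>r\<close> of a well-founded tree. Reals with this bound all lie in
      the null class \<open>A\<close>, against \<open>generic_not_simul\<close>.\<close>
    fix e assume e: "\<not> ipath (tree e) 0" "\<not> simul (tree e) (Tr i X) 0 0"
    then obtain r where r: "tree e 0 r" "simul (Tr i X) (tree e) 0 r" using not_simulD by blast
    have wf: "\<not> ipath (tree e) r" using e(1) r(1) ipath_unfold[of "tree e" 0] by blast
    have "{Y. simul (Tr i Y) (Tr (pr 0 (pr e e)) Y) 0 r} \<subseteq> A"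
      using ipath_simul wf i unfolding Tr_diag by blast
    then have "{Y. simul (Tr i Y) (Tr (pr 0 (pr e e)) Y) 0 r} \<in> null_sets M"
      using A(2) null_sets_mono by blast
    then have "\<not> simul (Tr i X) (Tr (pr 0 (pr e e)) X) 0 r"
      using wf by (intro generic_not_simul[OF X]) (simp_all add: stable_diag)
    then show False using r by (simp add: Tr_diag)
  qed
  have "Bad 0 \<longrightarrow> (\<exists>t. Bad t \<and> (\<forall>t'. Tr i X t t' \<longrightarrow> \<not> Bad t'))"
    using no_path by (induction rule: no_ipath_induct) blast
  then obtain t where t: "Bad t" "\<And>t'. Tr i X t t' \<Longrightarrow> \<not> Bad t'" using \<open>Bad 0\<close> by blast
  \<comment> \<open>The approximation for \<open>e\<close> may lose
    \<open>1 / 2 ^ (m + Suc e)\<close>, so the loss over all \<open>e\<close> together is at most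
    \<open>1 / 2 ^ m\<close>. Ill-founded \<open>e\<close> are exempted by a disjunct that is
    \<open>Sigma11\<close>.\<close>
  define F where "F n = {Y. \<exists>t' m. n = pr t' m \<and> Tr i Y t t' \<and>
    (\<forall>e. ipath (tree e) 0 \<or> Y \<in> inner (pr 0 (pr e e)) i (m + Suc e) 0 t')}" for n
  have F_pr: "F (pr t' m) = {Y. Tr i Y t t'} \<inter>
      (\<Inter>e. if ipath (tree e) 0 then UNIV else inner (pr 0 (pr e e)) i (m + Suc e) 0 t')" for t' m
    by (auto simp: F_def)
  have closed_F: "closed (F n)" for n
  proof -
    obtain t' m where n: "n = pr t' m" by (rule pr_cases)
    show ?thesis
      unfolding n F_pr by (intro closed_Int closed_INT ballI clopen_Tr) (simp add: closed_inner stable_diag)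
  qed
  have Sigma11_F: "Sigma11 (\<lambda>e s. s 0 \<in> F (e 0))"
    unfolding F_def mem_Collect_eq tree_def
    by (intro Sigma11_intros Sigma11_inner Sigma11_ipath_Tr; (rule Sigma11_Delta11)?; intro Delta11_intros Delta11_Tr)
  have X_F: "X \<notin> F n" for n
  proof
    assume "X \<in> F n"
    then obtain t' m where t': "Tr i X t t'"
      "\<And>e. ipath (tree e) 0 \<or> X \<in> inner (pr 0 (pr e e)) i (m + Suc e) 0 t'" unfolding F_def by blast
    then obtain e where "\<not> ipath (tree e) 0" "\<not> simul (tree e) (Tr i X) 0 t'"
      using t(2) unfolding Bad_def by blast
    then show False using t'(2)[of e] inner_subset[of "pr 0 (pr e e)" i "m + Suc e" 0 t'] by (auto simp: Tr_diag)
  qed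
  obtain G where G: "Sigma11 (\<lambda>e s. s 0 \<in> G)" "closed G" "\<forall>n. G \<inter> F n = {}" "X \<in> G"
    using generic_separation[OF X Sigma11_F closed_F X_F] by blast
  have G_sets: "G \<in> sets M" using G(2) by (rule closed_in_sets_cantor_measure)
  define S where "S t' = {Y. Y \<in> G \<and> Tr i Y t t' \<and> (\<forall>e. \<not> ipath (tree e) 0 \<longrightarrow> simul (tree e) (Tr i Y) 0 t')}" for t'
  \<comment> \<open>Points of \<open>S t'\<close> avoid every \<open>F (pr t' m)\<close>, so for
    each \<open>m\<close> they fall into the total loss at level \<open>m\<close>.\<close>
  have S: "S t' \<in> null_sets M" for t'
  proof -
    define D where "D m e = (if ipath (tree e) 0 then {} else
       {Y. simul (Tr (pr 0 (pr e e)) Y) (Tr i Y) 0 t'} - inner (pr 0 (pr e e)) i (m + Suc e) 0 t')" for m e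
    have D: "D m e \<in> sets M" "measure M (D m e) \<le> 1 / 2 ^ (m + Suc e)" for m e
      using sets_inner[of "pr 0 (pr e e)" 0 i t'] measure_simul_minus_inner[of "pr 0 (pr e e)" 0 i t' "m + Suc e"]
      by (auto simp: D_def stable_diag sets_simul_Tr)
    have sub: "S t' \<subseteq> (\<Union>e. D m e)" for m
    proof
      fix Y assume Y: "Y \<in> S t'"
      then have "Y \<notin> F (pr t' m)" using G(3) by (auto simp: S_def)
      then obtain e where "\<not> ipath (tree e) 0" "Y \<notin> inner (pr 0 (pr e e)) i (m + Suc e) 0 t'"
        using Y by (auto simp: F_pr S_def split: if_splits)
      then have "Y \<in> D m e" using Y by (simp add: D_def S_def Tr_diag)
      then show "Y \<in> (\<Union>e. D m e)" by blast
    qed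
    have "(\<Inter>m. \<Union>e. D m e) \<in> null_sets M"
    proof (rule null_sets_of_le_dyadic)
      show sets: "(\<Inter>m. \<Union>e. D m e) \<in> sets M"
        using D(1) by (intro sets.countable_INT' sets.countable_UN) auto
      fix m
      have "measure M (\<Inter>m. \<Union>e. D m e) \<le> measure M (\<Union>e. D m e)"
        using D(1) by (intro CM.finite_measure_mono) auto
      also have "\<dots> \<le> 1 / 2 ^ m" by (rule measure_UN_le[OF D])
      finally show "measure M (\<Inter>m. \<Union>e. D m e) \<le> 1 / 2 ^ m" .
    qed
    then show ?thesis by (rule null_sets_mono) (use sub in blast)
  qed
  define N where "N = {Y. Y \<in> G \<and> (\<forall>e. ipath (tree e) 0 \<or> simul (Tr (pr 0 (pr e e)) Y) (Tr i Y) 0 t)}"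
  have Sigma11_N: "Sigma11 (\<lambda>e s. s 0 \<in> N)"
    unfolding N_def mem_Collect_eq tree_def by (intro Sigma11_intros G(1) Sigma11_ipath_Tr Sigma11_bsimul_Tr Delta11_num_intros)
  have XN: "X \<in> N" using t(1) G(4) by (auto simp: N_def Bad_def Tr_diag)
  define B where "B e Y \<longleftrightarrow> Y \<in> G \<and> simul (Tr (pr 0 (pr e e)) Y) (Tr i Y) 0 t" for e Y
  have Sigma11_B: "Sigma11 (\<lambda>e s. B (e 0) (s 0))"
    unfolding B_def by (intro Sigma11_intros G(1) Sigma11_bsimul_Tr Delta11_num_intros)
  have B_sets: "{Y. B e Y} \<in> sets M" for e by (rule sets_Sigma11[OF Sigma11_B])
  have "N \<in> null_sets M"
  proof (rule ccontr)
    assume "N \<notin> null_sets M"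
    then have N_pos: "0 < measure M N"
      using sets_Sigma11_class[OF Sigma11_N] measure_nonneg[of M N] by (simp add: null_sets_iff less_le)
    \<comment> \<open>If \<open>tree e\<close> is well-founded, its class contains \<open>N\<close>.
      If it has a path, so does some child \<open>t'\<close> of \<open>t\<close> in the tree of
      \<open>Y\<close>; such a child exceeds every \<open>tree e\<close>, which puts
      \<open>Y\<close> into the null class \<open>S t'\<close>.\<close>
    have "\<not> ipath (tree e) 0 \<longleftrightarrow> 0 < measure M {Y. B e Y}" for e
    proof
      assume "\<not> ipath (tree e) 0"
      then have "measure M N \<le> measure M {Y. B e Y}"
        by (intro CM.finite_measure_mono B_sets) (auto simp: N_def B_def)
      then show "0 < measure M {Y. B e Y}" using N_pos by simp
    next
      assume pos: "0 < measure M {Y. B e Y}"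
      show "\<not> ipath (tree e) 0"
      proof
        assume "ipath (tree e) 0"
        then obtain r where r: "tree e 0 r" "ipath (tree e) r" using ipath_unfold[of "tree e" 0] by blast
        have "{Y. B e Y} \<subseteq> (\<Union>t'. S t')"
        proof
          fix Y assume "Y \<in> {Y. B e Y}"
          then have Y: "Y \<in> G" "simul (tree e) (Tr i Y) 0 t" by (auto simp: B_def Tr_diag)
          obtain t' where t': "Tr i Y t t'" "simul (tree e) (Tr i Y) r t'"
            using bsimul_step[OF Y(2) r(1)] by blast
          have "ipath (Tr i Y) t'" by (rule ipath_simul[OF r(2) t'(2)])
          then have "Y \<in> S t'" using Y t' by (simp add: S_def simul_of_ipath)
          then show "Y \<in> (\<Union>t'. S t')" by blast
        qed
        moreover have "(\<Union>t'. S t') \<in> null_sets M" by (intro null_sets_UN S)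
        ultimately have "{Y. B e Y} \<in> null_sets M" by (rule null_sets_mono[rotated])
        then show False using pos B_sets by (simp add: null_sets_iff)
      qed
    qed
    then show False using measure_diag[OF Sigma11_B, of 0 0] by simp
  qed
  then show False using generic_avoids_null_Sigma11[OF X Sigma11_N] XN by blast
qed

theorem theorem1p6:
  fixes X :: cantor
  shows "Solovay_Sigma11_generic X \<longleftrightarrow> Pi11_random X"
  using Pi11_random_imp_generic generic_imp_Pi11_random by blast

end
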